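(* Let $\alpha\in(0,1)$ and assume that Condition $\mathcal R$ (stated in the context) holds. Define $$ \delta_\varepsilon=\left[\int_0^T\left(\frac{\sigma(x_t)}{S_0(x_t)}\right)^2\mathrm dt\right]^{-2}\int_0^T\left(\frac{X_t-x_t}{\varepsilon\,S_0(x_t)^2}\right)^2\sigma(x_t)^2\,\mathrm dt, $$ $$ \gamma_\varepsilon=\left[\int_0^T\left(\frac{\sigma(x_t)}{S_0(x_t)}\right)^2\mathrm dt\right]^{-1/2}\sup_{0\le t\le T}\left|\frac{X_t-x_t}{\varepsilon\,S_0(x_t)}\right|, $$ and let $c_\alpha,b_\alpha$ be the solutions of $$ \mathbf P\left\{\int_0^1 w_v^2\,\mathrm dv>c_\alpha\right\}=\alpha,\qquad \mathbf P\left\{\sup_{0\le v\le 1}|w_v|>b_\alpha\right\}=\alpha, $$ where $w_v$, $0\le v\le 1$, is a standard Wiener process. Then the tests $\psi_\varepsilon=1_{\{\delta_\varepsilon>c_\alpha\}}$ and $\phi_\varepsilon=1_{\{\gamma_\varepsilon>b_\alpha\}}$ both belong to the class $\mathcal K_\alpha$ of tests of asymptotic size $\alpha$; that is, $\mathbf E_0\psi_\varepsilon=\alpha+o(1)$ and $\mathbf E_0\phi_\varepsilon=\alpha+o(1)$ as $\varepsilon\to0$.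
   Context: Fix $T>0$ and $x_0\in\mathbb R$. For $\varepsilon>0$ one observes the trajectory $X^\varepsilon=\{X_t,\,0\le t\le T\}$ of the solution of $$\mathrm dX_t=S(X_t)\,\mathrm dt+\varepsilon\,\sigma(X_t)\,\mathrm dW_t,\qquad X_0=x_0,\quad 0\le t\le T,$$ where $W$ is a standard Wiener process, $x_0$ is deterministic and $\sigma$ is known. The basic hypothesis is $\mathscr H_0: S(\cdot)=S_0(\cdot)$ with $S_0:\mathbb R\to\mathbb R$ a known function; $\mathbf P_0,\mathbf E_0$ denote probability and expectation under $\mathscr H_0$. Standing assumption: there is $L>0$ such that $|S_0(x)-S_0(y)|+|\sigma(x)-\sigma(y)|\le L|x-y|$ for all $x,y\in\mathbb R$ (so the equation under $\mathscr H_0$ has a unique strong solution). The function $\{x_t,\,0\le t\le T\}$ is the solution of the deterministic equation $\frac{\mathrm dx_t}{\mathrm dt}=S_0(x_t)$ on $[0,T]$ with initial value $x_0$. A test is a function $\psi_\varepsilon=\psi_\varepsilon(X^\varepsilon)$ of the observations, and $\mathcal K_\alpha=\{\psi_\varepsilon:\ \mathbf E_0\psi_\varepsilon(X^\varepsilon)=\alpha+o(1)\}$, where $o(1)$ refers to $\varepsilon\to0$. Condition $\mathcal R$: the function $S_0$ has two continuous bounded derivatives $S_0',S_0''$, the function $\sigma$ has one continuous bounded derivative $\sigma'$, and $S_0(x)>0$, $\sigma^2(x)>0$ for all $x\ge x_0$. *)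

theory Defs
  imports "HOL-Probability.Probability" "HOL-Library.Landau_Symbols"
begin

section \<open>Filtered probability spaces and the Wiener process\<close>

definition filtered_prob_space :: "'a measure \<Rightarrow> (real \<Rightarrow> 'a measure) \<Rightarrow> bool" where
  "filtered_prob_space M F \<longleftrightarrow>
     prob_space M \<and> filtration (space M) F \<and> (\<forall>t. subalgebra M (F t))"

definition natural_filtration ::
    "'a measure \<Rightarrow> real \<Rightarrow> (real \<Rightarrow> 'a \<Rightarrow> real) \<Rightarrow> real \<Rightarrow> 'a measure" where
  "natural_filtration M T W t =
     sigma (space M) {W s -` A \<inter> space M | s A. s \<in> {0..T} \<and> s \<le> t \<and> A \<in> sets borel}"

definition adapted :: "(real \<Rightarrow> 'a measure) \<Rightarrow> real \<Rightarrow> (real \<Rightarrow> 'a \<Rightarrow> real) \<Rightarrow> bool" where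
  "adapted F T X \<longleftrightarrow> (\<forall>t\<in>{0..T}. X t \<in> borel_measurable (F t))"

definition continuous_paths :: "'a measure \<Rightarrow> real \<Rightarrow> (real \<Rightarrow> 'a \<Rightarrow> real) \<Rightarrow> bool" where
  "continuous_paths M T X \<longleftrightarrow> (\<forall>\<omega>\<in>space M. continuous_on {0..T} (\<lambda>t. X t \<omega>))"

definition progressive :: "(real \<Rightarrow> 'a measure) \<Rightarrow> real \<Rightarrow> (real \<Rightarrow> 'a \<Rightarrow> real) \<Rightarrow> bool" where
  "progressive F T H \<longleftrightarrow>
     (\<forall>t\<in>{0..T}. (\<lambda>(s, \<omega>). H s \<omega>) \<in> borel_measurable (restrict_space borel {0..t} \<Otimes>\<^sub>M F t))"

text \<open>Standard Wiener process on \<open>[0, T]\<close> relative to the filtration \<open>F\<close>. The third argument of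
  \<^const>\<open>normal_density\<close> is the point, the second the standard deviation.\<close>

definition wiener_process ::
    "'a measure \<Rightarrow> (real \<Rightarrow> 'a measure) \<Rightarrow> real \<Rightarrow> (real \<Rightarrow> 'a \<Rightarrow> real) \<Rightarrow> bool" where
  "wiener_process M F T W \<longleftrightarrow>
     filtered_prob_space M F \<and> adapted F T W \<and> continuous_paths M T W \<and>
     (AE \<omega> in M. W 0 \<omega> = 0) \<and>
     (\<forall>s t. 0 \<le> s \<and> s < t \<and> t \<le> T \<longrightarrow>
        distributed M lborel (\<lambda>\<omega>. W t \<omega> - W s \<omega>) (\<lambda>x. ennreal (normal_density 0 (sqrt (t - s)) x)) \<and>
        prob_space.indep_set M (sets (F s))
          (sets (vimage_algebra (space M) (\<lambda>\<omega>. W t \<omega> - W s \<omega>) borel)))"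

definition standard_wiener_process ::
    "'a measure \<Rightarrow> real \<Rightarrow> (real \<Rightarrow> 'a \<Rightarrow> real) \<Rightarrow> bool" where
  "standard_wiener_process M T W \<longleftrightarrow> wiener_process M (natural_filtration M T W) T W"


section \<open>The It\^o integral\<close>

text \<open>A list of triples \<open>(a, b, \<xi>)\<close> encodes the simple process
  \<open>\<Sum> \<xi>(\<omega>) 1\<^bsub>(a, b]\<^esub>(t)\<close>; the intervals may overlap.\<close>

type_synonym 'a simple_process = "(real \<times> real \<times> ('a \<Rightarrow> real)) list"

definition is_simple_process ::
    "'a measure \<Rightarrow> (real \<Rightarrow> 'a measure) \<Rightarrow> real \<Rightarrow> 'a simple_process \<Rightarrow> bool" where
  "is_simple_process M F T ps \<longleftrightarrow>
     (\<forall>(a, b, \<xi>)\<in>set ps. 0 \<le> a \<and> a \<le> b \<and> b \<le> T \<and>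
        \<xi> \<in> borel_measurable (F a) \<and> bounded (\<xi> ` space M))"

definition simple_value :: "'a simple_process \<Rightarrow> real \<Rightarrow> 'a \<Rightarrow> real" where
  "simple_value ps t \<omega> = (\<Sum>(a, b, \<xi>)\<leftarrow>ps. \<xi> \<omega> * indicator {a<..b} t)"

definition simple_integral_wrt ::
    "(real \<Rightarrow> 'a \<Rightarrow> real) \<Rightarrow> 'a simple_process \<Rightarrow> real \<Rightarrow> 'a \<Rightarrow> real" where
  "simple_integral_wrt W ps t \<omega> =
     (\<Sum>(a, b, \<xi>)\<leftarrow>ps. \<xi> \<omega> * (W (min b t) \<omega> - W (min a t) \<omega>))"

text \<open>\<open>is_ito_integral M F T W H I\<close>: the process \<open>I\<close> is (a continuous version of)
  \<open>t \<mapsto> \<integral>\<^sub>0\<^sup>t H\<^sub>s dW\<^sub>s\<close> on \<open>[0, T]\<close>, where \<open>H\<close> is progressively measurable with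
  \<open>\<integral>\<^sub>0\<^sup>T H\<^sub>s\<^sup>2 ds < \<infinity>\<close> almost surely. The integral is the limit, in probability and uniformly in
  \<open>t\<close>, of the integrals of simple processes that converge to \<open>H\<close> in \<open>L\<^sup>2[0, T]\<close> in probability;
  this determines \<open>I\<close> up to indistinguishability. The integrals of squares are taken in
  \<^typ>\<open>ennreal\<close>, so that a divergent integral is not read as \<open>0\<close>.\<close>

definition is_ito_integral ::
    "'a measure \<Rightarrow> (real \<Rightarrow> 'a measure) \<Rightarrow> real \<Rightarrow> (real \<Rightarrow> 'a \<Rightarrow> real) \<Rightarrow>
     (real \<Rightarrow> 'a \<Rightarrow> real) \<Rightarrow> (real \<Rightarrow> 'a \<Rightarrow> real) \<Rightarrow> bool" where
  "is_ito_integral M F T W H I \<longleftrightarrow>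
     progressive F T H \<and>
     (AE \<omega> in M. (\<integral>\<^sup>+t\<in>{0..T}. ennreal ((H t \<omega>)\<^sup>2) \<partial>lborel) < \<infinity>) \<and>
     adapted F T I \<and> continuous_paths M T I \<and>
     (\<exists>ps. (\<forall>n::nat. is_simple_process M F T (ps n)) \<and>
        (\<forall>e>0. (\<lambda>n. measure M {\<omega>\<in>space M.
            (\<integral>\<^sup>+t\<in>{0..T}. ennreal ((simple_value (ps n) t \<omega> - H t \<omega>)\<^sup>2) \<partial>lborel) > ennreal e})
          \<longlonglongrightarrow> 0) \<and>
        (\<forall>e>0. (\<lambda>n. measure M {\<omega>\<in>space M.
            (SUP t\<in>{0..T}. \<bar>simple_integral_wrt W (ps n) t \<omega> - I t \<omega>\<bar>) > e})
          \<longlonglongrightarrow> 0))"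


section \<open>The diffusion, the limiting deterministic equation, and the conditions\<close>

text \<open>\<open>X\<close> solves \<open>dX\<^sub>t = b(X\<^sub>t) dt + s(X\<^sub>t) dW\<^sub>t\<close>, \<open>X\<^sub>0 = x0\<close>, on \<open>[0, T]\<close>.\<close>

definition sde_solution ::
    "'a measure \<Rightarrow> (real \<Rightarrow> 'a measure) \<Rightarrow> real \<Rightarrow> (real \<Rightarrow> 'a \<Rightarrow> real) \<Rightarrow>
     (real \<Rightarrow> real) \<Rightarrow> (real \<Rightarrow> real) \<Rightarrow> real \<Rightarrow> (real \<Rightarrow> 'a \<Rightarrow> real) \<Rightarrow> bool" where
  "sde_solution M F T W b s x0 X \<longleftrightarrow>
     adapted F T X \<and> continuous_paths M T X \<and>
     (AE \<omega> in M. set_integrable lborel {0..T} (\<lambda>t. b (X t \<omega>))) \<and>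
     (\<exists>I. is_ito_integral M F T W (\<lambda>t \<omega>. s (X t \<omega>)) I \<and>
        (AE \<omega> in M. \<forall>t\<in>{0..T}. X t \<omega> = x0 + (LINT u:{0..t}|lborel. b (X u \<omega>)) + I t \<omega>))"

definition ode_solution :: "real \<Rightarrow> (real \<Rightarrow> real) \<Rightarrow> real \<Rightarrow> (real \<Rightarrow> real) \<Rightarrow> bool" where
  "ode_solution T b x0 x \<longleftrightarrow>
     x 0 = x0 \<and> (\<forall>t\<in>{0..T}. (x has_real_derivative b (x t)) (at t within {0..T}))"

definition lipschitz_coefficients :: "(real \<Rightarrow> real) \<Rightarrow> (real \<Rightarrow> real) \<Rightarrow> bool" where
  "lipschitz_coefficients S0 \<sigma> \<longleftrightarrow>
     (\<exists>L>0. \<forall>x y. \<bar>S0 x - S0 y\<bar> + \<bar>\<sigma> x - \<sigma> y\<bar> \<le> L * \<bar>x - y\<bar>)"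

definition condition_R :: "(real \<Rightarrow> real) \<Rightarrow> (real \<Rightarrow> real) \<Rightarrow> real \<Rightarrow> bool" where
  "condition_R S0 \<sigma> x0 \<longleftrightarrow>
     (\<exists>S0' S0''.
        (\<forall>x. (S0 has_real_derivative S0' x) (at x)) \<and>
        (\<forall>x. (S0' has_real_derivative S0'' x) (at x)) \<and>
        continuous_on UNIV S0' \<and> continuous_on UNIV S0'' \<and>
        bounded (range S0') \<and> bounded (range S0'')) \<and>
     (\<exists>\<sigma>'.
        (\<forall>x. (\<sigma> has_real_derivative \<sigma>' x) (at x)) \<and>
        continuous_on UNIV \<sigma>' \<and> bounded (range \<sigma>')) \<and>
     (\<forall>x\<ge>x0. S0 x > 0 \<and> (\<sigma> x)\<^sup>2 > 0)"


section \<open>Tests and test statistics\<close>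

text \<open>The observation is the path restricted to \<open>[0, T]\<close>.\<close>

definition observation :: "real \<Rightarrow> (real \<Rightarrow> 'a \<Rightarrow> real) \<Rightarrow> 'a \<Rightarrow> real \<Rightarrow> real" where
  "observation T X \<omega> = restrict (\<lambda>t. X t \<omega>) {0..T}"

text \<open>A test is a family, indexed by the noise level, of functions of the observed path. The class
  consists of the tests of asymptotic size \<open>\<alpha>\<close> when \<open>X \<epsilon>\<close> is the observed process
  under the basic hypothesis. Integrability is required explicitly because the Bochner integral of
  a non-integrable function is \<open>0\<close>.\<close>

definition tests_of_size ::
    "'a measure \<Rightarrow> real \<Rightarrow> (real \<Rightarrow> real \<Rightarrow> 'a \<Rightarrow> real) \<Rightarrow> real \<Rightarrow>
     (real \<Rightarrow> (real \<Rightarrow> real) \<Rightarrow> real) set" where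
  "tests_of_size M T X \<alpha> =
     {\<psi>. (\<forall>\<epsilon>>0. integrable M (\<lambda>\<omega>. \<psi> \<epsilon> (observation T (X \<epsilon>) \<omega>))) \<and>
          (\<lambda>\<epsilon>. (LINT \<omega>|M. \<psi> \<epsilon> (observation T (X \<epsilon>) \<omega>)) - \<alpha>) \<in> o[at_right 0](\<lambda>_. 1)}"

definition delta_stat ::
    "real \<Rightarrow> (real \<Rightarrow> real) \<Rightarrow> (real \<Rightarrow> real) \<Rightarrow> (real \<Rightarrow> real) \<Rightarrow> real \<Rightarrow> (real \<Rightarrow> real) \<Rightarrow> real" where
  "delta_stat T S0 \<sigma> x \<epsilon> X =
     (LINT t:{0..T}|lborel. (\<sigma> (x t) / S0 (x t))\<^sup>2) powr (- 2) *
     (LINT t:{0..T}|lborel. ((X t - x t) / (\<epsilon> * (S0 (x t))\<^sup>2))\<^sup>2 * (\<sigma> (x t))\<^sup>2)"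

definition gamma_stat ::
    "real \<Rightarrow> (real \<Rightarrow> real) \<Rightarrow> (real \<Rightarrow> real) \<Rightarrow> (real \<Rightarrow> real) \<Rightarrow> real \<Rightarrow> (real \<Rightarrow> real) \<Rightarrow> real" where
  "gamma_stat T S0 \<sigma> x \<epsilon> X =
     (LINT t:{0..T}|lborel. (\<sigma> (x t) / S0 (x t))\<^sup>2) powr (- 1 / 2) *
     (SUP t\<in>{0..T}. \<bar>(X t - x t) / (\<epsilon> * S0 (x t))\<bar>)"

end

theory Submission
  imports Defs
begin

text \<open>Put \<open>g = \<sigma>(x\<^sub>t) / S\<^sub>0(x\<^sub>t)\<close>. As \<open>g\<close> is continuously differentiable, the Wiener integral
  \<open>Z\<^sub>t = \<integral>\<^sub>0\<^sup>t g dW\<close> can be defined path by path by partial integration. Integrating by parts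
  against \<open>1 / S\<^sub>0(x\<^sub>t)\<close> as well, \<open>(X\<^sub>t - x\<^sub>t) / (\<epsilon> S\<^sub>0(x\<^sub>t))\<close> becomes a continuous functional of the
  martingale part \<open>I / \<epsilon>\<close> of the equation plus a quadratic Taylor remainder. The only probabilistic
  estimate is the inequality
  \<open>P(\<exists>t. |I\<^sub>t - \<integral>\<^sub>0\<^sup>t h dW| > a and \<integral>\<^sub>0\<^sup>t (H - h)\<^sup>2 < b) \<le> 36 b / a\<^sup>2\<close> for \<open>I = \<integral> H dW\<close>, applied to
  \<open>H = \<epsilon> \<sigma>(X)\<close> and \<open>h = \<epsilon> \<sigma>(x)\<close>: outside an event of small probability, a first-exit argument and
  Gronwall's inequality keep \<open>X\<close> close to \<open>x\<close>, and the rescaled deviation is uniformly close to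
  \<open>Z\<close>.

  On a grid whose cells have equal mass for \<open>g\<^sup>2 dt\<close>, the mean value theorem yields weights that make
  the weighted increments of \<open>W\<close> independent and standard normal. Hence \<open>Z\<close>, run in the clock
  \<open>\<integral> g\<^sup>2 dt\<close>, and the Wiener process \<open>w\<close> have discretised functionals with the same law, and
  characteristic functions carry this over to the limit.

  Finally the limit laws have no atoms: conditionally on the increments after a small time \<open>s\<close>, the
  functionals are, up to a small error, a quadratic and a V-shaped function of \<open>w\<^sub>s\<close>, which has a
  bounded density.\<close>

section \<open>Paths on a compact interval\<close>

text \<open>The function \<open>1 / S0 (x t)\<close> is an integrating factor: along the
  deterministic solution its derivative is \<open>- S0' (x t)\<close> times itself, which cancels
  the linear part of the drift difference, so that at first order only the noise remains. The
  stochastic integral is given through the existence of approximating simple processes, so every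
  estimate for it is first proved for finite sums on a grid. It is under control only while X is
  near x, whereas X stays near x only if it is under control; hence the joint condition at one
  single time t in the Lenglart inequality. The factor 36 is 9 times 4: three squared errors of at
  most b each cost 3 * 3 * b, and the approximations use up half of the threshold a. The process w
  lives on a space of its own, so it can meet Z only through laws; the functionals of standard
  normal steps depend neither on a space nor on g and serve as the common reference. Convergence in
  probability passes to the probability of exceeding a level if the limit gives that level no mass,
  which is why atoms have to be excluded.\<close>

definition clamp_rat :: "real \<Rightarrow> nat \<Rightarrow> real" where
  "clamp_rat T n = max 0 (min T (real_of_rat (from_nat n)))"

lemma clamp_rat_in: "0 \<le> T \<Longrightarrow> clamp_rat T n \<in> {0..T}"
  by (auto simp: clamp_rat_def)

text \<open>Extended to the whole line by clamping, f is continuous, so the set where it exceeds c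
  is open and contains a rational. The points \<open>clamp_rat T n\<close> thus form a countable
  dense set of times, on which an event about some t in the interval becomes a countable
  union.\<close>

lemma ex_gt_iff_ex_clamp_rat_gt:
  fixes f :: "real \<Rightarrow> real"
  assumes T: "0 \<le> T" and f: "continuous_on {0..T} f"
  shows "(\<exists>t\<in>{0..T}. c < f t) \<longleftrightarrow> (\<exists>n. c < f (clamp_rat T n))"
proof
  assume "\<exists>t\<in>{0..T}. c < f t"
  then obtain t where t: "t \<in> {0..T}" "c < f t" by blast
  define g where "g = (\<lambda>s. f (max 0 (min T s)))"
  have "continuous_on UNIV g"
    unfolding g_def
    by (rule continuous_on_compose2[OF f]) (use T in \<open>auto intro!: continuous_intros\<close>)
  then have "open (g -` {c<..})"
    by (intro open_vimage) auto
  moreover have "t \<in> g -` {c<..}"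
    using t by (auto simp: g_def)
  ultimately obtain e where e: "e > 0" "ball t e \<subseteq> g -` {c<..}"
    by (meson open_contains_ball)
  obtain q where q: "t < real_of_rat q" "real_of_rat q < t + e"
    using of_rat_dense[of t "t + e"] e by auto
  then have "real_of_rat q \<in> ball t e"
    by (auto simp: dist_real_def)
  then have "c < g (real_of_rat q)"
    using e by auto
  moreover obtain n where "q = from_nat n"
    using surj_from_nat by blast
  ultimately show "\<exists>n. c < f (clamp_rat T n)"
    by (auto simp: g_def clamp_rat_def)
qed (use clamp_rat_in[OF T] in blast)

lemma less_SUP_Icc_iff:
  fixes f :: "real \<Rightarrow> real"
  assumes T: "0 \<le> T" and f: "continuous_on {0..T} f"
  shows "c < (SUP t\<in>{0..T}. f t) \<longleftrightarrow> (\<exists>t\<in>{0..T}. c < f t)"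
proof (rule less_cSUP_iff)
  show "{0..T} \<noteq> {}" using T by simp
  show "bdd_above (f ` {0..T})"
    by (intro bounded_imp_bdd_above compact_imp_bounded compact_continuous_image f compact_Icc)
qed

lemma le_SUP_Icc:
  fixes f :: "real \<Rightarrow> real"
  assumes "continuous_on {0..T} f" "t \<in> {0..T}"
  shows "f t \<le> (SUP t\<in>{0..T}. f t)"
proof -
  have "0 \<le> T" using assms(2) by auto
  show ?thesis
    using less_SUP_Icc_iff[OF \<open>0 \<le> T\<close> assms(1), of "SUP t\<in>{0..T}. f t"] assms(2)
    by (meson less_irrefl not_le)
qed

lemma SUP_Icc_le_iff:
  fixes f :: "real \<Rightarrow> real"
  assumes "0 \<le> T" "continuous_on {0..T} f"
  shows "(SUP t\<in>{0..T}. f t) \<le> c \<longleftrightarrow> (\<forall>t\<in>{0..T}. f t \<le> c)"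
  using less_SUP_Icc_iff[OF assms, of c] by (simp only: not_less[symmetric]) blast

lemma SUP_Icc_attained:
  fixes f :: "real \<Rightarrow> real"
  assumes "0 \<le> T" "continuous_on {0..T} f"
  obtains t where "t \<in> {0..T}" "f t = (SUP t\<in>{0..T}. f t)"
proof -
  obtain t where t: "t \<in> {0..T}" "\<forall>s\<in>{0..T}. f s \<le> f t"
    using continuous_attains_sup[of "{0..T}" f] assms by auto
  then have "f t = (SUP t\<in>{0..T}. f t)"
    using le_SUP_Icc[OF assms(2) t(1)] SUP_Icc_le_iff[OF assms, of "f t"] by (meson antisym)
  with t(1) show thesis by (rule that)
qed

lemma uniformly_continuous_IccD:
  fixes f :: "real \<Rightarrow> real"
  assumes f: "continuous_on {0..T} f" and e: "e > 0"
  obtains \<delta> where "\<delta> > 0"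
    "\<And>s t. s \<in> {0..T} \<Longrightarrow> t \<in> {0..T} \<Longrightarrow> \<bar>s - t\<bar> < \<delta> \<Longrightarrow> \<bar>f s - f t\<bar> \<le> e"
proof -
  have "uniformly_continuous_on {0..T} f"
    using compact_uniformly_continuous[OF f] by simp
  then obtain \<delta> where d: "\<delta> > 0"
    "\<forall>s\<in>{0..T}. \<forall>t\<in>{0..T}. dist t s < \<delta> \<longrightarrow> dist (f t) (f s) < e"
    using e unfolding uniformly_continuous_on_def by meson
  show thesis
  proof (rule that[OF d(1)])
    fix s t assume "s \<in> {0..T}" "t \<in> {0..T}" "\<bar>s - t\<bar> < \<delta>"
    then have "dist (f s) (f t) < e"
      using d(2) unfolding dist_real_def by blast
    then show "\<bar>f s - f t\<bar> \<le> e" by (simp add: dist_real_def)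
  qed
qed

lemma continuous_on_Icc_bound:
  fixes f :: "real \<Rightarrow> real"
  assumes "continuous_on {0..T} f"
  obtains K where "K > 0" "\<And>t. t \<in> {0..T} \<Longrightarrow> \<bar>f t\<bar> \<le> K"
proof -
  have "bounded (f ` {0..T})"
    using compact_continuous_image[OF assms compact_Icc] compact_imp_bounded by blast
  then show thesis
    using that by (auto simp: bounded_pos)
qed

lemma integral_Icc_diff:
  fixes f :: "real \<Rightarrow> real"
  assumes "continuous_on {0..T} f" "0 \<le> p" "p \<le> q" "q \<le> T"
  shows "integral {0..q} f - integral {0..p} f = integral {p..q} f"
proof -
  have "f integrable_on {0..q}"
    using assms by (intro integrable_continuous_real continuous_on_subset[OF assms(1)]) auto
  then show ?thesis
    using Henstock_Kurzweil_Integration.integral_combine[of 0 p q f] assms by auto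
qed

lemma grid_mono:
  fixes p :: "nat \<Rightarrow> real"
  assumes "\<And>i. i < n \<Longrightarrow> p i \<le> p (Suc i)" "i \<le> j" "j \<le> n"
  shows "p i \<le> p j"
  using assms(2,3)
proof (induction j)
  case (Suc j)
  then show ?case using assms(1)[of j] by (cases "i = Suc j") auto
qed simp

text \<open>The inequality \<open>p 0 \<le> p n\<close> is proved along with the sum because the
  induction step splits the integral at \<open>p n\<close>, which must lie to the right of
  \<open>p 0\<close>.\<close>

lemma integral_sum_grid:
  fixes f :: "real \<Rightarrow> real"
  assumes f: "continuous_on {0..T} f" and p: "\<And>i. i < n \<Longrightarrow> p i \<le> p (Suc i)" "0 \<le> p 0" "p n \<le> T"
  shows "(\<Sum>i<n. integral {p i..p (Suc i)} f) = integral {p 0..p n} f \<and> p 0 \<le> p n"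
  using p
proof (induction n)
  case 0
  then show ?case by simp
next
  case (Suc n)
  have le: "p n \<le> p (Suc n)" "p n \<le> T" using Suc.prems(1)[of n] Suc.prems(3) by auto
  have IH: "(\<Sum>i<n. integral {p i..p (Suc i)} f) = integral {p 0..p n} f \<and> p 0 \<le> p n"
    using Suc.prems le by (intro Suc.IH) auto
  have "f integrable_on {p 0..p (Suc n)}"
    using Suc.prems by (intro integrable_continuous_real continuous_on_subset[OF f]) auto
  then show ?case
    using Henstock_Kurzweil_Integration.integral_combine[of "p 0" "p n" "p (Suc n)" f] IH le by auto
qed

lemma integral_continuous_bound:
  fixes f :: "real \<Rightarrow> real"
  assumes "continuous_on {a..b} f" "a \<le> b" "\<And>t. t \<in> {a..b} \<Longrightarrow> \<bar>f t\<bar> \<le> B"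
  shows "\<bar>integral {a..b} f\<bar> \<le> B * (b - a)"
  using integral_bound[of a b f B] assms by auto

text \<open>The weight r is integrated exactly over each cell, so only the oscillation of f
  contributes. With r = 1 this gives ordinary Riemann sums on a uniform grid; with r the square of g
  it gives equal weights on a grid whose cells have equal mass.\<close>

lemma weighted_riemann_sum_error:
  fixes f r :: "real \<Rightarrow> real"
  assumes f: "continuous_on {0..T} f" and r: "continuous_on {0..T} r" "\<And>t. t \<in> {0..T} \<Longrightarrow> 0 \<le> r t"
    and p: "\<And>i. i < n \<Longrightarrow> p i \<le> p (Suc i)" "p 0 = 0" "p n = T"
    and p_in: "\<And>i. i \<le> n \<Longrightarrow> p i \<in> {0..T}"
    and osc: "\<And>i t. i < n \<Longrightarrow> t \<in> {p i..p (Suc i)} \<Longrightarrow> \<bar>f t - f (p (Suc i))\<bar> \<le> e"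
  shows "\<bar>integral {0..T} (\<lambda>t. f t * r t) - (\<Sum>i<n. f (p (Suc i)) * integral {p i..p (Suc i)} r)\<bar>
           \<le> e * integral {0..T} r"
proof -
  have fr: "continuous_on {0..T} (\<lambda>t. f t * r t)"
    by (intro continuous_intros f r)
  have "integral {0..T} (\<lambda>t. f t * r t) = (\<Sum>i<n. integral {p i..p (Suc i)} (\<lambda>t. f t * r t))"
    using integral_sum_grid[OF fr, of n p] p by auto
  then have "\<bar>integral {0..T} (\<lambda>t. f t * r t) - (\<Sum>i<n. f (p (Suc i)) * integral {p i..p (Suc i)} r)\<bar>
     = \<bar>\<Sum>i<n. integral {p i..p (Suc i)} (\<lambda>t. f t * r t) - f (p (Suc i)) * integral {p i..p (Suc i)} r\<bar>"
    by (simp add: sum_subtractf)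
  also have "\<dots> \<le> (\<Sum>i<n. \<bar>integral {p i..p (Suc i)} (\<lambda>t. f t * r t) - f (p (Suc i)) * integral {p i..p (Suc i)} r\<bar>)"
    by (rule sum_abs)
  also have "\<dots> \<le> (\<Sum>i<n. e * integral {p i..p (Suc i)} r)"
  proof (rule sum_mono)
    fix i assume "i \<in> {..<n}"
    then have i: "i < n" by simp
    have sub: "{p i..p (Suc i)} \<subseteq> {0..T}"
      using p_in[of i] p_in[of "Suc i"] i by auto
    have cr: "continuous_on {p i..p (Suc i)} r" "continuous_on {p i..p (Suc i)} f"
      using continuous_on_subset[OF r(1) sub] continuous_on_subset[OF f sub] by auto
    have "integral {p i..p (Suc i)} (\<lambda>t. f t * r t) - f (p (Suc i)) * integral {p i..p (Suc i)} r
       = integral {p i..p (Suc i)} (\<lambda>t. f t * r t) - integral {p i..p (Suc i)} (\<lambda>t. f (p (Suc i)) * r t)"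
      by simp
    also have "\<dots> = integral {p i..p (Suc i)} (\<lambda>t. f t * r t - f (p (Suc i)) * r t)"
      by (rule Henstock_Kurzweil_Integration.integral_diff[symmetric])
        (intro integrable_continuous_real continuous_intros cr)+
    also have "\<bar>\<dots>\<bar> \<le> integral {p i..p (Suc i)} (\<lambda>t. e * r t)"
    proof -
      have "norm (integral {p i..p (Suc i)} (\<lambda>t. f t * r t - f (p (Suc i)) * r t)) \<le> integral {p i..p (Suc i)} (\<lambda>t. e * r t)"
      proof (rule integral_norm_bound_integral)
        fix t assume t: "t \<in> {p i..p (Suc i)}"
        have "\<bar>(f t - f (p (Suc i))) * r t\<bar> \<le> e * r t"
          unfolding abs_mult using osc[OF i t] r(2)[of t] t sub by (intro mult_mono) auto
        then show "norm (f t * r t - f (p (Suc i)) * r t) \<le> e * r t"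
          by (simp add: algebra_simps)
      qed (intro integrable_continuous_real continuous_intros cr)+
      then show ?thesis by simp
    qed
    finally show "\<bar>integral {p i..p (Suc i)} (\<lambda>t. f t * r t) - f (p (Suc i)) * integral {p i..p (Suc i)} r\<bar>
        \<le> e * integral {p i..p (Suc i)} r" by simp
  qed
  also have "\<dots> = e * integral {0..T} r"
    using integral_sum_grid[OF r(1), of n p] p by (simp add: sum_distrib_left[symmetric])
  finally show ?thesis .
qed

section \<open>Integration by parts against a continuous path\<close>

definition C1_pair :: "real \<Rightarrow> (real \<Rightarrow> real) \<Rightarrow> (real \<Rightarrow> real) \<Rightarrow> bool" where
  "C1_pair T h h' \<longleftrightarrow>
     (\<forall>t\<in>{0..T}. (h has_real_derivative h' t) (at t within {0..T})) \<and> continuous_on {0..T} h'"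

text \<open>For a continuous path \<open>v\<close> and a \<open>C\<^sup>1\<close> integrand \<open>h\<close> this is \<open>\<integral>\<^sub>0\<^sup>t h dv\<close>, integrated by parts;
  it needs no stochastic integration when \<open>v\<close> is a Wiener path.\<close>

definition parts_integral :: "(real \<Rightarrow> real) \<Rightarrow> (real \<Rightarrow> real) \<Rightarrow> (real \<Rightarrow> real) \<Rightarrow> real \<Rightarrow> real" where
  "parts_integral h h' v t = h t * v t - h 0 * v 0 - integral {0..t} (\<lambda>s. h' s * v s)"

lemma C1_pair_continuous:
  assumes "C1_pair T h h'"
  shows "continuous_on {0..T} h"
proof (rule DERIV_continuous_on)
  fix t assume "t \<in> {0..T}"
  then show "(h has_real_derivative h' t) (at t within {0..T})"
    using assms by (simp add: C1_pair_def)
qed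

lemma C1_pair_continuous': "C1_pair T h h' \<Longrightarrow> continuous_on {0..T} h'"
  by (simp add: C1_pair_def)

lemma C1_pair_integral:
  assumes "C1_pair T h h'" "0 \<le> p" "p \<le> q" "q \<le> T"
  shows "integral {p..q} h' = h q - h p"
proof (rule integral_unique, rule fundamental_theorem_of_calculus[OF assms(3)])
  fix t assume t: "t \<in> {p..q}"
  then have "(h has_real_derivative h' t) (at t within {0..T})"
    using assms by (auto simp: C1_pair_def)
  then show "(h has_vector_derivative h' t) (at t within {p..q})"
    unfolding has_real_derivative_iff_has_vector_derivative[symmetric]
    by (rule DERIV_subset) (use assms in auto)
qed

lemma C1_pair_primitive:
  assumes "continuous_on {0..T} f"
  shows "C1_pair T (\<lambda>t. integral {0..t} f) f"
  unfolding C1_pair_def using integral_has_real_derivative[OF assms] assms by auto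

lemma C1_pair_mult:
  assumes "C1_pair T f f'" "C1_pair T h h'"
  shows "C1_pair T (\<lambda>t. f t * h t) (\<lambda>t. f' t * h t + f t * h' t)"
  unfolding C1_pair_def
proof (intro conjI ballI)
  show "continuous_on {0..T} (\<lambda>t. f' t * h t + f t * h' t)"
    by (intro continuous_intros C1_pair_continuous[OF assms(1)] C1_pair_continuous[OF assms(2)]
        C1_pair_continuous'[OF assms(1)] C1_pair_continuous'[OF assms(2)])
  fix t assume "t \<in> {0..T}"
  then show "((\<lambda>t. f t * h t) has_real_derivative f' t * h t + f t * h' t) (at t within {0..T})"
    using assms unfolding C1_pair_def by (auto intro!: derivative_eq_intros)
qed

lemma parts_integral_continuous:
  assumes "C1_pair T h h'" "continuous_on {0..T} v"
  shows "continuous_on {0..T} (parts_integral h h' v)"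
proof -
  have "continuous_on {0..T} (\<lambda>s. h' s * v s)"
    by (intro continuous_intros assms C1_pair_continuous'[OF assms(1)])
  then have "continuous_on {0..T} (\<lambda>t. integral {0..t} (\<lambda>s. h' s * v s))"
    using C1_pair_continuous[OF C1_pair_primitive] by blast
  then show ?thesis
    unfolding parts_integral_def
    by (intro continuous_intros assms C1_pair_continuous[OF assms(1)]) auto
qed

text \<open>Writing \<open>h q - h u\<close> and \<open>h u - h p\<close> as integrals of h' leaves
  only integrals of h' against differences of v inside the cell. The error is proportional to the
  length of the cell, so summed over a grid it stays of order e even if v has infinite
  variation.\<close>

lemma parts_integral_increment_error:
  assumes h: "C1_pair T h h'" and v: "continuous_on {0..T} v"
    and o: "0 \<le> p" "p \<le> u" "u \<le> q" "q \<le> T"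
    and K: "\<And>s. s \<in> {p..q} \<Longrightarrow> \<bar>h' s\<bar> \<le> K"
    and e: "\<And>s s'. s \<in> {p..q} \<Longrightarrow> s' \<in> {p..q} \<Longrightarrow> \<bar>v s - v s'\<bar> \<le> e"
  shows "\<bar>parts_integral h h' v q - parts_integral h h' v p - h u * (v q - v p)\<bar> \<le> K * e * (q - p)"
proof -
  have ch: "continuous_on {0..T} h'" using C1_pair_continuous'[OF h] .
  have chv: "continuous_on {0..T} (\<lambda>s. h' s * v s)"
    by (intro continuous_intros v ch)
  have piece: "integral {a..b} (\<lambda>s. h' s * (v z - v s)) = (h b - h a) * v z - integral {a..b} (\<lambda>s. h' s * v s)"
    if "0 \<le> a" "a \<le> b" "b \<le> T" for a b z
  proof -
    have "{a..b} \<subseteq> {0..T}" using that by auto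
    then have ci: "continuous_on {a..b} h'" "continuous_on {a..b} v"
      using ch v continuous_on_subset by blast+
    have "integral {a..b} (\<lambda>s. h' s * (v z - v s)) = integral {a..b} (\<lambda>s. h' s * v z - h' s * v s)"
      by (simp add: algebra_simps)
    also have "\<dots> = integral {a..b} (\<lambda>s. h' s * v z) - integral {a..b} (\<lambda>s. h' s * v s)"
      by (rule Henstock_Kurzweil_Integration.integral_diff) (intro integrable_continuous_real continuous_intros ci)+
    finally show ?thesis
      using C1_pair_integral[OF h that] by simp
  qed
  have bnd: "\<bar>integral {a..b} (\<lambda>s. h' s * (v z - v s))\<bar> \<le> K * e * (b - a)"
    if "p \<le> a" "a \<le> b" "b \<le> q" "z \<in> {p..q}" for a b z
  proof (rule integral_continuous_bound)
    have "{a..b} \<subseteq> {0..T}" using that o by auto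
    then show "continuous_on {a..b} (\<lambda>s. h' s * (v z - v s))"
      by (intro continuous_intros continuous_on_subset[OF ch] continuous_on_subset[OF v])
    fix t assume "t \<in> {a..b}"
    then have "t \<in> {p..q}" using that by auto
    then show "\<bar>h' t * (v z - v t)\<bar> \<le> K * e"
      unfolding abs_mult using K[of t] e[of z t] that by (intro mult_mono) auto
  qed (use that in auto)
  have "parts_integral h h' v q - parts_integral h h' v p - h u * (v q - v p)
     = (h q - h u) * v q + (h u - h p) * v p - integral {p..q} (\<lambda>s. h' s * v s)"
    unfolding parts_integral_def using integral_Icc_diff[OF chv, of p q] o by (simp add: algebra_simps)
  also have "integral {p..q} (\<lambda>s. h' s * v s) = integral {p..u} (\<lambda>s. h' s * v s) + integral {u..q} (\<lambda>s. h' s * v s)"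
    using integral_Icc_diff[OF chv, of p q] integral_Icc_diff[OF chv, of p u] integral_Icc_diff[OF chv, of u q] o by simp
  finally have eq: "parts_integral h h' v q - parts_integral h h' v p - h u * (v q - v p)
     = integral {u..q} (\<lambda>s. h' s * (v q - v s)) + integral {p..u} (\<lambda>s. h' s * (v p - v s))"
    using piece[of u q q] piece[of p u p] o by simp
  show ?thesis
    unfolding eq using bnd[of u q q] bnd[of p u p] o by (simp add: algebra_simps abs_le_iff)
qed

text \<open>The point \<open>u i\<close> has to lie in its cell only if the cell is nondegenerate:
  when a grid is stopped at a time t, the later cells collapse to t while the chosen node stays
  beyond t. Such a cell contributes nothing to either side.\<close>

lemma parts_integral_sum_error:
  assumes h: "C1_pair T h h'" and v: "continuous_on {0..T} v"
    and o: "0 \<le> p 0" "p n \<le> T" "\<And>i. i < n \<Longrightarrow> p i \<le> p (Suc i)"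
    and u: "\<And>i. i < n \<Longrightarrow> p i < p (Suc i) \<Longrightarrow> u i \<in> {p i..p (Suc i)}"
    and K: "\<And>s. s \<in> {0..T} \<Longrightarrow> \<bar>h' s\<bar> \<le> K"
    and e: "\<And>i s s'. i < n \<Longrightarrow> s \<in> {p i..p (Suc i)} \<Longrightarrow> s' \<in> {p i..p (Suc i)} \<Longrightarrow> \<bar>v s - v s'\<bar> \<le> e"
  shows "\<bar>parts_integral h h' v (p n) - parts_integral h h' v (p 0)
            - (\<Sum>i<n. h (u i) * (v (p (Suc i)) - v (p i)))\<bar> \<le> K * e * (p n - p 0) \<and> p 0 \<le> p n"
  using o u e
proof (induction n)
  case 0
  then show ?case by simp
next
  case (Suc n)
  have le: "p n \<le> p (Suc n)" "p n \<le> T" using Suc.prems(3)[of n] Suc.prems(2) by auto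
  have IH: "\<bar>parts_integral h h' v (p n) - parts_integral h h' v (p 0)
            - (\<Sum>i<n. h (u i) * (v (p (Suc i)) - v (p i)))\<bar> \<le> K * e * (p n - p 0) \<and> p 0 \<le> p n"
  proof (rule Suc.IH)
    show "\<bar>v s - v s'\<bar> \<le> e" if "i < n" "s \<in> {p i..p (Suc i)}" "s' \<in> {p i..p (Suc i)}" for i s s'
      using Suc.prems(5)[of i s s'] that by simp
  qed (use Suc.prems le in auto)
  have "\<bar>parts_integral h h' v (p (Suc n)) - parts_integral h h' v (p n) - h (u n) * (v (p (Suc n)) - v (p n))\<bar>
     \<le> K * e * (p (Suc n) - p n)"
  proof (cases "p n = p (Suc n)")
    case False
    then have "u n \<in> {p n..p (Suc n)}" using Suc.prems(4)[of n] le by simp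
    then show ?thesis
      using Suc.prems(1,2) IH
      by (intro parts_integral_increment_error[OF h v] K Suc.prems(5)[of n]) auto
  qed simp
  moreover have "K * e * (p (Suc n) - p 0) = K * e * (p n - p 0) + K * e * (p (Suc n) - p n)"
    by (simp add: algebra_simps)
  ultimately show ?case using IH le by (simp only: sum.lessThan_Suc) linarith
qed

section \<open>Pathwise analysis of the perturbed equation\<close>

text \<open>The right-hand side U of the hypothesis has derivative \<open>L * u t\<close>, which is
  at most \<open>L * U t\<close>, so \<open>exp (- L * t) * U t\<close> does not increase from its
  initial value C.\<close>

lemma gronwall_Icc:
  fixes u :: "real \<Rightarrow> real"
  assumes u: "continuous_on {0..T} u" and L: "0 \<le> L"
    and le: "\<And>t. t \<in> {0..T} \<Longrightarrow> u t \<le> C + L * integral {0..t} u"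
    and t: "t \<in> {0..T}"
  shows "u t \<le> C * exp (L * t)"
proof -
  define U where "U = (\<lambda>t. C + L * integral {0..t} u)"
  have U: "C1_pair T U (\<lambda>t. L * u t)"
    unfolding C1_pair_def U_def
    using C1_pair_primitive[OF u] by (auto simp: C1_pair_def intro!: derivative_eq_intros continuous_intros u)
  have E: "C1_pair T (\<lambda>t. exp (- L * t)) (\<lambda>t. - L * exp (- L * t))"
    unfolding C1_pair_def by (auto intro!: derivative_eq_intros continuous_intros)
  note EU = C1_pair_mult[OF E U]
  have "exp (- L * t) * U t - exp (- L * 0) * U 0
      = integral {0..t} (\<lambda>t. - L * exp (- L * t) * U t + exp (- L * t) * (L * u t))"
    using C1_pair_integral[OF EU, of 0 t] t by simp
  also have "\<dots> \<le> integral {0..t} (\<lambda>t. 0)"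
  proof (rule Henstock_Kurzweil_Integration.integral_le)
    have "{0..t} \<subseteq> {0..T}" using t by auto
    then show "(\<lambda>t. - L * exp (- L * t) * U t + exp (- L * t) * (L * u t)) integrable_on {0..t}"
      using integrable_continuous_real[OF continuous_on_subset[OF C1_pair_continuous'[OF EU]]] by blast
    show "(\<lambda>t. 0::real) integrable_on {0..t}" by (rule integrable_continuous_real) simp
    fix s assume "s \<in> {0..t}"
    then have "u s \<le> U s" using le[of s] t by (auto simp: U_def)
    then have "exp (- L * s) * L * (u s - U s) \<le> 0"
      using L by (intro mult_nonneg_nonpos) auto
    then show "- L * exp (- L * s) * U s + exp (- L * s) * (L * u s) \<le> 0"
      by (simp add: algebra_simps)
  qed
  finally have "exp (- L * t) * U t \<le> C" by (simp add: U_def)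
  then have "exp (L * t) * (exp (- L * t) * U t) \<le> exp (L * t) * C"
    by (intro mult_left_mono) auto
  then have "U t \<le> C * exp (L * t)"
    by (simp add: exp_minus field_simps)
  then show ?thesis using le[OF t] by (simp add: U_def)
qed

lemma integral_mult_const_C1:
  assumes "C1_pair T f f'" "0 \<le> t" "t \<le> T"
  shows "integral {0..t} (\<lambda>s. f' s * c) = (f t - f 0) * c"
  using C1_pair_integral[OF assms(1), of 0 t] assms by simp

text \<open>Associativity of the integral, \<open>f d(\<integral> h dv) = f h dv\<close>. Since
  everything is integrated by parts, it reduces to the ordinary product rule for f and the primitive
  H of \<open>h' * v\<close>. It identifies the limit of the rescaled deviation as the Wiener
  integral of g.\<close>

lemma parts_integral_compose:
  assumes f: "C1_pair T f f'" and h: "C1_pair T h h'" and v: "continuous_on {0..T} v" and t: "t \<in> {0..T}"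
  shows "parts_integral f f' (parts_integral h h' v) t
       = parts_integral (\<lambda>t. f t * h t) (\<lambda>t. f' t * h t + f t * h' t) v t"
proof -
  note ct = C1_pair_continuous[OF f] C1_pair_continuous'[OF f] C1_pair_continuous[OF h] C1_pair_continuous'[OF h] v
  define H where "H = (\<lambda>t. integral {0..t} (\<lambda>s. h' s * v s))"
  have H: "C1_pair T H (\<lambda>s. h' s * v s)"
    unfolding H_def by (intro C1_pair_primitive continuous_intros ct)
  note cH = C1_pair_continuous[OF H]
  have sub: "{0..t} \<subseteq> {0..T}" using t by auto
  have int: "g integrable_on {0..t}" if "continuous_on {0..T} g" for g :: "real \<Rightarrow> real"
    using integrable_continuous_real[OF continuous_on_subset[OF that sub]] .
  have 1: "integral {0..t} (\<lambda>s. f' s * parts_integral h h' v s)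
      = integral {0..t} (\<lambda>s. f' s * (h s * v s)) - (f t - f 0) * (h 0 * v 0) - integral {0..t} (\<lambda>s. f' s * H s)"
  proof -
    have "integral {0..t} (\<lambda>s. f' s * parts_integral h h' v s)
      = integral {0..t} (\<lambda>s. f' s * (h s * v s) - f' s * (h 0 * v 0) - f' s * H s)"
      by (simp add: parts_integral_def H_def algebra_simps)
    also have "\<dots> = integral {0..t} (\<lambda>s. f' s * (h s * v s) - f' s * (h 0 * v 0)) - integral {0..t} (\<lambda>s. f' s * H s)"
      by (intro Henstock_Kurzweil_Integration.integral_diff int continuous_intros ct cH)
    also have "integral {0..t} (\<lambda>s. f' s * (h s * v s) - f' s * (h 0 * v 0))
      = integral {0..t} (\<lambda>s. f' s * (h s * v s)) - integral {0..t} (\<lambda>s. f' s * (h 0 * v 0))"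
      by (intro Henstock_Kurzweil_Integration.integral_diff int continuous_intros ct)
    finally show ?thesis using integral_mult_const_C1[OF f, of t] t by simp
  qed
  have 2: "integral {0..t} (\<lambda>s. f' s * H s) + integral {0..t} (\<lambda>s. f s * (h' s * v s)) = f t * H t"
  proof -
    have "integral {0..t} (\<lambda>s. f' s * H s) + integral {0..t} (\<lambda>s. f s * (h' s * v s))
      = integral {0..t} (\<lambda>s. f' s * H s + f s * (h' s * v s))"
      by (intro Henstock_Kurzweil_Integration.integral_add[symmetric] int continuous_intros ct cH)
    also have "\<dots> = f t * H t - f 0 * H 0"
      using C1_pair_integral[OF C1_pair_mult[OF f H], of 0 t] t by simp
    finally show ?thesis by (simp add: H_def)
  qed
  have 3: "integral {0..t} (\<lambda>s. (f' s * h s + f s * h' s) * v s)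
     = integral {0..t} (\<lambda>s. f' s * (h s * v s)) + integral {0..t} (\<lambda>s. f s * (h' s * v s))"
  proof -
    have "integral {0..t} (\<lambda>s. (f' s * h s + f s * h' s) * v s)
      = integral {0..t} (\<lambda>s. f' s * (h s * v s) + f s * (h' s * v s))"
      by (simp add: algebra_simps)
    also have "\<dots> = integral {0..t} (\<lambda>s. f' s * (h s * v s)) + integral {0..t} (\<lambda>s. f s * (h' s * v s))"
      by (intro Henstock_Kurzweil_Integration.integral_add int continuous_intros ct)
    finally show ?thesis .
  qed
  have "parts_integral f f' (parts_integral h h' v) t
    = f t * (h t * v t - h 0 * v 0 - H t) - integral {0..t} (\<lambda>s. f' s * parts_integral h h' v s)"
    unfolding parts_integral_def H_def by simp
  then show ?thesis
    unfolding 1 unfolding parts_integral_def 3 using 2 by (simp add: algebra_simps)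
qed

text \<open>The product rule is applied to the smooth part of D only. The rough part I is never
  differentiated and leaves \<open>f t * I t - \<integral> f' I\<close>, which is the integral of f
  against I by parts, up to the initial value.\<close>

lemma mult_primitive_plus:
  assumes f: "C1_pair T f f'" and a: "continuous_on {0..T} a" and I: "continuous_on {0..T} I"
    and D: "\<And>t. t \<in> {0..T} \<Longrightarrow> D t = integral {0..t} a + I t"
    and t: "t \<in> {0..T}"
  shows "f t * D t = f t * I t - integral {0..t} (\<lambda>s. f' s * I s) + integral {0..t} (\<lambda>s. f' s * D s + f s * a s)"
proof -
  define A where "A = (\<lambda>t. integral {0..t} a)"
  have A: "C1_pair T A a"
    unfolding A_def by (intro C1_pair_primitive a)
  note ct = C1_pair_continuous[OF f] C1_pair_continuous'[OF f] C1_pair_continuous[OF A] a I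
  have sub: "{0..t} \<subseteq> {0..T}" using t by auto
  have int: "g integrable_on {0..t}" if "continuous_on {0..T} g" for g :: "real \<Rightarrow> real"
    using integrable_continuous_real[OF continuous_on_subset[OF that sub]] .
  have "f t * A t = integral {0..t} (\<lambda>s. f' s * A s + f s * a s)"
    using C1_pair_integral[OF C1_pair_mult[OF f A], of 0 t] t by (simp add: A_def)
  moreover have "integral {0..t} (\<lambda>s. f' s * D s + f s * a s)
     = integral {0..t} (\<lambda>s. f' s * I s + (f' s * A s + f s * a s))"
    by (rule Henstock_Kurzweil_Integration.integral_cong) (use D sub in \<open>auto simp: A_def algebra_simps\<close>)
  moreover have "\<dots> = integral {0..t} (\<lambda>s. f' s * I s) + integral {0..t} (\<lambda>s. f' s * A s + f s * a s)"
    by (intro Henstock_Kurzweil_Integration.integral_add int continuous_intros ct)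
  ultimately show ?thesis using D[OF t] by (simp add: A_def algebra_simps)
qed

lemma ode_solution_continuous: "ode_solution T S x0 x \<Longrightarrow> continuous_on {0..T} x"
  unfolding ode_solution_def by (rule DERIV_continuous_on[of _ x "\<lambda>t. S (x t)"]) simp

lemma ode_solution_C1:
  assumes "ode_solution T S x0 x" "continuous_on UNIV S"
  shows "C1_pair T x (\<lambda>t. S (x t))"
  using assms ode_solution_continuous[OF assms(1)]
  unfolding C1_pair_def ode_solution_def by (auto intro: continuous_on_compose2)

lemma ode_solution_integral:
  assumes "ode_solution T S x0 x" "continuous_on UNIV S" "t \<in> {0..T}"
  shows "x t = x0 + integral {0..t} (\<lambda>s. S (x s))"
  using C1_pair_integral[OF ode_solution_C1[OF assms(1,2)], of 0 t] assms by (simp add: ode_solution_def)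

text \<open>After a last visit to the level \<open>x0\<close> the solution would have to leave it downwards, although
  its derivative there is \<open>S x0 > 0\<close>.\<close>

lemma ode_solution_ge:
  assumes x: "ode_solution T S x0 x" and S: "S x0 > 0" and t: "t \<in> {0..T}"
  shows "x0 \<le> x t"
proof (rule ccontr)
  assume lt: "\<not> x0 \<le> x t"
  define Z where "Z = {s\<in>{0..t}. x s \<in> {x0..}}"
  have "continuous_on {0..t} x"
    using continuous_on_subset[OF ode_solution_continuous[OF x]] t by auto
  then have "closed Z"
    unfolding Z_def by (intro continuous_closed_preimage[unfolded vimage_def Int_def, simplified mem_Collect_eq]) auto
  moreover have "bounded Z"
    by (rule bounded_subset[of "{0..t}"]) (auto simp: Z_def)
  moreover have "0 \<in> Z"
    using x t by (auto simp: Z_def ode_solution_def)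
  ultimately obtain s where s: "s \<in> Z" "\<And>u. u \<in> Z \<Longrightarrow> u \<le> s"
    using compact_attains_sup[of Z] by (auto simp: compact_eq_bounded_closed)
  have st: "0 \<le> s" "s < t" "x0 \<le> x s"
    using s lt unfolding Z_def by (auto simp: less_le)
  have after: "x u < x0" if "s < u" "u \<le> t" for u
    using s(2)[of u] that st by (force simp: Z_def)
  have "x s = x0"
  proof (rule ccontr)
    assume "x s \<noteq> x0"
    then have "x t \<le> (x0 + x s) / 2" "(x0 + x s) / 2 \<le> x s" using st lt by auto
    moreover have "continuous_on {s..t} x"
      using continuous_on_subset[OF ode_solution_continuous[OF x]] t st by auto
    ultimately obtain u where u: "s \<le> u" "u \<le> t" "x u = (x0 + x s) / 2"
      using IVT2'[of x t "(x0 + x s) / 2" s] st by auto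
    then have "u \<noteq> s" using \<open>x s \<noteq> x0\<close> by auto
    then show False using after[of u] u st \<open>x s \<noteq> x0\<close> by auto
  qed
  have "(x has_real_derivative S (x s)) (at s within {0..T})"
    using x st t by (auto simp: ode_solution_def)
  then have "(x has_real_derivative S x0) (at s within {s..T})"
    unfolding \<open>x s = x0\<close> by (rule DERIV_subset) (use st in auto)
  from has_real_derivative_pos_inc_right[OF this S] obtain d where
    d: "d > 0" "\<And>h. 0 < h \<Longrightarrow> s + h \<in> {s..T} \<Longrightarrow> h < d \<Longrightarrow> x s < x (s + h)"
    by blast
  define h where "h = min (d / 2) (t - s)"
  have "x s < x (s + h)"
    using d st t by (intro d(2)) (auto simp: h_def min_def)
  moreover have "x (s + h) < x0"
    using d st by (intro after) (auto simp: h_def min_def)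
  ultimately show False using \<open>x s = x0\<close> by simp
qed

text \<open>The hypothesis \<open>good\<close> is conditional: it bounds I at t only if the
  accumulated square up to t is below b, which is known only as long as X is within r of x. Up to
  the first exit from that neighbourhood the condition holds, and Gronwall then bounds the distance
  by \<open>\<epsilon> * ((a + K) * exp (L * T))\<close>, which is strictly less than r; so no exit
  occurs.\<close>

lemma pathwise_localisation:
  fixes S \<sigma> x X I \<psi> :: "real \<Rightarrow> real"
  assumes L: "0 \<le> L" and \<epsilon>: "0 < \<epsilon>"
    and lip: "\<And>y z. \<bar>S y - S z\<bar> \<le> L * \<bar>y - z\<bar>" "\<And>y z. \<bar>\<sigma> y - \<sigma> z\<bar> \<le> L * \<bar>y - z\<bar>"
    and cont: "continuous_on {0..T} x" "continuous_on {0..T} X" "continuous_on {0..T} I" "continuous_on UNIV S"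
      "continuous_on UNIV \<sigma>"
    and x: "\<And>t. t \<in> {0..T} \<Longrightarrow> x t = x0 + integral {0..t} (\<lambda>s. S (x s))"
    and X: "\<And>t. t \<in> {0..T} \<Longrightarrow> X t = x0 + integral {0..t} (\<lambda>s. S (X s)) + I t"
    and \<psi>: "\<And>t. t \<in> {0..T} \<Longrightarrow> \<bar>\<psi> t\<bar> \<le> K"
    and good: "\<And>t. t \<in> {0..T} \<Longrightarrow> integral {0..t} (\<lambda>s. (\<sigma> (X s) - \<sigma> (x s))\<^sup>2) < b \<Longrightarrow> \<bar>I t / \<epsilon> - \<psi> t\<bar> \<le> a"
    and small: "\<epsilon> * ((a + K) * exp (L * T)) < r" "(L * r)\<^sup>2 * T < b"
    and aK: "0 \<le> a" "0 \<le> K" and t: "t \<in> {0..T}"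
  shows "\<bar>X t - x t\<bar> \<le> \<epsilon> * ((a + K) * exp (L * T)) \<and> \<bar>I t / \<epsilon> - \<psi> t\<bar> \<le> a"
proof -
  define R where "R = (a + K) * exp (L * T)"
  have cSX: "continuous_on {0..T} (\<lambda>s. S (X s))" "continuous_on {0..T} (\<lambda>s. S (x s))"
    "continuous_on {0..T} (\<lambda>s. \<sigma> (X s))" "continuous_on {0..T} (\<lambda>s. \<sigma> (x s))"
    using continuous_on_compose2[OF cont(4) cont(2)] continuous_on_compose2[OF cont(4) cont(1)]
      continuous_on_compose2[OF cont(5) cont(2)] continuous_on_compose2[OF cont(5) cont(1)] by auto
  have goodI: "\<bar>I s / \<epsilon> - \<psi> s\<bar> \<le> a"
    if s: "s \<in> {0..T}" and near: "\<And>u. u \<in> {0..T} \<Longrightarrow> u < s \<Longrightarrow> \<bar>X u - x u\<bar> \<le> r" for s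
  proof (rule good[OF s])
    have sub: "{0..s} \<subseteq> {0..T}" using s by auto
    \<comment> \<open>Closeness is known only before s, since s may be the exit time itself; the
      integrand is therefore changed at that single point.\<close>
    define g where "g u = (if u = s then 0 else (\<sigma> (X u) - \<sigma> (x u))\<^sup>2)" for u
    have int: "(\<lambda>u. (\<sigma> (X u) - \<sigma> (x u))\<^sup>2) integrable_on {0..s}"
      by (intro integrable_continuous_real continuous_intros continuous_on_subset[OF cSX(3) sub]
          continuous_on_subset[OF cSX(4) sub])
    have "integral {0..s} (\<lambda>u. (\<sigma> (X u) - \<sigma> (x u))\<^sup>2) = integral {0..s} g"
      by (rule integral_spike[of "{s}"]) (auto simp: g_def)
    also have "\<dots> \<le> integral {0..s} (\<lambda>u. (L * r)\<^sup>2)"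
    proof (rule Henstock_Kurzweil_Integration.integral_le)
      show "g integrable_on {0..s}"
        by (rule integrable_spike[OF int, of "{s}"]) (auto simp: g_def)
      fix u assume u: "u \<in> {0..s}"
      show "g u \<le> (L * r)\<^sup>2"
      proof (cases "u = s")
        case False
        then have "\<bar>X u - x u\<bar> \<le> r" using near[of u] u s by auto
        then have "L * \<bar>X u - x u\<bar> \<le> L * r" using L by (rule mult_left_mono)
        then have "\<bar>\<sigma> (X u) - \<sigma> (x u)\<bar> \<le> L * r" using lip(2)[of "X u" "x u"] by linarith
        then show ?thesis using False by (simp add: g_def abs_le_square_iff[symmetric])
      qed (simp add: g_def)
    qed auto
    also have "\<dots> \<le> (L * r)\<^sup>2 * T"
      using s by (simp add: mult.commute[of s] mult_left_mono)
    finally show "integral {0..s} (\<lambda>u. (\<sigma> (X u) - \<sigma> (x u))\<^sup>2) < b" using small by linarith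
  qed
  have bound: "\<bar>X t - x t\<bar> \<le> \<epsilon> * R"
    if t: "t \<in> {0..T}" and near: "\<And>u. u \<in> {0..T} \<Longrightarrow> u < t \<Longrightarrow> \<bar>X u - x u\<bar> \<le> r" for t
  proof -
    have "\<bar>X t - x t\<bar> \<le> (\<epsilon> * (a + K)) * exp (L * t)"
    proof (rule gronwall_Icc[OF _ L])
      have sub: "{0..t} \<subseteq> {0..T}" using t by auto
      show "continuous_on {0..t} (\<lambda>t. \<bar>X t - x t\<bar>)"
        by (intro continuous_intros continuous_on_subset[OF cont(1) sub] continuous_on_subset[OF cont(2) sub])
      show "t \<in> {0..t}" using t by auto
      fix s assume "s \<in> {0..t}"
      then have s: "s \<in> {0..T}" and sub: "{0..s} \<subseteq> {0..T}" using t by auto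
      have int: "f integrable_on {0..s}" if "continuous_on {0..T} f" for f :: "real \<Rightarrow> real"
        using integrable_continuous_real[OF continuous_on_subset[OF that sub]] .
      have near_s: "\<bar>I s / \<epsilon> - \<psi> s\<bar> \<le> a"
        using near \<open>s \<in> {0..t}\<close> by (intro goodI s) auto
      then have "\<bar>I s / \<epsilon>\<bar> \<le> a + K" using \<psi>[OF s] by linarith
      then have I: "\<bar>I s\<bar> \<le> \<epsilon> * (a + K)" using \<epsilon> by (simp add: field_simps)
      have "X s - x s = integral {0..s} (\<lambda>u. S (X u)) - integral {0..s} (\<lambda>u. S (x u)) + I s"
        using x[OF s] X[OF s] by simp
      also have "integral {0..s} (\<lambda>u. S (X u)) - integral {0..s} (\<lambda>u. S (x u)) = integral {0..s} (\<lambda>u. S (X u) - S (x u))"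
        by (intro Henstock_Kurzweil_Integration.integral_diff[symmetric] int cSX)
      finally have "\<bar>X s - x s\<bar> \<le> \<bar>integral {0..s} (\<lambda>u. S (X u) - S (x u))\<bar> + \<epsilon> * (a + K)"
        using I by linarith
      also have "\<bar>integral {0..s} (\<lambda>u. S (X u) - S (x u))\<bar> \<le> integral {0..s} (\<lambda>u. L * \<bar>X u - x u\<bar>)"
      proof -
        have "norm (integral {0..s} (\<lambda>u. S (X u) - S (x u))) \<le> integral {0..s} (\<lambda>u. L * \<bar>X u - x u\<bar>)"
          by (rule integral_norm_bound_integral) (use lip(1) in \<open>auto intro!: int continuous_intros cSX cont(1,2)\<close>)
        then show ?thesis by simp
      qed
      finally show "\<bar>X s - x s\<bar> \<le> \<epsilon> * (a + K) + L * integral {0..s} (\<lambda>u. \<bar>X u - x u\<bar>)" by simp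
    qed
    also have "\<dots> \<le> (\<epsilon> * (a + K)) * exp (L * T)"
      using t L \<epsilon> aK by (intro mult_left_mono) (auto intro: mult_left_mono)
    finally show ?thesis by (simp add: R_def mult.assoc)
  qed
  have near: "\<bar>X s - x s\<bar> \<le> r" if "s \<in> {0..T}" for s
  proof (rule ccontr)
    assume far: "\<not> ?thesis"
    define Z where "Z = {s\<in>{0..T}. r \<le> \<bar>X s - x s\<bar>}"
    have "closed Z"
      unfolding Z_def by (intro continuous_closed_preimage[of "{0..T}" "\<lambda>s. \<bar>X s - x s\<bar>" "{r..}", unfolded vimage_def Int_def, simplified mem_Collect_eq atLeast_iff] continuous_intros cont)
    moreover have "bounded Z"
      by (rule bounded_subset[of "{0..T}"]) (auto simp: Z_def)
    moreover have "s \<in> Z" using far that by (auto simp: Z_def)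
    \<comment> \<open>At the first time u when the distance reaches r, \<open>bound\<close> applies
      because only earlier times enter its premise, and it puts the distance at u strictly below
      r.\<close>
    ultimately obtain u where u: "u \<in> Z" "\<And>v. v \<in> Z \<Longrightarrow> u \<le> v"
      using compact_attains_inf[of Z] by (auto simp: compact_eq_bounded_closed)
    have "\<bar>X u - x u\<bar> \<le> \<epsilon> * R"
    proof (rule bound)
      show "\<bar>X v - x v\<bar> \<le> r" if "v \<in> {0..T}" "v < u" for v
        using u(2)[of v] that by (force simp: Z_def)
    qed (use u in \<open>auto simp: Z_def\<close>)
    then show False using u(1) small by (simp add: Z_def R_def)
  qed
  show ?thesis using bound[OF t near] goodI[OF t near] by (simp add: R_def)
qed

text \<open>The equation for f' makes f an integrating factor for the linearised equation, so f
  times the deviation is an integral of f against I plus the Taylor remainder. The latter is of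
  order \<open>(\<epsilon> * R)\<close> squared and remains of order \<epsilon> after division by
  \<epsilon>.\<close>

lemma rescaled_deviation_approx:
  fixes S S' \<sigma> x X I \<psi> f f' :: "real \<Rightarrow> real"
  assumes \<epsilon>: "0 < \<epsilon>"
    and cont: "continuous_on {0..T} x" "continuous_on {0..T} X" "continuous_on {0..T} I" "continuous_on {0..T} \<psi>"
      "continuous_on UNIV S" 
    and f: "C1_pair T f f'" "\<And>t. t \<in> {0..T} \<Longrightarrow> f' t = - S' (x t) * f t" "\<psi> 0 = 0"
    and x: "\<And>t. t \<in> {0..T} \<Longrightarrow> x t = x0 + integral {0..t} (\<lambda>s. S (x s))"
    and X: "\<And>t. t \<in> {0..T} \<Longrightarrow> X t = x0 + integral {0..t} (\<lambda>s. S (X s)) + I t"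
    and taylor: "\<And>y z. \<bar>S y - S z - S' z * (y - z)\<bar> \<le> C * (y - z)\<^sup>2"
    and near: "\<And>t. t \<in> {0..T} \<Longrightarrow> \<bar>X t - x t\<bar> \<le> \<epsilon> * R"
    and I: "\<And>t. t \<in> {0..T} \<Longrightarrow> \<bar>I t / \<epsilon> - \<psi> t\<bar> \<le> a"
    and Kf: "\<And>t. t \<in> {0..T} \<Longrightarrow> \<bar>f t\<bar> \<le> Kf" "\<And>t. t \<in> {0..T} \<Longrightarrow> \<bar>f' t\<bar> \<le> Kf"
    and t: "t \<in> {0..T}" and C: "0 \<le> C"
  shows "\<bar>(X t - x t) / \<epsilon> * f t - parts_integral f f' \<psi> t\<bar> \<le> a * Kf * (1 + T) + Kf * C * T * \<epsilon> * R\<^sup>2"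
proof -
  define J where "J t = I t / \<epsilon> - \<psi> t" for t
  define G where "G s = f s * (S (X s) - S (x s) - S' (x s) * (X s - x s))" for s
  define D where "D t = X t - x t" for t
  have sub: "{0..t} \<subseteq> {0..T}" using t by auto
  have int: "g integrable_on {0..t}" if "continuous_on {0..T} g" for g :: "real \<Rightarrow> real"
    using integrable_continuous_real[OF continuous_on_subset[OF that sub]] .
  have cSX: "continuous_on {0..T} (\<lambda>s. S (X s))" "continuous_on {0..T} (\<lambda>s. S (x s))"
    using continuous_on_compose2[OF cont(5) cont(2)] continuous_on_compose2[OF cont(5) cont(1)] by auto
  have cJ: "continuous_on {0..T} J"
    unfolding J_def using \<epsilon> by (intro continuous_intros cont) auto
  note cf = C1_pair_continuous[OF f(1)] C1_pair_continuous'[OF f(1)]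
  have Kf0: "0 \<le> Kf" using Kf(1)[OF t] by linarith
  have a0: "0 \<le> a" using I[OF t] by linarith
  have D: "D s = integral {0..s} (\<lambda>u. S (X u) - S (x u)) + I s" if "s \<in> {0..T}" for s
  proof -
    have sub: "{0..s} \<subseteq> {0..T}" using that by auto
    have "integral {0..s} (\<lambda>u. S (X u) - S (x u)) = integral {0..s} (\<lambda>u. S (X u)) - integral {0..s} (\<lambda>u. S (x u))"
      by (intro Henstock_Kurzweil_Integration.integral_diff integrable_continuous_real
          continuous_on_subset[OF _ sub] cSX)
    then show ?thesis using x[OF that] X[OF that] by (simp add: D_def)
  qed
  have "f t * D t = f t * I t - integral {0..t} (\<lambda>s. f' s * I s)
      + integral {0..t} (\<lambda>s. f' s * D s + f s * (S (X s) - S (x s)))"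
    by (rule mult_primitive_plus[OF f(1) _ cont(3) D t]) (intro continuous_intros cSX)
  \<comment> \<open>Here \<open>f' = - S' (x t) * f\<close> removes the linear term of
    \<open>S (X s) - S (x s)\<close>.\<close>
  also have "integral {0..t} (\<lambda>s. f' s * D s + f s * (S (X s) - S (x s))) = integral {0..t} G"
    by (rule Henstock_Kurzweil_Integration.integral_cong)
      (use f(2) sub in \<open>auto simp: G_def D_def algebra_simps\<close>)
  finally have fD: "f t * D t / \<epsilon> = f t * (I t / \<epsilon>) - integral {0..t} (\<lambda>s. f' s * (I s / \<epsilon>)) + integral {0..t} G / \<epsilon>"
    by (simp add: diff_divide_distrib add_divide_distrib)
  have "integral {0..t} (\<lambda>s. f' s * J s) = integral {0..t} (\<lambda>s. f' s * (I s / \<epsilon>) - f' s * \<psi> s)"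
    by (simp add: J_def algebra_simps)
  also have "\<dots> = integral {0..t} (\<lambda>s. f' s * (I s / \<epsilon>)) - integral {0..t} (\<lambda>s. f' s * \<psi> s)"
    using \<epsilon> by (intro Henstock_Kurzweil_Integration.integral_diff int continuous_intros cf cont) auto
  finally have eq: "(X t - x t) / \<epsilon> * f t - parts_integral f f' \<psi> t
     = f t * J t - integral {0..t} (\<lambda>s. f' s * J s) + integral {0..t} G / \<epsilon>"
    using fD f(3) by (simp add: parts_integral_def J_def D_def algebra_simps)
  have 1: "\<bar>f t * J t\<bar> \<le> Kf * a"
    unfolding abs_mult using Kf(1)[OF t] I[OF t] Kf0 by (intro mult_mono) (auto simp: J_def)
  have 2: "\<bar>integral {0..t} (\<lambda>s. f' s * J s)\<bar> \<le> Kf * a * (t - 0)"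
  proof (rule integral_continuous_bound)
    show "continuous_on {0..t} (\<lambda>s. f' s * J s)"
      by (intro continuous_on_subset[OF _ sub] continuous_intros cf cJ)
    show "\<bar>f' s * J s\<bar> \<le> Kf * a" if "s \<in> {0..t}" for s
      unfolding abs_mult using Kf(2)[of s] I[of s] Kf0 that sub by (intro mult_mono) (auto simp: J_def)
  qed (use t in auto)
  have 3: "\<bar>integral {0..t} G\<bar> \<le> (Kf * (C * (\<epsilon> * R)\<^sup>2)) * (t - 0)"
  proof (rule integral_continuous_bound)
    \<comment> \<open>The factor \<open>S' (x s) * f s\<close> in G is traded for
      \<open>- f' s\<close>, whose continuity is part of \<open>C1_pair\<close>.\<close>
    have "continuous_on {0..T} (\<lambda>s. f s * (S (X s) - S (x s)) + f' s * (X s - x s))"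
      by (intro continuous_intros cf cSX cont)
    then have "continuous_on {0..T} G"
      by (rule continuous_on_cong[THEN iffD1, rotated -1]) (auto simp: G_def f(2) algebra_simps)
    then show "continuous_on {0..t} G" using sub by (rule continuous_on_subset)
    show "\<bar>G s\<bar> \<le> Kf * (C * (\<epsilon> * R)\<^sup>2)" if "s \<in> {0..t}" for s
    proof -
      have s: "s \<in> {0..T}" using that sub by auto
      have "\<bar>X s - x s\<bar>\<^sup>2 \<le> (\<epsilon> * R)\<^sup>2" using near[OF s] by (intro power_mono) auto
      then have "C * (X s - x s)\<^sup>2 \<le> C * (\<epsilon> * R)\<^sup>2" using C by (simp add: mult_left_mono)
      then have "\<bar>S (X s) - S (x s) - S' (x s) * (X s - x s)\<bar> \<le> C * (\<epsilon> * R)\<^sup>2"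
        using taylor[of "X s" "x s"] by linarith
      then show ?thesis
        unfolding G_def abs_mult using Kf(1)[OF s] Kf0 by (intro mult_mono) auto
    qed
  qed (use t in auto)
  have "\<bar>(X t - x t) / \<epsilon> * f t - parts_integral f f' \<psi> t\<bar>
      \<le> Kf * a + Kf * a * t + (Kf * (C * (\<epsilon> * R)\<^sup>2)) * t / \<epsilon>"
  proof -
    have "\<bar>integral {0..t} G / \<epsilon>\<bar> \<le> (Kf * (C * (\<epsilon> * R)\<^sup>2)) * t / \<epsilon>"
      using divide_right_mono[OF 3, of \<epsilon>] \<epsilon> by (simp add: abs_divide)
    then show ?thesis unfolding eq using 1 2 unfolding diff_zero by linarith
  qed
  also have "\<dots> \<le> Kf * a + Kf * a * T + (Kf * (C * (\<epsilon> * R)\<^sup>2)) * T / \<epsilon>"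
    using t Kf0 a0 C \<epsilon> by (intro add_mono mult_left_mono divide_right_mono) auto
  also have "\<dots> = a * Kf * (1 + T) + Kf * C * T * \<epsilon> * R\<^sup>2"
    using \<epsilon> by (simp add: power2_eq_square field_simps)
  finally show ?thesis .
qed

lemma abs_SUP_diff_le:
  fixes y z :: "real \<Rightarrow> real"
  assumes "0 \<le> T" "continuous_on {0..T} y" "continuous_on {0..T} z"
    and e: "\<And>t. t \<in> {0..T} \<Longrightarrow> \<bar>y t - z t\<bar> \<le> e"
  shows "\<bar>(SUP t\<in>{0..T}. y t) - (SUP t\<in>{0..T}. z t)\<bar> \<le> e"
proof -
  have "(SUP t\<in>{0..T}. y t) \<le> (SUP t\<in>{0..T}. z t) + e"
    unfolding SUP_Icc_le_iff[OF assms(1,2)] using le_SUP_Icc[OF assms(3)] e by (force simp: abs_le_iff)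
  moreover have "(SUP t\<in>{0..T}. z t) \<le> (SUP t\<in>{0..T}. y t) + e"
    unfolding SUP_Icc_le_iff[OF assms(1,3)] using le_SUP_Icc[OF assms(2)] e by (force simp: abs_le_iff)
  ultimately show ?thesis by linarith
qed

lemma integral_square_diff_le:
  fixes y z r :: "real \<Rightarrow> real"
  assumes T: "0 \<le> T" and c: "continuous_on {0..T} y" "continuous_on {0..T} z" "continuous_on {0..T} r"
    and r: "\<And>t. t \<in> {0..T} \<Longrightarrow> 0 \<le> r t"
    and e: "\<And>t. t \<in> {0..T} \<Longrightarrow> \<bar>y t - z t\<bar> \<le> e" and K: "\<And>t. t \<in> {0..T} \<Longrightarrow> \<bar>z t\<bar> \<le> K"
  shows "\<bar>integral {0..T} (\<lambda>t. (y t)\<^sup>2 * r t) - integral {0..T} (\<lambda>t. (z t)\<^sup>2 * r t)\<bar>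
           \<le> e * (e + 2 * K) * integral {0..T} r"
proof -
  have "integral {0..T} (\<lambda>t. (y t)\<^sup>2 * r t) - integral {0..T} (\<lambda>t. (z t)\<^sup>2 * r t)
      = integral {0..T} (\<lambda>t. (y t)\<^sup>2 * r t - (z t)\<^sup>2 * r t)"
    by (intro Henstock_Kurzweil_Integration.integral_diff[symmetric] integrable_continuous_real continuous_intros c)
  moreover have "norm \<dots> \<le> integral {0..T} (\<lambda>t. e * (e + 2 * K) * r t)"
  proof (rule integral_norm_bound_integral)
    fix t assume t: "t \<in> {0..T}"
    have "\<bar>(y t)\<^sup>2 - (z t)\<^sup>2\<bar> = \<bar>y t - z t\<bar> * \<bar>y t + z t\<bar>"
      by (simp add: abs_mult[symmetric] power2_eq_square algebra_simps)
    also have "\<dots> \<le> e * (e + 2 * K)"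
      using e[OF t] K[OF t] by (intro mult_mono) auto
    finally have "\<bar>((y t)\<^sup>2 - (z t)\<^sup>2) * r t\<bar> \<le> e * (e + 2 * K) * r t"
      unfolding abs_mult using r[OF t] by (intro mult_mono) auto
    then show "norm ((y t)\<^sup>2 * r t - (z t)\<^sup>2 * r t) \<le> e * (e + 2 * K) * r t"
      by (simp add: algebra_simps)
  qed (intro integrable_continuous_real continuous_intros c)+
  ultimately show ?thesis by simp
qed

section \<open>Measurability of path functionals and the discrete Lenglart inequality\<close>

lemma weighted_riemann_sum_tendsto:
  fixes f r :: "real \<Rightarrow> real"
  assumes f: "continuous_on {0..T} f" and r: "continuous_on {0..T} r" "\<And>t. t \<in> {0..T} \<Longrightarrow> 0 \<le> r t"
    and p: "\<And>n i. i < m n \<Longrightarrow> p n i \<le> p n (Suc i)" "\<And>n. p n 0 = 0" "\<And>n. p n (m n) = T"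
    and p_in: "\<And>n i. i \<le> m n \<Longrightarrow> p n i \<in> {0..T}"
    and mesh: "\<And>d. d > 0 \<Longrightarrow> \<forall>\<^sub>F n in sequentially. \<forall>i<m n. p n (Suc i) - p n i < d"
  shows "(\<lambda>n. \<Sum>i<m n. f (p n (Suc i)) * integral {p n i..p n (Suc i)} r) \<longlonglongrightarrow> integral {0..T} (\<lambda>t. f t * r t)"
proof (rule LIMSEQ_I)
  fix e :: real assume e: "e > 0"
  have T: "0 \<le> T" using p_in[of 0 0] p(2) by auto
  define R where "R = integral {0..T} r"
  have R: "0 \<le> R"
    unfolding R_def using r by (intro integral_nonneg integrable_continuous_real) auto
  \<comment> \<open>The summand 1 covers a weight of total mass 0.\<close>
  define e' where "e' = e / (R + 1)"
  have e': "e' > 0" using e R by (simp add: e'_def)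
  obtain d where d: "d > 0"
    "\<And>s t. s \<in> {0..T} \<Longrightarrow> t \<in> {0..T} \<Longrightarrow> \<bar>s - t\<bar> < d \<Longrightarrow> \<bar>f s - f t\<bar> \<le> e'"
    using uniformly_continuous_IccD[OF f e'] by metis
  obtain n0 where n0: "\<And>n i. n \<ge> n0 \<Longrightarrow> i < m n \<Longrightarrow> p n (Suc i) - p n i < d"
    using mesh[OF d(1)] unfolding eventually_sequentially by blast
  have "norm ((\<Sum>i<m n. f (p n (Suc i)) * integral {p n i..p n (Suc i)} r) - integral {0..T} (\<lambda>t. f t * r t)) < e"
    if n: "n \<ge> n0" for n
  proof -
    have "\<bar>integral {0..T} (\<lambda>t. f t * r t) - (\<Sum>i<m n. f (p n (Suc i)) * integral {p n i..p n (Suc i)} r)\<bar> \<le> e' * R"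
      unfolding R_def
    proof (rule weighted_riemann_sum_error[OF f r])
      fix i t assume i: "i < m n" and t: "t \<in> {p n i..p n (Suc i)}"
      have "p n i \<in> {0..T}" "p n (Suc i) \<in> {0..T}" using p_in i by auto
      then show "\<bar>f t - f (p n (Suc i))\<bar> \<le> e'"
        using n0[OF n i] t by (intro d(2)) auto
    qed (use p p_in in auto)
    also have "\<dots> < e"
      using e R by (simp add: e'_def field_simps)
    finally show ?thesis by (simp add: abs_minus_commute)
  qed
  then show "\<exists>n0. \<forall>n\<ge>n0. norm ((\<Sum>i<m n. f (p n (Suc i)) * integral {p n i..p n (Suc i)} r) - integral {0..T} (\<lambda>t. f t * r t)) < e"
    by blast
qed

lemma uniform_grid_mesh:
  assumes "0 \<le> T" "0 < d"
  shows "\<forall>\<^sub>F n in sequentially. \<forall>i<Suc n. T * real (Suc i) / real (Suc n) - T * real i / real (Suc n) < d"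
proof -
  have "(\<lambda>n. T / real (Suc n)) \<longlonglongrightarrow> 0"
    using LIMSEQ_Suc[OF lim_const_over_n[of T]] by simp
  then have "\<forall>\<^sub>F n in sequentially. T / real (Suc n) < d"
    using assms by (intro order_tendstoD(2)) auto
  then show ?thesis
    by (rule eventually_mono) (auto simp: diff_divide_distrib[symmetric] algebra_simps)
qed

lemma uniform_grid_in: "0 \<le> T \<Longrightarrow> i \<le> Suc n \<Longrightarrow> T * real i / real (Suc n) \<in> {0..T}"
  by (auto simp: divide_le_eq intro: mult_left_mono)

lemma riemann_sum_tendsto:
  fixes f :: "real \<Rightarrow> real"
  assumes T: "0 \<le> T" and f: "continuous_on {0..T} f"
  shows "(\<lambda>n. \<Sum>i<Suc n. f (T * real (Suc i) / real (Suc n)) * (T / real (Suc n))) \<longlonglongrightarrow> integral {0..T} f"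
proof -
  have "(\<lambda>n. \<Sum>i<Suc n. f (T * real (Suc i) / real (Suc n)) * integral {T * real i / real (Suc n)..T * real (Suc i) / real (Suc n)} (\<lambda>_. 1::real))
      \<longlonglongrightarrow> integral {0..T} (\<lambda>t. f t * 1)"
  proof (rule weighted_riemann_sum_tendsto[OF f])
    show "T * real i / real (Suc n) \<le> T * real (Suc i) / real (Suc n)" for i n
      using T by (intro divide_right_mono mult_left_mono) auto
  qed (use T uniform_grid_in uniform_grid_mesh in auto)
  moreover have "integral {T * real i / real (Suc n)..T * real (Suc i) / real (Suc n)} (\<lambda>_. 1::real) = T / real (Suc n)" for i n
  proof -
    have "T * real i / real (Suc n) \<le> T * real (Suc i) / real (Suc n)"
      using T by (intro divide_right_mono mult_left_mono) auto
    then have "integral {T * real i / real (Suc n)..T * real (Suc i) / real (Suc n)} (\<lambda>_. 1::real)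
        = T * real (Suc i) / real (Suc n) - T * real i / real (Suc n)"
      by simp
    also have "\<dots> = T / real (Suc n)"
      by (simp add: diff_divide_distrib[symmetric] algebra_simps)
    finally show ?thesis .
  qed
  ultimately show ?thesis by (simp only: mult_1_right)
qed

text \<open>For continuous paths the integral is a pointwise limit of Riemann sums, each of them a
  finite combination of the measurable variables \<open>Y s\<close>.\<close>

lemma borel_measurable_integral_path:
  fixes Y :: "real \<Rightarrow> 'a \<Rightarrow> real"
  assumes Y: "\<And>s. s \<in> {0..t} \<Longrightarrow> Y s \<in> borel_measurable M" and t: "0 \<le> t"
    and c: "\<And>\<omega>. \<omega> \<in> space M \<Longrightarrow> continuous_on {0..t} (\<lambda>s. Y s \<omega>)"
  shows "(\<lambda>\<omega>. integral {0..t} (\<lambda>s. Y s \<omega>)) \<in> borel_measurable M"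
proof (rule borel_measurable_LIMSEQ_real)
  show "(\<lambda>n. \<Sum>i<Suc n. Y (t * real (Suc i) / real (Suc n)) \<omega> * (t / real (Suc n))) \<longlonglongrightarrow> integral {0..t} (\<lambda>s. Y s \<omega>)"
    if "\<omega> \<in> space M" for \<omega>
    using riemann_sum_tendsto[OF t c[OF that]] .
  show "(\<lambda>\<omega>. \<Sum>i<Suc n. Y (t * real (Suc i) / real (Suc n)) \<omega> * (t / real (Suc n))) \<in> borel_measurable M" for n
    by (intro borel_measurable_sum borel_measurable_times borel_measurable_const Y uniform_grid_in[OF t]) auto
qed

lemma borel_measurable_SUP_path:
  fixes Y :: "real \<Rightarrow> 'a \<Rightarrow> real"
  assumes Y: "\<And>s. s \<in> {0..t} \<Longrightarrow> Y s \<in> borel_measurable M" and t: "0 \<le> t"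
    and c: "\<And>\<omega>. \<omega> \<in> space M \<Longrightarrow> continuous_on {0..t} (\<lambda>s. Y s \<omega>)"
  shows "(\<lambda>\<omega>. SUP s\<in>{0..t}. Y s \<omega>) \<in> borel_measurable M"
  unfolding borel_measurable_iff_greater
proof
  fix a
  have "{\<omega> \<in> space M. a < (SUP s\<in>{0..t}. Y s \<omega>)} = (\<Union>n. {\<omega> \<in> space M. a < Y (clamp_rat t n) \<omega>})"
    using less_SUP_Icc_iff[OF t c] ex_gt_iff_ex_clamp_rat_gt[OF t c] by auto
  also have "\<dots> \<in> sets M"
    using borel_measurable_iff_greater Y[OF clamp_rat_in[OF t]] by (intro sets.countable_UN) blast
  finally show "{\<omega> \<in> space M. a < (SUP s\<in>{0..t}. Y s \<omega>)} \<in> sets M" .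
qed

lemma borel_measurable_parts_integral:
  assumes h: "C1_pair T h h'" and Y: "\<And>s. s \<in> {0..T} \<Longrightarrow> Y s \<in> borel_measurable M"
    and c: "\<And>\<omega>. \<omega> \<in> space M \<Longrightarrow> continuous_on {0..T} (\<lambda>s. Y s \<omega>)" and t: "t \<in> {0..T}"
  shows "(\<lambda>\<omega>. parts_integral h h' (\<lambda>s. Y s \<omega>) t) \<in> borel_measurable M"
proof -
  have sub: "{0..t} \<subseteq> {0..T}" using t by auto
  have [measurable]: "(\<lambda>\<omega>. integral {0..t} (\<lambda>s. h' s * Y s \<omega>)) \<in> borel_measurable M"
  proof (rule borel_measurable_integral_path)
    show "continuous_on {0..t} (\<lambda>s. h' s * Y s \<omega>)" if "\<omega> \<in> space M" for \<omega>
      by (intro continuous_on_subset[OF _ sub] continuous_intros c C1_pair_continuous'[OF h] that)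
  qed (use Y t in auto)
  have [measurable]: "Y t \<in> borel_measurable M" "Y 0 \<in> borel_measurable M"
    using Y t by auto
  show ?thesis unfolding parts_integral_def by measurable
qed

lemma (in prob_space) integrable_square_bounded:
  fixes \<xi> :: "'a \<Rightarrow> real"
  assumes \<xi>: "\<xi> \<in> borel_measurable M" "bounded (\<xi> ` space M)"
  shows "integrable M (\<lambda>\<omega>. (\<xi> \<omega>)\<^sup>2)"
proof -
  obtain B where B: "\<And>\<omega>. \<omega> \<in> space M \<Longrightarrow> \<bar>\<xi> \<omega>\<bar> \<le> B"
    using \<xi>(2) by (auto simp: bounded_iff)
  show ?thesis
  proof (rule integrable_const_bound[of _ "B\<^sup>2"])
    show "AE \<omega> in M. norm ((\<xi> \<omega>)\<^sup>2) \<le> B\<^sup>2"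
    proof (rule AE_I2)
      fix \<omega> assume "\<omega> \<in> space M"
      then have "\<bar>\<xi> \<omega>\<bar>\<^sup>2 \<le> B\<^sup>2" using B[of \<omega>] by (intro power_mono) auto
      then show "norm ((\<xi> \<omega>)\<^sup>2) \<le> B\<^sup>2" by simp
    qed
  qed (use \<xi>(1) in measurable)
qed

section \<open>Increments of a Wiener process and the discrete isometry\<close>

locale wiener = prob_space M for M :: "'a measure" +
  fixes F :: "real \<Rightarrow> 'a measure" and T :: real and W :: "real \<Rightarrow> 'a \<Rightarrow> real"
  assumes wiener: "wiener_process M F T W"
begin

lemma subalgebra_F: "subalgebra M (F t)"
  and filtration_F: "filtration (space M) F"
  and W_measurable_F: "t \<in> {0..T} \<Longrightarrow> W t \<in> borel_measurable (F t)"
  and W_continuous: "\<omega> \<in> space M \<Longrightarrow> continuous_on {0..T} (\<lambda>t. W t \<omega>)"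
  and W_0: "AE \<omega> in M. W 0 \<omega> = 0"
  using wiener
  unfolding wiener_process_def filtered_prob_space_def adapted_def continuous_paths_def by blast+

lemma space_F: "space (F t) = space M"
  using subalgebra_F[of t] by (simp add: subalgebra_def)

lemma measurable_F: "f \<in> borel_measurable (F s) \<Longrightarrow> f \<in> borel_measurable M"
  by (rule measurable_from_subalg[OF subalgebra_F])

lemma measurable_F_mono: "f \<in> borel_measurable (F s) \<Longrightarrow> s \<le> t \<Longrightarrow> f \<in> borel_measurable (F t)"
  by (rule measurable_from_subalg[of "F t" "F s"])
    (simp_all add: subalgebra_def space_F filtration.sets_F_mono[OF filtration_F])

lemma W_measurable: "t \<in> {0..T} \<Longrightarrow> W t \<in> borel_measurable M"
  using W_measurable_F measurable_F by blast

lemma increment_normal: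
  "0 \<le> s \<Longrightarrow> s < t \<Longrightarrow> t \<le> T \<Longrightarrow>
     distributed M lborel (\<lambda>\<omega>. W t \<omega> - W s \<omega>) (normal_density 0 (sqrt (t - s)))"
  using wiener unfolding wiener_process_def by blast

lemma increment_indep_set:
  "0 \<le> s \<Longrightarrow> s < t \<Longrightarrow> t \<le> T \<Longrightarrow>
     indep_set (sets (F s)) (sets (vimage_algebra (space M) (\<lambda>\<omega>. W t \<omega> - W s \<omega>) borel))"
  using wiener unfolding wiener_process_def by blast

lemma increment_indep_var:
  assumes st: "0 \<le> s" "s < t" "t \<le> T" and Y: "Y \<in> borel_measurable (F s)"
  shows "indep_var borel Y borel (\<lambda>\<omega>. W t \<omega> - W s \<omega>)"
  unfolding indep_var_eq
proof (intro conjI)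
  show "random_variable borel Y" using measurable_F[OF Y] .
  show "random_variable borel (\<lambda>\<omega>. W t \<omega> - W s \<omega>)"
    using W_measurable st by (intro borel_measurable_diff) auto
  have "sigma_sets (space M) {Y -` A \<inter> space M |A. A \<in> sets borel} \<subseteq> sets (F s)"
    using measurable_sets[OF Y] sets.top[of "F s"]
    by (intro sets.sigma_sets_subset'[of _ "F s", unfolded space_F]) (auto simp: space_F)
  moreover have "indep_set (sets (F s)) (sigma_sets (space M) {(\<lambda>\<omega>. W t \<omega> - W s \<omega>) -` A \<inter> space M |A. A \<in> sets borel})"
    using increment_indep_set[OF st] by (simp add: sets_vimage_algebra)
  ultimately show "indep_set (sigma_sets (space M) {Y -` A \<inter> space M |A. A \<in> sets borel})
     (sigma_sets (space M) {(\<lambda>\<omega>. W t \<omega> - W s \<omega>) -` A \<inter> space M |A. A \<in> sets borel})"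
    unfolding indep_set_def by (elim indep_sets_mono_sets) (auto split: bool.split)
qed

lemma increment_moments:
  assumes st: "0 \<le> s" "s < t" "t \<le> T"
  shows "integrable M (\<lambda>\<omega>. W t \<omega> - W s \<omega>)" "expectation (\<lambda>\<omega>. W t \<omega> - W s \<omega>) = 0"
    "integrable M (\<lambda>\<omega>. (W t \<omega> - W s \<omega>)\<^sup>2)" "expectation (\<lambda>\<omega>. (W t \<omega> - W s \<omega>)\<^sup>2) = t - s"
proof -
  have pos: "0 < sqrt (t - s)" using st by simp
  note D = increment_normal[OF st]
  show "expectation (\<lambda>\<omega>. W t \<omega> - W s \<omega>) = 0"
    using normal_distributed_expectation[OF pos D] .
  then show "expectation (\<lambda>\<omega>. (W t \<omega> - W s \<omega>)\<^sup>2) = t - s"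
    using normal_distributed_variance[OF pos D] st by simp
  show int2: "integrable M (\<lambda>\<omega>. (W t \<omega> - W s \<omega>)\<^sup>2)"
    using distributed_integrable[OF D, of "\<lambda>x. x\<^sup>2"] integrable_normal_moment[OF pos, of 0 2] by simp
  then show "integrable M (\<lambda>\<omega>. W t \<omega> - W s \<omega>)"
  proof (rule square_integrable_imp_integrable[rotated])
    show "random_variable borel (\<lambda>\<omega>. W t \<omega> - W s \<omega>)"
      using st by (intro borel_measurable_diff W_measurable) simp_all
  qed
qed

text \<open>In the expanded square the cross term is an \<open>F s\<close>-measurable factor times
  an independent centred increment, so its expectation vanishes; in the last term independence
  splits off the variance \<open>t - s\<close>.\<close>

lemma isometry_step:
  assumes st: "0 \<le> s" "s \<le> t" "t \<le> T" and Y: "Y \<in> borel_measurable (F s)" "integrable M (\<lambda>\<omega>. (Y \<omega>)\<^sup>2)"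
    and \<xi>: "\<xi> \<in> borel_measurable (F s)" "bounded (\<xi> ` space M)"
  shows "integrable M (\<lambda>\<omega>. (Y \<omega> + \<xi> \<omega> * (W t \<omega> - W s \<omega>))\<^sup>2)"
    "expectation (\<lambda>\<omega>. (Y \<omega> + \<xi> \<omega> * (W t \<omega> - W s \<omega>))\<^sup>2)
       = expectation (\<lambda>\<omega>. (Y \<omega>)\<^sup>2) + expectation (\<lambda>\<omega>. (\<xi> \<omega>)\<^sup>2 * (t - s))"
proof -
  have "integrable M (\<lambda>\<omega>. (Y \<omega> + \<xi> \<omega> * (W t \<omega> - W s \<omega>))\<^sup>2) \<and>
    expectation (\<lambda>\<omega>. (Y \<omega> + \<xi> \<omega> * (W t \<omega> - W s \<omega>))\<^sup>2)
       = expectation (\<lambda>\<omega>. (Y \<omega>)\<^sup>2) + expectation (\<lambda>\<omega>. (\<xi> \<omega>)\<^sup>2 * (t - s))"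
  \<comment> \<open>The increments are described only for s < t, while grids may contain degenerate
    cells.\<close>
  proof (cases "s = t")
    case False
    then have st': "0 \<le> s" "s < t" "t \<le> T" using st by auto
    define D where "D \<omega> = W t \<omega> - W s \<omega>" for \<omega>
    note mom = increment_moments[OF st', folded D_def]
    note [measurable] = measurable_F[OF Y(1)] measurable_F[OF \<xi>(1)]
    obtain B where B: "\<And>\<omega>. \<omega> \<in> space M \<Longrightarrow> \<bar>\<xi> \<omega>\<bar> \<le> B"
      using \<xi>(2) by (auto simp: bounded_iff)
    have Yint: "integrable M Y"
      by (rule square_integrable_imp_integrable[OF _ Y(2)]) measurable
    have i1: "integrable M (\<lambda>\<omega>. 2 * (Y \<omega> * \<xi> \<omega>))"
    proof (rule integrable_mult_right, rule Bochner_Integration.integrable_bound[of M "\<lambda>\<omega>. B * Y \<omega>"])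
      show "integrable M (\<lambda>\<omega>. B * Y \<omega>)" using Yint by (rule integrable_mult_right)
      show "(\<lambda>\<omega>. Y \<omega> * \<xi> \<omega>) \<in> borel_measurable M" by measurable
      show "AE \<omega> in M. norm (Y \<omega> * \<xi> \<omega>) \<le> norm (B * Y \<omega>)"
      proof (rule AE_I2)
        fix \<omega> assume "\<omega> \<in> space M"
        then have "\<bar>\<xi> \<omega>\<bar> \<le> \<bar>B\<bar>" using B[of \<omega>] by linarith
        then show "norm (Y \<omega> * \<xi> \<omega>) \<le> norm (B * Y \<omega>)"
          by (simp add: abs_mult mult.commute[of "\<bar>Y \<omega>\<bar>"] mult_right_mono)
      qed
    qed
    have i2: "integrable M (\<lambda>\<omega>. (\<xi> \<omega>)\<^sup>2)"
      by (rule integrable_square_bounded[OF measurable_F[OF \<xi>(1)] \<xi>(2)])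
    have ind1: "indep_var borel (\<lambda>\<omega>. 2 * (Y \<omega> * \<xi> \<omega>)) borel D"
      unfolding D_def
      by (intro increment_indep_var[OF st'] borel_measurable_times borel_measurable_const Y(1) \<xi>(1))
    have "indep_var borel (\<lambda>\<omega>. (\<xi> \<omega>)\<^sup>2) borel D"
      unfolding D_def by (intro increment_indep_var[OF st'] borel_measurable_power \<xi>(1))
    from indep_var_compose[OF this, of "\<lambda>x. x" borel "\<lambda>x. x\<^sup>2" borel]
    have ind2: "indep_var borel (\<lambda>\<omega>. (\<xi> \<omega>)\<^sup>2) borel (\<lambda>\<omega>. (D \<omega>)\<^sup>2)"
      by (simp add: comp_def)
    note j1 = indep_var_integrable[OF ind1 i1 mom(1)] and e1 = indep_var_lebesgue_integral[OF ind1 i1 mom(1)]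
    note j2 = indep_var_integrable[OF ind2 i2 mom(3)] and e2 = indep_var_lebesgue_integral[OF ind2 i2 mom(3)]
    have eq: "(Y \<omega> + \<xi> \<omega> * D \<omega>)\<^sup>2 = (Y \<omega>)\<^sup>2 + 2 * (Y \<omega> * \<xi> \<omega>) * D \<omega> + (\<xi> \<omega>)\<^sup>2 * (D \<omega>)\<^sup>2" for \<omega>
      by (simp add: power2_eq_square algebra_simps)
    show ?thesis
      unfolding D_def[symmetric] eq using Y(2) j1 j2 e1 e2 mom by simp
  qed (use Y in simp)
  then show "integrable M (\<lambda>\<omega>. (Y \<omega> + \<xi> \<omega> * (W t \<omega> - W s \<omega>))\<^sup>2)"
    "expectation (\<lambda>\<omega>. (Y \<omega> + \<xi> \<omega> * (W t \<omega> - W s \<omega>))\<^sup>2)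
       = expectation (\<lambda>\<omega>. (Y \<omega>)\<^sup>2) + expectation (\<lambda>\<omega>. (\<xi> \<omega>)\<^sup>2 * (t - s))" by auto
qed

text \<open>The partial sum is measurable at the node where the next increment starts, so
  \<open>isometry_step\<close> applies. Measurability, integrability and the order of the end points
  are carried through the induction for that purpose.\<close>

lemma discrete_isometry:
  assumes p: "0 \<le> p 0" "\<And>i. i < n \<Longrightarrow> p i \<le> p (Suc i)" "p n \<le> T"
    and \<xi>: "\<And>i. i < n \<Longrightarrow> \<xi> i \<in> borel_measurable (F (p i))" "\<And>i. i < n \<Longrightarrow> bounded (\<xi> i ` space M)"
  shows "(\<lambda>\<omega>. \<Sum>i<n. \<xi> i \<omega> * (W (p (Suc i)) \<omega> - W (p i) \<omega>)) \<in> borel_measurable (F (p n)) \<and> p 0 \<le> p n \<and>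
    integrable M (\<lambda>\<omega>. (\<Sum>i<n. \<xi> i \<omega> * (W (p (Suc i)) \<omega> - W (p i) \<omega>))\<^sup>2) \<and>
    expectation (\<lambda>\<omega>. (\<Sum>i<n. \<xi> i \<omega> * (W (p (Suc i)) \<omega> - W (p i) \<omega>))\<^sup>2)
      = expectation (\<lambda>\<omega>. \<Sum>i<n. (\<xi> i \<omega>)\<^sup>2 * (p (Suc i) - p i))"
  using p \<xi>
proof (induction n)
  case 0
  then show ?case by simp
next
  case (Suc n)
  have le: "p n \<le> p (Suc n)" "p n \<le> T" using Suc.prems(2)[of n] Suc.prems(3) by auto
  let ?N = "\<lambda>n \<omega>. \<Sum>i<n. \<xi> i \<omega> * (W (p (Suc i)) \<omega> - W (p i) \<omega>)"
  have "?N n \<in> borel_measurable (F (p n)) \<and> p 0 \<le> p n \<and> integrable M (\<lambda>\<omega>. (?N n \<omega>)\<^sup>2) \<and>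
    expectation (\<lambda>\<omega>. (?N n \<omega>)\<^sup>2) = expectation (\<lambda>\<omega>. \<Sum>i<n. (\<xi> i \<omega>)\<^sup>2 * (p (Suc i) - p i))"
    by (rule Suc.IH[OF Suc.prems(1) Suc.prems(2) le(2) Suc.prems(4) Suc.prems(5)]) (simp_all only: less_SucI)
  then have IH: "?N n \<in> borel_measurable (F (p n))" "p 0 \<le> p n" "integrable M (\<lambda>\<omega>. (?N n \<omega>)\<^sup>2)"
    "expectation (\<lambda>\<omega>. (?N n \<omega>)\<^sup>2) = expectation (\<lambda>\<omega>. \<Sum>i<n. (\<xi> i \<omega>)\<^sup>2 * (p (Suc i) - p i))"
    by blast+
  have in_T: "p n \<in> {0..T}" "p (Suc n) \<in> {0..T}" using IH Suc.prems(1,3) le by auto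
  have xi: "\<xi> n \<in> borel_measurable (F (p n))" "bounded (\<xi> n ` space M)" using Suc.prems(4,5) by auto
  have int: "integrable M (\<lambda>\<omega>. (\<xi> i \<omega>)\<^sup>2 * (p (Suc i) - p i))" if "i < Suc n" for i
    using integrable_square_bounded[OF measurable_F[OF Suc.prems(4)[OF that]] Suc.prems(5)[OF that]] by simp
  note step = isometry_step[of "p n" "p (Suc n)" "?N n" "\<xi> n", OF _ le(1) _ IH(1,3) xi]
  have "?N (Suc n) \<in> borel_measurable (F (p (Suc n)))"
  proof -
    have [measurable]: "?N n \<in> borel_measurable (F (p (Suc n)))" "\<xi> n \<in> borel_measurable (F (p (Suc n)))"
      "W (p n) \<in> borel_measurable (F (p (Suc n)))" "W (p (Suc n)) \<in> borel_measurable (F (p (Suc n)))"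
      using measurable_F_mono[OF _ le(1)] IH xi W_measurable_F in_T by auto
    show ?thesis unfolding sum.lessThan_Suc by measurable
  qed
  moreover have "expectation (\<lambda>\<omega>. \<Sum>i<Suc n. (\<xi> i \<omega>)\<^sup>2 * (p (Suc i) - p i))
      = expectation (\<lambda>\<omega>. \<Sum>i<n. (\<xi> i \<omega>)\<^sup>2 * (p (Suc i) - p i)) + expectation (\<lambda>\<omega>. (\<xi> n \<omega>)\<^sup>2 * (p (Suc n) - p n))"
    unfolding sum.lessThan_Suc using int
    by (intro Bochner_Integration.integral_add Bochner_Integration.integrable_sum) auto
  ultimately show ?case
    using step in_T IH le by auto
qed

text \<open>The integrand is switched off as soon as its accumulated square would pass \<open>b\<close> or the integral
  has passed \<open>a\<close>; Chebyshev's inequality for the remaining integral gives the bound.\<close>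

lemma discrete_lenglart:
  assumes p: "0 \<le> p 0" "\<And>i. i < n \<Longrightarrow> p i \<le> p (Suc i)" "p n \<le> T"
    and \<xi>: "\<And>i. i < n \<Longrightarrow> \<xi> i \<in> borel_measurable (F (p i))" "\<And>i. i < n \<Longrightarrow> bounded (\<xi> i ` space M)"
    and ab: "a > 0" "b \<ge> 0"
  shows "\<exists>B\<in>events. {\<omega> \<in> space M. \<exists>k\<le>n. \<bar>\<Sum>i<k. \<xi> i \<omega> * (W (p (Suc i)) \<omega> - W (p i) \<omega>)\<bar> > a \<and>
      (\<Sum>i<k. (\<xi> i \<omega>)\<^sup>2 * (p (Suc i) - p i)) \<le> b} \<subseteq> B \<and> prob B \<le> b / a\<^sup>2"
proof -
  define N where "N k \<omega> = (\<Sum>i<k. \<xi> i \<omega> * (W (p (Suc i)) \<omega> - W (p i) \<omega>))" for k \<omega>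
  define V where "V k \<omega> = (\<Sum>i<k. (\<xi> i \<omega>)\<^sup>2 * (p (Suc i) - p i))" for k \<omega>
  \<comment> \<open>The condition on \<open>V (Suc i)\<close> already counts cell i. It is
    nevertheless decided at time \<open>p i\<close>, because \<open>\<xi> i\<close> is known there;
    so the cut-off integrand is still adapted.\<close>
  define A where "A i = {\<omega>\<in>space M. V (Suc i) \<omega> \<le> b \<and> (\<forall>j\<in>{..i}. \<bar>N j \<omega>\<bar> \<le> a)}" for i
  define \<zeta> where "\<zeta> i \<omega> = \<xi> i \<omega> * indicator (A i) \<omega>" for i \<omega>
  define N' where "N' \<omega> = (\<Sum>i<n. \<zeta> i \<omega> * (W (p (Suc i)) \<omega> - W (p i) \<omega>))" for \<omega>
  note p_mono = grid_mono[of n p, OF p(2)]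
  have meas_xi: "\<xi> j \<in> borel_measurable (F (p i))" if "j \<le> i" "i < n" for i j
    using measurable_F_mono[OF \<xi>(1)[of j] p_mono[of j i]] that by auto
  have meas_W: "W (p j) \<in> borel_measurable (F (p i))" if "j \<le> i" "i \<le> n" for i j
    using p_mono[of 0 j] p_mono[of j i] p_mono[of j n] that p(1,3)
    by (intro measurable_F_mono[OF W_measurable_F]) auto
  have A_sets: "A i \<in> sets (F (p i))" if i: "i < n" for i
  proof -
    have [measurable]: "V (Suc i) \<in> borel_measurable (F (p i))"
      unfolding V_def using meas_xi i by (intro borel_measurable_sum borel_measurable_times borel_measurable_power) auto
    have mN: "N j \<in> borel_measurable (F (p i))" if "j \<le> i" for j
      unfolding N_def using meas_xi meas_W i that
      by (intro borel_measurable_sum borel_measurable_times borel_measurable_diff) auto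
    have "{\<omega>\<in>space (F (p i)). V (Suc i) \<omega> \<le> b} \<in> sets (F (p i))"
      by measurable
    then have "{\<omega>\<in>space (F (p i)). V (Suc i) \<omega> \<le> b} \<inter> {\<omega>\<in>space (F (p i)). \<forall>j\<in>{..i}. \<bar>N j \<omega>\<bar> \<le> a} \<in> sets (F (p i))"
    proof (intro sets.Int sets.sets_Collect_finite_All')
      show "{\<omega> \<in> space (F (p i)). \<bar>N j \<omega>\<bar> \<le> a} \<in> sets (F (p i))" if "j \<in> {..i}" for j
      proof -
        have [measurable]: "N j \<in> borel_measurable (F (p i))" using mN that by simp
        show ?thesis by measurable
      qed
    qed auto
    also have "{\<omega>\<in>space (F (p i)). V (Suc i) \<omega> \<le> b} \<inter> {\<omega>\<in>space (F (p i)). \<forall>j\<in>{..i}. \<bar>N j \<omega>\<bar> \<le> a} = A i"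
      unfolding A_def space_F by blast
    finally show ?thesis .
  qed
  have \<zeta>: "\<zeta> i \<in> borel_measurable (F (p i))" "bounded (\<zeta> i ` space M)" if i: "i < n" for i
  proof -
    show "\<zeta> i \<in> borel_measurable (F (p i))"
      unfolding \<zeta>_def using \<xi>(1)[OF i] A_sets[OF i] by measurable
    obtain B where "\<And>\<omega>. \<omega> \<in> space M \<Longrightarrow> \<bar>\<xi> i \<omega>\<bar> \<le> B"
      using \<xi>(2)[OF i] by (auto simp: bounded_iff)
    then have "\<bar>\<zeta> i \<omega>\<bar> \<le> \<bar>B\<bar>" if "\<omega> \<in> space M" for \<omega>
      using that by (fastforce simp: \<zeta>_def indicator_def)
    then show "bounded (\<zeta> i ` space M)" by (auto simp: bounded_iff)
  qed
  have V_mono: "V k \<omega> \<le> V k' \<omega>" if "k \<le> k'" "k' \<le> n" for k k' \<omega>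
    unfolding V_def using that p(2) by (intro sum_mono2) auto
  have sq_le: "(\<Sum>i<k. (\<zeta> i \<omega>)\<^sup>2 * (p (Suc i) - p i)) \<le> b" if "k \<le> n" for k \<omega>
    using that
  proof (induction k)
    case (Suc k)
    show ?case
    proof (cases "\<omega> \<in> A k")
      case True
      have "(\<Sum>i<Suc k. (\<zeta> i \<omega>)\<^sup>2 * (p (Suc i) - p i)) \<le> V (Suc k) \<omega>"
        unfolding V_def using Suc.prems p(2)
        by (intro sum_mono mult_right_mono) (auto simp: \<zeta>_def indicator_def)
      then show ?thesis using True by (simp add: A_def)
    qed (use Suc in \<open>simp add: \<zeta>_def\<close>)
  qed (use ab in simp)
  note iso = discrete_isometry[of p n \<zeta>, OF p \<zeta>, folded N'_def]
  define B where "B = {\<omega>\<in>space M. \<bar>N' \<omega>\<bar> \<ge> a}"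
  have mN': "N' \<in> borel_measurable M"
    unfolding N'_def using measurable_F iso unfolding N'_def by blast
  have "prob B \<le> expectation (\<lambda>\<omega>. (N' \<omega>)\<^sup>2) / a\<^sup>2"
    unfolding B_def by (rule second_moment_method[OF mN']) (use iso ab in auto)
  also have "expectation (\<lambda>\<omega>. (N' \<omega>)\<^sup>2) \<le> b"
  proof -
    have eq: "expectation (\<lambda>\<omega>. (N' \<omega>)\<^sup>2) = expectation (\<lambda>\<omega>. \<Sum>i<n. (\<zeta> i \<omega>)\<^sup>2 * (p (Suc i) - p i))"
      using iso by blast
    have "expectation (\<lambda>\<omega>. \<Sum>i<n. (\<zeta> i \<omega>)\<^sup>2 * (p (Suc i) - p i)) \<le> expectation (\<lambda>\<omega>. b)"
    proof (rule integral_mono_AE')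
      show "AE \<omega> in M. (\<Sum>i<n. (\<zeta> i \<omega>)\<^sup>2 * (p (Suc i) - p i)) \<le> b"
        using sq_le by simp
    qed (use ab in simp_all)
    then show ?thesis unfolding eq by (simp add: prob_space)
  qed
  finally have "prob B \<le> b / a\<^sup>2"
    by (simp add: divide_right_mono)
  moreover have "B \<in> events"
    unfolding B_def using mN' by measurable
  moreover have "\<omega> \<in> B" if \<omega>: "\<omega> \<in> space M" and k: "k \<le> n" "\<bar>N k \<omega>\<bar> > a" "V k \<omega> \<le> b" for \<omega> k
  proof -
    \<comment> \<open>The first passage over a. Before m nothing is switched off, as the accumulated
      square is at most \<open>V k \<omega>\<close>; from m on everything is, as index m violates
      the second condition. Hence the truncated sum freezes at \<open>N m \<omega>\<close>.\<close>
    define m where "m = (LEAST m. \<bar>N m \<omega>\<bar> > a)"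
    have m: "\<bar>N m \<omega>\<bar> > a" unfolding m_def using k(2) by (rule LeastI)
    have before: "\<bar>N j \<omega>\<bar> \<le> a" if "j < m" for j
      using not_less_Least[of j "\<lambda>m. \<bar>N m \<omega>\<bar> > a"] that unfolding m_def by auto
    have "m \<le> k" unfolding m_def using k(2) by (rule Least_le)
    have "\<zeta> i \<omega> = (if i < m then \<xi> i \<omega> else 0)" if "i < n" for i
    proof (cases "i < m")
      case True
      then have "V (Suc i) \<omega> \<le> V k \<omega>" using \<open>m \<le> k\<close> k(1) by (intro V_mono) auto
      then have "\<omega> \<in> A i" using True before k \<omega> by (auto simp: A_def)
      then show ?thesis using True by (simp add: \<zeta>_def)
    next
      case False
      then have "\<omega> \<notin> A i" using m by (auto simp: A_def not_less not_le intro!: bexI[of _ m])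
      then show ?thesis using False by (simp add: \<zeta>_def)
    qed
    then have "N' \<omega> = (\<Sum>i<n. if i < m then \<xi> i \<omega> * (W (p (Suc i)) \<omega> - W (p i) \<omega>) else 0)"
      unfolding N'_def by (intro sum.cong) auto
    also have "\<dots> = N m \<omega>"
      unfolding N_def using \<open>m \<le> k\<close> k(1)
      by (subst sum.inter_filter[symmetric]) (auto intro!: sum.cong)
    finally show ?thesis using m \<omega> by (simp add: B_def)
  qed
  ultimately show ?thesis
    unfolding N_def V_def by blast
qed

end

section \<open>Simple processes\<close>

lemma finite_grid:
  fixes G :: "real set"
  assumes G: "finite G" "0 \<in> G" "G \<subseteq> {0..T}"
  obtains p :: "nat \<Rightarrow> real" and n where "G = p ` {..n}" "p 0 = 0" "\<And>i. i < n \<Longrightarrow> p i \<le> p (Suc i)" "p n \<le> T"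
    "\<And>g i. g \<in> G \<Longrightarrow> i < n \<Longrightarrow> g \<le> p i \<or> p (Suc i) \<le> g"
proof -
  define l where "l = sorted_list_of_set G"
  define n where "n = length l - 1"
  have l: "set l = G" "sorted l" "l \<noteq> []"
    using G by (auto simp: l_def)
  have mono: "l ! i \<le> l ! j" if "i \<le> j" "j \<le> n" for i j
  proof (rule sorted_nth_mono[OF l(2) that(1)])
    show "j < length l" using that(2) l(3) by (cases l) (auto simp: n_def)
  qed
  have G_eq: "G = (\<lambda>i. l ! i) ` {..n}"
    using l by (auto simp: n_def set_conv_nth image_iff) (metis Suc_pred length_greater_0_conv less_Suc_eq_le)+
  have in_G: "l ! i \<in> G" if "i \<le> n" for i
    using G_eq that by blast
  obtain j where j: "j \<le> n" "l ! j = 0" using G(2) G_eq by auto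
  have "l ! 0 = 0"
    using mono[of 0 j] j in_G[of 0] G(3) by auto
  moreover have "g \<le> l ! i \<or> l ! Suc i \<le> g" if "g \<in> G" "i < n" for g i
  proof -
    obtain j where "j \<le> n" "g = l ! j" using \<open>g \<in> G\<close> G_eq by auto
    then show ?thesis using mono[of j i] mono[of "Suc i" j] that by (cases "j \<le> i") auto
  qed
  moreover have "l ! n \<le> T" using in_G[of n] G(3) by auto
  ultimately show thesis
    using that[of "\<lambda>i. l ! i" n] G_eq mono by auto
qed

text \<open>Neither a nor b lies strictly inside a cell, so every nondegenerate cell is either
  contained in the interval from a to b or outside it, and the increment telescopes over the cells
  inside.\<close>

lemma increment_over_grid:
  fixes w :: "real \<Rightarrow> real"
  assumes p: "p 0 = 0" "\<And>i. i < n \<Longrightarrow> p i \<le> p (Suc i)"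
    and ab: "0 \<le> a" "a \<le> b" "\<And>i. i < n \<Longrightarrow> a \<le> p i \<or> p (Suc i) \<le> a" "\<And>i. i < n \<Longrightarrow> b \<le> p i \<or> p (Suc i) \<le> b"
    and k: "k \<le> n"
  shows "w (min b (p k)) - w (min a (p k)) = (\<Sum>i<k. if a \<le> p i \<and> p i < b then w (p (Suc i)) - w (p i) else 0)"
  using k
proof (induction k)
  case 0
  then show ?case using p ab by simp
next
  case (Suc k)
  then have IH: "w (min b (p k)) - w (min a (p k)) = (\<Sum>i<k. if a \<le> p i \<and> p i < b then w (p (Suc i)) - w (p i) else 0)"
    and kn: "k < n" by simp_all
  show ?case
  proof (cases "a = b")
    case False
    then show ?thesis
      using p(2)[OF kn] ab(2) ab(3)[OF kn] ab(4)[OF kn] IH by (auto simp: min_def split: if_splits)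
  qed (simp add: not_less[symmetric])
qed

text \<open>The right limit at \<open>s\<close> of \<^const>\<open>simple_value\<close>, which is left-continuous; it is \<open>F s\<close>-measurable.\<close>

definition simple_right_value :: "'a simple_process \<Rightarrow> real \<Rightarrow> 'a \<Rightarrow> real" where
  "simple_right_value ps s \<omega> = (\<Sum>(a, b, \<xi>)\<leftarrow>ps. if a \<le> s \<and> s < b then \<xi> \<omega> else 0)"

definition endpoints :: "'a simple_process \<Rightarrow> real set" where
  "endpoints ps = (\<Union>(a, b, \<xi>)\<in>set ps. {a, b})"

lemma is_simple_process_Cons:
  "is_simple_process M F T ((a, b, \<xi>) # ps) \<longleftrightarrow>
     0 \<le> a \<and> a \<le> b \<and> b \<le> T \<and> \<xi> \<in> borel_measurable (F a) \<and> bounded (\<xi> ` space M) \<and> is_simple_process M F T ps"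
  by (auto simp: is_simple_process_def)

lemma is_simple_process_append:
  "is_simple_process M F T (ps @ qs) \<longleftrightarrow> is_simple_process M F T ps \<and> is_simple_process M F T qs"
  unfolding is_simple_process_def set_append ball_Un ..

lemma endpoints_subset: "is_simple_process M F T ps \<Longrightarrow> endpoints ps \<subseteq> {0..T}"
  by (force simp: is_simple_process_def endpoints_def)

lemma finite_endpoints: "finite (endpoints ps)"
  by (auto simp: endpoints_def)

text \<open>The intervals of a simple process may overlap. On a grid that separates all their end
  points the integral becomes a sum over disjoint cells with coefficients known at the left nodes,
  which is the form that \<open>discrete_lenglart\<close> treats.\<close>

lemma simple_integral_wrt_grid:
  fixes ps :: "'a simple_process"
  assumes p: "p 0 = 0" "\<And>i. i < n \<Longrightarrow> p i \<le> p (Suc i)"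
    and ps: "is_simple_process M F T ps"
    and G: "\<And>g i. g \<in> endpoints ps \<Longrightarrow> i < n \<Longrightarrow> g \<le> p i \<or> p (Suc i) \<le> g"
    and k: "k \<le> n"
  shows "simple_integral_wrt W ps (p k) \<omega> = (\<Sum>i<k. simple_right_value ps (p i) \<omega> * (W (p (Suc i)) \<omega> - W (p i) \<omega>))"
  using ps G
proof (induction ps)
  case Nil
  then show ?case by (simp add: simple_integral_wrt_def simple_right_value_def)
next
  case (Cons x ps)
  obtain a b \<xi> where x: "x = (a, b, \<xi>)" by (cases x)
  have ab: "0 \<le> a" "a \<le> b" using Cons.prems(1) by (auto simp: x is_simple_process_Cons)
  have IH: "simple_integral_wrt W ps (p k) \<omega> = (\<Sum>i<k. simple_right_value ps (p i) \<omega> * (W (p (Suc i)) \<omega> - W (p i) \<omega>))"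
  proof (rule Cons.IH)
    show "is_simple_process M F T ps" using Cons.prems(1) by (simp add: x is_simple_process_Cons)
    show "g \<le> p i \<or> p (Suc i) \<le> g" if "g \<in> endpoints ps" "i < n" for g i
      using that by (intro Cons.prems(2)) (simp_all add: endpoints_def)
  qed
  have sep: "a \<le> p i \<or> p (Suc i) \<le> a" "b \<le> p i \<or> p (Suc i) \<le> b" if "i < n" for i
    using that by (intro Cons.prems(2); simp add: endpoints_def x)+
  have "W (min b (p k)) \<omega> - W (min a (p k)) \<omega>
      = (\<Sum>i<k. if a \<le> p i \<and> p i < b then W (p (Suc i)) \<omega> - W (p i) \<omega> else 0)"
    by (rule increment_over_grid[of p n a b k "\<lambda>t. W t \<omega>"]) (fact p ab sep k)+
  then have "\<xi> \<omega> * (W (min b (p k)) \<omega> - W (min a (p k)) \<omega>)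
     = (\<Sum>i<k. (if a \<le> p i \<and> p i < b then \<xi> \<omega> else 0) * (W (p (Suc i)) \<omega> - W (p i) \<omega>))"
    by (simp add: sum_distrib_left if_distrib if_distribR cong: if_cong)
  then show ?case
    using IH by (simp add: simple_integral_wrt_def simple_right_value_def x sum.distrib distrib_right)
qed

lemma simple_value_grid:
  assumes "\<And>g. g \<in> endpoints ps \<Longrightarrow> g \<le> s \<or> s' \<le> g" "s < t" "t \<le> s'"
  shows "simple_value ps t \<omega> = simple_right_value ps s \<omega>"
  using assms(1)
proof (induction ps)
  case Nil
  then show ?case by (simp add: simple_value_def simple_right_value_def)
next
  case (Cons x ps)
  obtain a b \<xi> where x: "x = (a, b, \<xi>)" by (cases x)
  have IH: "simple_value ps t \<omega> = simple_right_value ps s \<omega>"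
    by (rule Cons.IH, rule Cons.prems) (simp add: endpoints_def)
  have "a \<le> s \<or> s' \<le> a" "b \<le> s \<or> s' \<le> b"
    by (rule Cons.prems, simp add: endpoints_def x)+
  then have "indicator {a<..b} t = (if a \<le> s \<and> s < b then 1 else (0::real))"
    using assms(2,3) by (auto simp: indicator_def)
  then show ?case using IH by (simp add: simple_value_def simple_right_value_def x)
qed

lemma simple_value_borel: "(\<lambda>t. simple_value ps t \<omega>) \<in> borel_measurable borel"
proof (induction ps)
  case (Cons x ps)
  obtain a b \<xi> where x: "x = (a, b, \<xi>)" by (cases x)
  have "(\<lambda>t. \<xi> \<omega> * indicator {a<..b} t + simple_value ps t \<omega>) \<in> borel_measurable borel"
    using Cons.IH by measurable
  then show ?case by (simp add: simple_value_def x)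
qed (simp add: simple_value_def)

lemma nn_integral_simple_value_ge:
  assumes p: "p 0 = 0" "\<And>i. i < n \<Longrightarrow> p i \<le> p (Suc i)"
    and G: "\<And>g i. g \<in> endpoints ps \<Longrightarrow> i < n \<Longrightarrow> g \<le> p i \<or> p (Suc i) \<le> g"
    and k: "k \<le> n"
  shows "ennreal (\<Sum>i<k. (simple_right_value ps (p i) \<omega>)\<^sup>2 * (p (Suc i) - p i))
     \<le> (\<integral>\<^sup>+t\<in>{0..p k}. ennreal ((simple_value ps t \<omega>)\<^sup>2) \<partial>lborel) \<and> 0 \<le> p k"
  using k
proof (induction k)
  case 0
  then show ?case using p by simp
next
  case (Suc k)
  let ?c = "simple_right_value ps (p k) \<omega>"
  have kn: "k < n" using Suc by simp
  note le = p(2)[OF kn]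
  have [measurable]: "(\<lambda>t. simple_value ps t \<omega>) \<in> borel_measurable borel" by (rule simple_value_borel)
  have IH: "ennreal (\<Sum>i<k. (simple_right_value ps (p i) \<omega>)\<^sup>2 * (p (Suc i) - p i))
     \<le> (\<integral>\<^sup>+t\<in>{0..p k}. ennreal ((simple_value ps t \<omega>)\<^sup>2) \<partial>lborel)" "0 \<le> p k"
    using Suc by auto
  have "ennreal (\<Sum>i<Suc k. (simple_right_value ps (p i) \<omega>)\<^sup>2 * (p (Suc i) - p i))
      = ennreal (\<Sum>i<k. (simple_right_value ps (p i) \<omega>)\<^sup>2 * (p (Suc i) - p i)) + ennreal (?c\<^sup>2 * (p (Suc k) - p k))"
    unfolding sum.lessThan_Suc using kn p(2) by (intro ennreal_plus sum_nonneg mult_nonneg_nonneg) auto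
  also have "ennreal (?c\<^sup>2 * (p (Suc k) - p k)) = (\<integral>\<^sup>+t\<in>{p k<..p (Suc k)}. ennreal (?c\<^sup>2) \<partial>lborel)"
    using le by (simp add: nn_integral_cmult_indicator ennreal_mult)
  also have "\<dots> = (\<integral>\<^sup>+t\<in>{p k<..p (Suc k)}. ennreal ((simple_value ps t \<omega>)\<^sup>2) \<partial>lborel)"
  proof (rule nn_integral_cong)
    fix t
    show "ennreal (?c\<^sup>2) * indicator {p k<..p (Suc k)} t = ennreal ((simple_value ps t \<omega>)\<^sup>2) * indicator {p k<..p (Suc k)} t"
    proof (cases "t \<in> {p k<..p (Suc k)}")
      case True
      then have "simple_value ps t \<omega> = ?c"
        using G kn by (intro simple_value_grid[of ps "p k" "p (Suc k)"]) auto
      then show ?thesis by simp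
    qed simp
  qed
  finally have "ennreal (\<Sum>i<Suc k. (simple_right_value ps (p i) \<omega>)\<^sup>2 * (p (Suc i) - p i))
     \<le> (\<integral>\<^sup>+t\<in>{0..p k}. ennreal ((simple_value ps t \<omega>)\<^sup>2) \<partial>lborel)
        + (\<integral>\<^sup>+t\<in>{p k<..p (Suc k)}. ennreal ((simple_value ps t \<omega>)\<^sup>2) \<partial>lborel)"
    using IH(1) by (simp add: add_right_mono)
  also have "\<dots> = (\<integral>\<^sup>+t. ennreal ((simple_value ps t \<omega>)\<^sup>2) * indicator {0..p k} t
      + ennreal ((simple_value ps t \<omega>)\<^sup>2) * indicator {p k<..p (Suc k)} t \<partial>lborel)"
    by (rule nn_integral_add[symmetric]) measurable
  also have "\<dots> = (\<integral>\<^sup>+t\<in>{0..p (Suc k)}. ennreal ((simple_value ps t \<omega>)\<^sup>2) \<partial>lborel)"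
    using IH(2) le by (intro nn_integral_cong) (auto simp: indicator_def)
  finally show ?case using IH(2) le by simp
qed

context wiener
begin

lemma simple_right_value_measurable:
  assumes "is_simple_process M F T ps"
  shows "simple_right_value ps s \<in> borel_measurable (F s)" "bounded (simple_right_value ps s ` space M)"
proof -
  have "simple_right_value ps s \<in> borel_measurable (F s) \<and> bounded (simple_right_value ps s ` space M)"
    using assms
  proof (induction ps)
    case Nil
    have "simple_right_value [] s = (\<lambda>\<omega>::'a. 0)"
      by (simp add: simple_right_value_def fun_eq_iff)
    then show ?case by (simp add: image_constant_conv)
  next
    case (Cons x ps)
    obtain a b \<xi> where x: "x = (a, b, \<xi>)" by (cases x)
    define \<zeta> where "\<zeta> \<omega> = (if a \<le> s \<and> s < b then \<xi> \<omega> else 0)" for \<omega>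
    have eq: "simple_right_value (x # ps) s = (\<lambda>\<omega>. \<zeta> \<omega> + simple_right_value ps s \<omega>)"
      by (simp add: simple_right_value_def x \<zeta>_def fun_eq_iff)
    have xi: "\<xi> \<in> borel_measurable (F a)" "bounded (\<xi> ` space M)" "is_simple_process M F T ps"
      using Cons.prems by (simp_all add: x is_simple_process_Cons)
    have "\<zeta> \<in> borel_measurable (F s)"
      unfolding \<zeta>_def using measurable_F_mono[OF xi(1), of s] by (cases "a \<le> s \<and> s < b") auto
    moreover have "bounded (\<zeta> ` space M)"
      unfolding \<zeta>_def using xi(2) by (cases "a \<le> s \<and> s < b") (auto simp: image_constant_conv)
    ultimately show ?case
      unfolding eq using Cons.IH[OF xi(3)] by (auto intro: bounded_plus_comp)
  qed
  then show "simple_right_value ps s \<in> borel_measurable (F s)" "bounded (simple_right_value ps s ` space M)"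
    by auto
qed

text \<open>The times in D are put into the grid together with the end points of the simple process,
  so each of them is a node and \<open>discrete_lenglart\<close> covers them all at once. The
  conclusion speaks of a covering event B, which spares a measurability proof for the set
  itself.\<close>

lemma simple_integral_lenglart:
  assumes ps: "is_simple_process M F T ps" and D: "finite D" "D \<subseteq> {0..T}" and ab: "a > 0" "b \<ge> 0" and T: "0 \<le> T"
  shows "\<exists>B\<in>events. {\<omega> \<in> space M. \<exists>t\<in>D. \<bar>simple_integral_wrt W ps t \<omega>\<bar> > a \<and>
      (\<integral>\<^sup>+s\<in>{0..t}. ennreal ((simple_value ps s \<omega>)\<^sup>2) \<partial>lborel) \<le> ennreal b} \<subseteq> B \<and> prob B \<le> b / a\<^sup>2"
proof -
  define G where "G = insert 0 (D \<union> endpoints ps)"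
  have "finite G" "0 \<in> G" "G \<subseteq> {0..T}"
    using D finite_endpoints endpoints_subset[OF ps] T by (auto simp: G_def)
  from finite_grid[OF this] obtain p n where p: "G = p ` {..n}" "p 0 = 0" "\<And>i. i < n \<Longrightarrow> p i \<le> p (Suc i)" "p n \<le> T"
    and sep: "\<And>g i. g \<in> G \<Longrightarrow> i < n \<Longrightarrow> g \<le> p i \<or> p (Suc i) \<le> g" by metis
  have sep': "\<And>g i. g \<in> endpoints ps \<Longrightarrow> i < n \<Longrightarrow> g \<le> p i \<or> p (Suc i) \<le> g"
    using sep by (auto simp: G_def)
  have "\<exists>B\<in>events. {\<omega> \<in> space M. \<exists>k\<le>n. \<bar>\<Sum>i<k. simple_right_value ps (p i) \<omega> * (W (p (Suc i)) \<omega> - W (p i) \<omega>)\<bar> > a \<and>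
      (\<Sum>i<k. (simple_right_value ps (p i) \<omega>)\<^sup>2 * (p (Suc i) - p i)) \<le> b} \<subseteq> B \<and> prob B \<le> b / a\<^sup>2"
    by (rule discrete_lenglart) (use p ab simple_right_value_measurable[OF ps] in simp_all)
  then obtain B where B: "B \<in> events" "prob B \<le> b / a\<^sup>2"
    "\<And>\<omega> k. \<omega> \<in> space M \<Longrightarrow> k \<le> n \<Longrightarrow> \<bar>\<Sum>i<k. simple_right_value ps (p i) \<omega> * (W (p (Suc i)) \<omega> - W (p i) \<omega>)\<bar> > a \<Longrightarrow>
      (\<Sum>i<k. (simple_right_value ps (p i) \<omega>)\<^sup>2 * (p (Suc i) - p i)) \<le> b \<Longrightarrow> \<omega> \<in> B"
    by blast
  have "\<omega> \<in> B" if \<omega>: "\<omega> \<in> space M" and t: "t \<in> D" "\<bar>simple_integral_wrt W ps t \<omega>\<bar> > a"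
    "(\<integral>\<^sup>+s\<in>{0..t}. ennreal ((simple_value ps s \<omega>)\<^sup>2) \<partial>lborel) \<le> ennreal b" for \<omega> t
  proof -
    obtain k where k: "k \<le> n" "t = p k" using t(1) p(1) by (auto simp: G_def)
    have "ennreal (\<Sum>i<k. (simple_right_value ps (p i) \<omega>)\<^sup>2 * (p (Suc i) - p i)) \<le> ennreal b"
      using nn_integral_simple_value_ge[of p n ps k \<omega>, OF p(2,3) sep' k(1)] t(3) k(2) by (auto intro: order_trans)
    then have "(\<Sum>i<k. (simple_right_value ps (p i) \<omega>)\<^sup>2 * (p (Suc i) - p i)) \<le> b"
      using ab(2) by (simp add: ennreal_le_iff)
    then show ?thesis
      using t(2) simple_integral_wrt_grid[of p n M F T ps k W \<omega>, OF p(2,3) ps sep' k(1)] k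
      by (intro B(3)[OF \<omega> k(1)]) simp_all
  qed
  then show ?thesis using B(1,2) by blast
qed

end

lemma (in prob_space) prob_gt_tendsto_0:
  fixes Z :: "nat \<Rightarrow> 'a \<Rightarrow> real"
  assumes Z: "\<And>n. Z n \<in> borel_measurable M" and lim: "\<And>\<omega>. \<omega> \<in> space M \<Longrightarrow> (\<lambda>n. Z n \<omega>) \<longlonglongrightarrow> 0" and e: "e > 0"
  shows "(\<lambda>n. prob {\<omega>\<in>space M. e < Z n \<omega>}) \<longlonglongrightarrow> 0"
proof -
  note [measurable] = Z
  have "(\<lambda>n. expectation (indicator {\<omega>\<in>space M. e < Z n \<omega>})) \<longlonglongrightarrow> expectation (\<lambda>_. 0 :: real)"
  proof (rule integral_dominated_convergence[of _ _ _ "\<lambda>_. 1"])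
    show "AE \<omega> in M. (\<lambda>n. indicator {\<omega>\<in>space M. e < Z n \<omega>} \<omega> :: real) \<longlonglongrightarrow> 0"
    proof (rule AE_I2)
      fix \<omega> assume \<omega>: "\<omega> \<in> space M"
      have "\<forall>\<^sub>F n in sequentially. Z n \<omega> < e"
        using order_tendstoD(2)[OF lim[OF \<omega>] e] .
      then show "(\<lambda>n. indicator {\<omega>\<in>space M. e < Z n \<omega>} \<omega> :: real) \<longlonglongrightarrow> 0"
        by (intro tendsto_eventually) (auto elim!: eventually_mono)
    qed
  qed (auto simp: indicator_def)
  then show ?thesis by simp
qed

section \<open>Step approximation of a deterministic integrand\<close>

definition step_process :: "(real \<Rightarrow> real) \<Rightarrow> real \<Rightarrow> nat \<Rightarrow> 'a simple_process" where
  "step_process h T m =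
     map (\<lambda>j. (T * real j / real m, T * real (Suc j) / real m, \<lambda>_. h (T * real j / real m))) [0..<m]"

lemma simple_value_append: "simple_value (ps @ qs) t \<omega> = simple_value ps t \<omega> + simple_value qs t \<omega>"
  by (simp add: simple_value_def)

lemma simple_integral_wrt_append:
  "simple_integral_wrt W (ps @ qs) t \<omega> = simple_integral_wrt W ps t \<omega> + simple_integral_wrt W qs t \<omega>"
  by (simp add: simple_integral_wrt_def)

lemma simple_value_step_process:
  "simple_value (step_process h T m) t \<omega>
     = (\<Sum>j<m. h (T * real j / real m) * indicator {T * real j / real m<..T * real (Suc j) / real m} t)"
  by (simp add: simple_value_def step_process_def comp_def interv_sum_list_conv_sum_set_nat atLeast0LessThan)

lemma simple_integral_wrt_step_process:
  "simple_integral_wrt W (step_process h T m) t \<omega>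
     = (\<Sum>j<m. h (T * real j / real m) * (W (min (T * real (Suc j) / real m) t) \<omega> - W (min (T * real j / real m) t) \<omega>))"
  by (simp add: simple_integral_wrt_def step_process_def comp_def interv_sum_list_conv_sum_set_nat atLeast0LessThan)

lemma simple_value_step_process_near:
  assumes T: "0 < T" and m: "0 < m" and t: "0 < t" "t \<le> T"
  obtains j where "j < m" "t \<in> {T * real j / real m<..T * real (Suc j) / real m}"
    "simple_value (step_process h T m) t \<omega> = h (T * real j / real m)"
proof -
  define y where "y = t * real m / T"
  have y: "0 < y" "y \<le> real m" using T m t by (auto simp: y_def field_simps)
  \<comment> \<open>The cells are open on the left and closed on the right, so the index is the
    ceiling minus one rather than the floor.\<close>
  define j where "j = nat (\<lceil>y\<rceil> - 1)"
  have cy: "0 < \<lceil>y\<rceil>" "\<lceil>y\<rceil> \<le> int m" using y by (auto simp: ceiling_le_iff)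
  have iff: "t \<in> {T * real i / real m<..T * real (Suc i) / real m} \<longleftrightarrow> i = j" for i
  proof -
    have "t \<in> {T * real i / real m<..T * real (Suc i) / real m} \<longleftrightarrow> real i < y \<and> y \<le> real i + 1"
      using T m by (auto simp: y_def field_simps)
    also have "\<dots> \<longleftrightarrow> \<lceil>y\<rceil> = int i + 1"
      by (simp add: ceiling_eq_iff)
    also have "\<dots> \<longleftrightarrow> i = j" using cy by (auto simp: j_def)
    finally show ?thesis .
  qed
  have j: "j < m" unfolding j_def using cy by (subst nat_less_iff) linarith+
  have "simple_value (step_process h T m) t \<omega> = (\<Sum>i<m. if i = j then h (T * real i / real m) else 0)"
    unfolding simple_value_step_process by (rule sum.cong) (use iff in \<open>auto simp: indicator_def\<close>)
  then show thesis using j iff by (intro that[of j]) auto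
qed

lemma simple_integral_step_process_near:
  assumes T: "0 \<le> T" and m: "0 < m" and t: "t \<in> {0..T}" and h: "C1_pair T h h'"
    and w: "continuous_on {0..T} (\<lambda>s. W s \<omega>)"
    and K: "\<And>s. s \<in> {0..T} \<Longrightarrow> \<bar>h' s\<bar> \<le> K"
    and e: "\<And>s s'. s \<in> {0..T} \<Longrightarrow> s' \<in> {0..T} \<Longrightarrow> \<bar>s - s'\<bar> \<le> T / real m \<Longrightarrow> \<bar>W s \<omega> - W s' \<omega>\<bar> \<le> e"
  shows "\<bar>parts_integral h h' (\<lambda>s. W s \<omega>) t - simple_integral_wrt W (step_process h T m) t \<omega>\<bar> \<le> K * e * t"
proof -
  \<comment> \<open>Integration up to t amounts to stopping the nodes at t; the cells beyond t
    collapse, which \<open>parts_integral_sum_error\<close> permits.\<close>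
  define p where "p i = min (T * real i / real m) t" for i
  have g: "T * real i / real m \<le> T * real (Suc i) / real m" "0 \<le> T * real i / real m"
    "T * real (Suc i) / real m - T * real i / real m = T / real m" for i
    using T m by (auto simp: divide_right_mono mult_left_mono field_simps)
  have p0: "p 0 = 0" "p m = t" using t m by (auto simp: p_def)
  have p_mono: "p i \<le> p (Suc i)" for i
    using g(1)[of i] by (auto simp: p_def)
  have p_in: "p i \<in> {0..T}" for i
    using t g(2)[of i] by (auto simp: p_def)
  have diff: "p (Suc i) - p i \<le> T / real m" for i
    using g(1,3)[of i] by (auto simp: p_def)
  have "\<bar>parts_integral h h' (\<lambda>s. W s \<omega>) (p m) - parts_integral h h' (\<lambda>s. W s \<omega>) (p 0)
            - (\<Sum>i<m. h (T * real i / real m) * (W (p (Suc i)) \<omega> - W (p i) \<omega>))\<bar> \<le> K * e * (p m - p 0) \<and> p 0 \<le> p m"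
  proof (rule parts_integral_sum_error[OF h w])
    fix i
    show "p i \<le> p (Suc i)" by (rule p_mono)
    show "T * real i / real m \<in> {p i..p (Suc i)}" if "p i < p (Suc i)"
      using that g(1)[of i] by (auto simp: p_def)
    show "\<bar>W s \<omega> - W s' \<omega>\<bar> \<le> e" if "s \<in> {p i..p (Suc i)}" "s' \<in> {p i..p (Suc i)}" for s s'
      using that diff[of i] p_in[of i] p_in[of "Suc i"] by (intro e) auto
  qed (use p0 t K in auto)
  then show ?thesis
    unfolding p0 simple_integral_wrt_step_process by (simp add: p_def parts_integral_def)
qed

lemma nn_integral_square_sum3:
  fixes f g h :: "real \<Rightarrow> real"
  assumes [measurable]: "f \<in> borel_measurable borel" "g \<in> borel_measurable borel" "h \<in> borel_measurable borel"
    and A[measurable]: "A \<in> sets borel"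
  shows "(\<integral>\<^sup>+s\<in>A. ennreal ((f s + g s + h s)\<^sup>2) \<partial>lborel)
     \<le> 3 * ((\<integral>\<^sup>+s\<in>A. ennreal ((f s)\<^sup>2) \<partial>lborel) + (\<integral>\<^sup>+s\<in>A. ennreal ((g s)\<^sup>2) \<partial>lborel) + (\<integral>\<^sup>+s\<in>A. ennreal ((h s)\<^sup>2) \<partial>lborel))"
proof -
  have sq: "(x + y + z)\<^sup>2 \<le> 3 * (x\<^sup>2 + y\<^sup>2 + z\<^sup>2)" for x y z :: real
    using zero_le_power2[of "x - y"] zero_le_power2[of "y - z"] zero_le_power2[of "x - z"]
    by (simp add: power2_eq_square algebra_simps)
  have "ennreal ((f s + g s + h s)\<^sup>2) \<le> 3 * (ennreal ((f s)\<^sup>2) + ennreal ((g s)\<^sup>2) + ennreal ((h s)\<^sup>2))" for s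
  proof -
    have "ennreal ((f s + g s + h s)\<^sup>2) \<le> ennreal (3 * ((f s)\<^sup>2 + (g s)\<^sup>2 + (h s)\<^sup>2))"
      by (intro ennreal_leI sq)
    also have "\<dots> = ennreal 3 * (ennreal ((f s)\<^sup>2) + ennreal ((g s)\<^sup>2) + ennreal ((h s)\<^sup>2))"
      by (simp only: ennreal_mult' ennreal_plus zero_le_power2 add_nonneg_nonneg zero_le_numeral)
    finally show ?thesis by simp
  qed
  then have "(\<integral>\<^sup>+s\<in>A. ennreal ((f s + g s + h s)\<^sup>2) \<partial>lborel)
     \<le> (\<integral>\<^sup>+s. 3 * (ennreal ((f s)\<^sup>2) * indicator A s + ennreal ((g s)\<^sup>2) * indicator A s + ennreal ((h s)\<^sup>2) * indicator A s) \<partial>lborel)"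
    by (intro nn_integral_mono) (auto simp: indicator_def)
  also have "\<dots> = 3 * ((\<integral>\<^sup>+s\<in>A. ennreal ((f s)\<^sup>2) \<partial>lborel) + (\<integral>\<^sup>+s\<in>A. ennreal ((g s)\<^sup>2) \<partial>lborel) + (\<integral>\<^sup>+s\<in>A. ennreal ((h s)\<^sup>2) \<partial>lborel))"
    by (simp add: nn_integral_cmult nn_integral_add)
  finally show ?thesis .
qed

context wiener
begin

lemma is_simple_step_process:
  assumes "0 \<le> T" "0 < m"
  shows "is_simple_process M F T (step_process h T m)"
  unfolding is_simple_process_def step_process_def
proof (clarsimp, intro conjI)
  fix j assume j: "j < m"
  show "0 \<le> T * real j / real m" using assms by simp
  show "T * real j / real m \<le> T * (1 + real j) / real m"
    using assms by (intro divide_right_mono mult_left_mono) auto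
  have "1 + real j \<le> real m" using j by linarith
  then have "T * (1 + real j) \<le> T * real m" using assms by (intro mult_left_mono)
  then show "T * (1 + real j) / real m \<le> T" using assms by (simp add: divide_le_eq)
  show "bounded ((\<lambda>_. h (T * real j / real m)) ` space M)" by (auto simp: image_constant_conv)
qed

lemma simple_integral_wrt_path:
  assumes "is_simple_process M F T ps"
  shows "t \<in> {0..T} \<Longrightarrow> simple_integral_wrt W ps t \<in> borel_measurable M"
    and "\<omega> \<in> space M \<Longrightarrow> continuous_on {0..T} (\<lambda>t. simple_integral_wrt W ps t \<omega>)"
proof -
  have "(t \<in> {0..T} \<longrightarrow> simple_integral_wrt W ps t \<in> borel_measurable M) \<and>
    (\<omega> \<in> space M \<longrightarrow> continuous_on {0..T} (\<lambda>t. simple_integral_wrt W ps t \<omega>))"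
    using assms
  proof (induction ps)
    case Nil
    have eq: "simple_integral_wrt W [] = (\<lambda>t \<omega>. 0)"
      by (simp add: simple_integral_wrt_def fun_eq_iff)
    show ?case unfolding eq by simp
  next
    case (Cons x ps)
    obtain a b \<xi> where x: "x = (a, b, \<xi>)" by (cases x)
    have xi: "\<xi> \<in> borel_measurable M" "0 \<le> a" "a \<le> b" "b \<le> T" "is_simple_process M F T ps"
      using Cons.prems measurable_F by (auto simp: x is_simple_process_Cons)
    have eq: "simple_integral_wrt W (x # ps) = (\<lambda>t \<omega>. \<xi> \<omega> * (W (min b t) \<omega> - W (min a t) \<omega>) + simple_integral_wrt W ps t \<omega>)"
      by (simp add: simple_integral_wrt_def fun_eq_iff x)
    note IH = Cons.IH[OF xi(5)]
    show ?case
    proof (intro conjI impI)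
      assume t: "t \<in> {0..T}"
      have [measurable]: "\<xi> \<in> borel_measurable M" "W (min b t) \<in> borel_measurable M" "W (min a t) \<in> borel_measurable M"
        "simple_integral_wrt W ps t \<in> borel_measurable M"
        using xi t IH by (auto intro!: W_measurable)
      show "simple_integral_wrt W (x # ps) t \<in> borel_measurable M"
        unfolding eq by measurable
    next
      assume \<omega>: "\<omega> \<in> space M"
      have "continuous_on {0..T} (\<lambda>t. W (min c t) \<omega>)" if "0 \<le> c" "c \<le> T" for c
        by (rule continuous_on_compose2[OF W_continuous[OF \<omega>]]) (use that in \<open>auto intro!: continuous_intros\<close>)
      then show "continuous_on {0..T} (\<lambda>t. simple_integral_wrt W (x # ps) t \<omega>)"
        unfolding eq using IH \<omega> xi by (intro continuous_intros) auto
    qed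
  qed
  then show "t \<in> {0..T} \<Longrightarrow> simple_integral_wrt W ps t \<in> borel_measurable M"
    "\<omega> \<in> space M \<Longrightarrow> continuous_on {0..T} (\<lambda>t. simple_integral_wrt W ps t \<omega>)" by auto
qed

text \<open>The convergence holds along every single path: the error is bounded by the oscillation
  of that path over the length \<open>T / (n + 1)\<close>, which vanishes by uniform
  continuity.\<close>

lemma step_process_error_tendsto_0:
  assumes T: "0 \<le> T" and h: "C1_pair T h h'" and \<omega>: "\<omega> \<in> space M"
  shows "(\<lambda>n. SUP t\<in>{0..T}. \<bar>parts_integral h h' (\<lambda>s. W s \<omega>) t - simple_integral_wrt W (step_process h T (Suc n)) t \<omega>\<bar>) \<longlonglongrightarrow> 0"
    (is "?S \<longlonglongrightarrow> 0")
proof (rule LIMSEQ_I)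
  fix e :: real assume e: "e > 0"
  have cont: "continuous_on {0..T} (\<lambda>t. \<bar>parts_integral h h' (\<lambda>s. W s \<omega>) t - simple_integral_wrt W (step_process h T (Suc n)) t \<omega>\<bar>)" for n
    by (intro continuous_intros parts_integral_continuous[OF h W_continuous[OF \<omega>]]
        simple_integral_wrt_path(2)[OF is_simple_step_process \<omega>] T) simp
  obtain K where K: "K > 0" "\<And>t. t \<in> {0..T} \<Longrightarrow> \<bar>h' t\<bar> \<le> K"
    using continuous_on_Icc_bound[OF C1_pair_continuous'[OF h]] by metis
  define e' where "e' = e / 2 / (K * (T + 1))"
  have e': "e' > 0" using e K T by (simp add: e'_def)
  obtain d where d: "d > 0"
    "\<And>s t. s \<in> {0..T} \<Longrightarrow> t \<in> {0..T} \<Longrightarrow> \<bar>s - t\<bar> < d \<Longrightarrow> \<bar>W s \<omega> - W t \<omega>\<bar> \<le> e'"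
    using uniformly_continuous_IccD[OF W_continuous[OF \<omega>] e'] by metis
  have "(\<lambda>n. T / real (Suc n)) \<longlonglongrightarrow> 0"
    using LIMSEQ_Suc[OF lim_const_over_n[of T]] by simp
  then have "\<forall>\<^sub>F n in sequentially. T / real (Suc n) < d"
    using d(1) by (rule order_tendstoD(2))
  then obtain n0 where n0: "\<And>n. n \<ge> n0 \<Longrightarrow> T / real (Suc n) < d"
    unfolding eventually_sequentially by blast
  have "norm (?S n - 0) < e" if n: "n \<ge> n0" for n
  proof -
    have near: "\<bar>parts_integral h h' (\<lambda>s. W s \<omega>) t - simple_integral_wrt W (step_process h T (Suc n)) t \<omega>\<bar> \<le> e / 2"
      if t: "t \<in> {0..T}" for t
    proof -
      have "\<bar>parts_integral h h' (\<lambda>s. W s \<omega>) t - simple_integral_wrt W (step_process h T (Suc n)) t \<omega>\<bar> \<le> K * e' * t"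
        by (rule simple_integral_step_process_near[where W = W, OF T _ t h W_continuous[OF \<omega>] K(2)]) (use n0[OF n] in \<open>auto intro!: d(2)\<close>)
      also have "\<dots> \<le> K * e' * (T + 1)"
        using t K e' by (intro mult_left_mono) auto
      also have "\<dots> = e / 2"
      proof -
        have "K * e' * (T + 1) = e / 2 / (K * (T + 1)) * (K * (T + 1))"
          by (simp only: e'_def ac_simps)
        also have "\<dots> = e / 2"
          by (rule nonzero_eq_divide_eq[THEN iffD1, OF _ refl]) (use T K(1) in auto)
        finally show ?thesis .
      qed
      finally show ?thesis .
    qed
    have "?S n \<le> e / 2"
      unfolding SUP_Icc_le_iff[OF T cont] using near by blast
    moreover have "0 \<le> ?S n"
      using le_SUP_Icc[OF cont[of n], of 0] T by auto
    ultimately show ?thesis using e by simp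
  qed
  then show "\<exists>n0. \<forall>n\<ge>n0. norm (?S n - 0) < e" by blast
qed

end

section \<open>Lenglart's inequality for stochastic integrals\<close>

lemma borel_measurable_nn_integral_path:
  fixes v H :: "real \<Rightarrow> 'a \<Rightarrow> real"
  assumes v: "(\<lambda>(\<omega>, t). v t \<omega>) \<in> borel_measurable (M \<Otimes>\<^sub>M lborel)"
    and H: "(\<lambda>(t, \<omega>). H t \<omega>) \<in> borel_measurable (restrict_space borel {0..T} \<Otimes>\<^sub>M M)" and T: "0 \<le> T"
  shows "(\<lambda>\<omega>. \<integral>\<^sup>+t\<in>{0..T}. ennreal ((v t \<omega> - H t \<omega>)\<^sup>2) \<partial>lborel) \<in> borel_measurable M"
proof -
  \<comment> \<open>The integrand H is measurable only for times in the interval; clamping the time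
    extends it to the line without changing the integral.\<close>
  define c where "c t = max 0 (min T t)" for t
  have c: "c \<in> measurable lborel (restrict_space borel {0..T})"
  proof (rule measurable_restrict_space2)
    have "c \<in> borel_measurable borel" unfolding c_def
      by (intro borel_measurable_continuous_onI continuous_on_max continuous_on_min continuous_on_const continuous_on_id)
    then show "c \<in> borel_measurable lborel" by simp
  qed (use T in \<open>auto simp: c_def\<close>)
  have [measurable]: "(\<lambda>z. (c (snd z), fst z)) \<in> measurable (M \<Otimes>\<^sub>M lborel) (restrict_space borel {0..T} \<Otimes>\<^sub>M M)"
    using measurable_compose[OF measurable_snd c] by measurable
  have "(\<lambda>z. (\<lambda>(t, \<omega>). H t \<omega>) (c (snd z), fst z)) \<in> borel_measurable (M \<Otimes>\<^sub>M lborel)"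
    using H by (rule measurable_compose[rotated]) measurable
  then have [measurable]: "(\<lambda>z. H (c (snd z)) (fst z)) \<in> borel_measurable (M \<Otimes>\<^sub>M lborel)"
    by simp
  have [measurable]: "(\<lambda>z. v (snd z) (fst z)) \<in> borel_measurable (M \<Otimes>\<^sub>M lborel)"
    using v by (simp add: split_beta')
  have "(\<lambda>\<omega>. \<integral>\<^sup>+t. ennreal ((v t \<omega> - H (c t) \<omega>)\<^sup>2) * indicator {0..T} t \<partial>lborel) \<in> borel_measurable M"
  proof (rule sigma_finite_measure.borel_measurable_nn_integral)
    show "sigma_finite_measure lborel" by (rule sigma_finite_lborel)
    have "(\<lambda>z. ennreal ((v (snd z) (fst z) - H (c (snd z)) (fst z))\<^sup>2) * indicator {0..T} (snd z)) \<in> borel_measurable (M \<Otimes>\<^sub>M lborel)"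
      by measurable
    then show "(\<lambda>(\<omega>, t). ennreal ((v t \<omega> - H (c t) \<omega>)\<^sup>2) * indicator {0..T} t) \<in> borel_measurable (M \<Otimes>\<^sub>M lborel)"
      by (simp add: split_beta')
  qed
  also have "(\<lambda>\<omega>. \<integral>\<^sup>+t. ennreal ((v t \<omega> - H (c t) \<omega>)\<^sup>2) * indicator {0..T} t \<partial>lborel)
      = (\<lambda>\<omega>. \<integral>\<^sup>+t\<in>{0..T}. ennreal ((v t \<omega> - H t \<omega>)\<^sup>2) \<partial>lborel)"
    by (intro ext nn_integral_cong) (auto simp: c_def indicator_def)
  finally show ?thesis .
qed

context wiener
begin

lemma simple_value_joint:
  assumes "is_simple_process M F T ps"
  shows "(\<lambda>(\<omega>, t). simple_value ps t \<omega>) \<in> borel_measurable (M \<Otimes>\<^sub>M lborel)"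
proof -
  have "(\<lambda>z. simple_value ps (snd z) (fst z)) \<in> borel_measurable (M \<Otimes>\<^sub>M lborel)"
    using assms
  proof (induction ps)
    case (Cons x ps)
    obtain a b \<xi> where x: "x = (a, b, \<xi>)" by (cases x)
    have [measurable]: "\<xi> \<in> borel_measurable M"
      using Cons.prems measurable_F by (auto simp: x is_simple_process_Cons)
    have [measurable]: "(\<lambda>z. simple_value ps (snd z) (fst z)) \<in> borel_measurable (M \<Otimes>\<^sub>M lborel)"
      using Cons by (auto simp: x is_simple_process_Cons)
    have "(\<lambda>z. \<xi> (fst z) * indicator {a<..b} (snd z) + simple_value ps (snd z) (fst z)) \<in> borel_measurable (M \<Otimes>\<^sub>M lborel)"
      by measurable
    then show ?case by (simp add: simple_value_def x)
  qed (simp add: simple_value_def)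
  then show ?thesis by (simp add: split_beta')
qed

lemma progressive_measurable:
  assumes "progressive F T H" "0 \<le> T"
  shows "(\<lambda>(t, \<omega>). H t \<omega>) \<in> borel_measurable (restrict_space borel {0..T} \<Otimes>\<^sub>M M)"
    and "t \<in> {0..T} \<Longrightarrow> H t \<in> borel_measurable M"
proof -
  have H: "(\<lambda>(t, \<omega>). H t \<omega>) \<in> borel_measurable (restrict_space borel {0..T} \<Otimes>\<^sub>M F T)"
    using assms unfolding progressive_def by auto
  have "(\<lambda>z. z) \<in> measurable (restrict_space borel {0..T} \<Otimes>\<^sub>M M) (restrict_space borel {0..T} \<Otimes>\<^sub>M F T)"
  proof -
    have "snd \<in> measurable (restrict_space borel {0..T} \<Otimes>\<^sub>M M) (F T)"
      by (rule measurable_compose[OF measurable_snd measurable_from_subalg[OF subalgebra_F[of T] measurable_ident[unfolded id_def]]])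
    then have "(\<lambda>z. (fst z, snd z)) \<in> measurable (restrict_space borel {0..T} \<Otimes>\<^sub>M M) (restrict_space borel {0..T} \<Otimes>\<^sub>M F T)"
      by (intro measurable_Pair measurable_fst)
    then show ?thesis by simp
  qed
  from measurable_compose[OF this H]
  show joint: "(\<lambda>(t, \<omega>). H t \<omega>) \<in> borel_measurable (restrict_space borel {0..T} \<Otimes>\<^sub>M M)"
    by simp
  show "H t \<in> borel_measurable M" if "t \<in> {0..T}"
  proof -
    have "Pair t \<in> measurable M (restrict_space borel {0..T} \<Otimes>\<^sub>M M)"
      using that by (intro measurable_Pair1') (simp add: space_restrict_space)
    from measurable_compose[OF this joint] show ?thesis by simp
  qed
qed

text \<open>Both conditions concern the same t: the accumulated square has to be small only up to
  the time of the deviation, which is what a first-exit argument can supply. Both inequalities are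
  strict, so that for continuous paths the set of such t is relatively open and a countable dense
  set of times detects it.\<close>

definition lenglart_event ::
    "(real \<Rightarrow> 'a \<Rightarrow> real) \<Rightarrow> (real \<Rightarrow> 'a \<Rightarrow> real) \<Rightarrow> (real \<Rightarrow> real) \<Rightarrow> (real \<Rightarrow> real) \<Rightarrow> real \<Rightarrow> real \<Rightarrow> real set \<Rightarrow> 'a set" where
  "lenglart_event H I h h' a b D = {\<omega>\<in>space M. \<exists>t\<in>D. a < \<bar>I t \<omega> - parts_integral h h' (\<lambda>s. W s \<omega>) t\<bar> \<and>
     integral {0..t} (\<lambda>s. (H s \<omega> - h s)\<^sup>2) < b}"

text \<open>Joining the simple processes \<open>ps n\<close> for H and \<open>qs n\<close> for
  \<open>- h\<close> gives a simple process whose integral approximates the deviation. Two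
  approximation errors of a / 4 leave the threshold a / 2. The three squared errors, from H to its
  approximation, from H to h, and from h to its steps, are at most b each, so the budget is 9 * b;
  and 9 * b divided by the square of a / 2 is the stated bound. The events \<open>A1\<close>,
  \<open>A2\<close>, \<open>A3\<close>, where an approximation fails, disappear as n grows.\<close>

lemma lenglart_event_finite:
  assumes T: "0 < T" and ito: "is_ito_integral M F T W H I" and Hc: "continuous_paths M T H"
    and h: "C1_pair T h h'" and ab: "0 < a" "0 < b" and D: "finite D" "D \<subseteq> {0..T}"
    and ev: "lenglart_event H I h h' a b D \<in> events"
  shows "prob (lenglart_event H I h h' a b D) \<le> 36 * b / a\<^sup>2"
proof -
  have T0: "0 \<le> T" using T by simp
  from ito obtain ps where ps: "\<And>n. is_simple_process M F T (ps n)"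
    and lim1: "\<And>e. e > 0 \<Longrightarrow> (\<lambda>n. prob {\<omega>\<in>space M. (\<integral>\<^sup>+t\<in>{0..T}. ennreal ((simple_value (ps n) t \<omega> - H t \<omega>)\<^sup>2) \<partial>lborel) > ennreal e}) \<longlonglongrightarrow> 0"
    and lim2: "\<And>e. e > 0 \<Longrightarrow> (\<lambda>n. prob {\<omega>\<in>space M. (SUP t\<in>{0..T}. \<bar>simple_integral_wrt W (ps n) t \<omega> - I t \<omega>\<bar>) > e}) \<longlonglongrightarrow> 0"
    unfolding is_ito_integral_def by blast
  have I: "continuous_on {0..T} (\<lambda>t. I t \<omega>)" if "\<omega> \<in> space M" for \<omega>
    using ito that unfolding is_ito_integral_def continuous_paths_def by blast
  have Im: "I t \<in> borel_measurable M" if "t \<in> {0..T}" for t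
    using ito that measurable_F unfolding is_ito_integral_def adapted_def by blast
  have prog: "progressive F T H" using ito unfolding is_ito_integral_def by blast
  have Hc': "continuous_on {0..T} (\<lambda>t. H t \<omega>)" if "\<omega> \<in> space M" for \<omega>
    using Hc that unfolding continuous_paths_def by blast
  define e where "e = a / 4"
  define qs :: "nat \<Rightarrow> 'a simple_process" where "qs n = step_process (\<lambda>t. - h t) T (Suc n)" for n
  have qs: "is_simple_process M F T (qs n)" for n
    unfolding qs_def using T0 by (rule is_simple_step_process) simp
  define A1 where "A1 n = {\<omega>\<in>space M. (\<integral>\<^sup>+t\<in>{0..T}. ennreal ((simple_value (ps n) t \<omega> - H t \<omega>)\<^sup>2) \<partial>lborel) > ennreal b}" for n
  define A2 where "A2 n = {\<omega>\<in>space M. (SUP t\<in>{0..T}. \<bar>simple_integral_wrt W (ps n) t \<omega> - I t \<omega>\<bar>) > e}" for n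
  define Z where "Z n \<omega> = (SUP t\<in>{0..T}. \<bar>parts_integral h h' (\<lambda>s. W s \<omega>) t - simple_integral_wrt W (step_process h T (Suc n)) t \<omega>\<bar>)" for n \<omega>
  define A3 where "A3 n = {\<omega>\<in>space M. e < Z n \<omega>}" for n
  have A1: "A1 n \<in> events" for n
  proof -
    have [measurable]: "(\<lambda>\<omega>. \<integral>\<^sup>+t\<in>{0..T}. ennreal ((simple_value (ps n) t \<omega> - H t \<omega>)\<^sup>2) \<partial>lborel) \<in> borel_measurable M"
      by (rule borel_measurable_nn_integral_path[OF simple_value_joint[OF ps] progressive_measurable(1)[OF prog T0] T0])
    show ?thesis unfolding A1_def by measurable
  qed
  have c2: "continuous_on {0..T} (\<lambda>t. \<bar>simple_integral_wrt W (ps n) t \<omega> - I t \<omega>\<bar>)" if "\<omega> \<in> space M" for n \<omega>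
    by (intro continuous_intros simple_integral_wrt_path(2)[OF ps that] I[OF that])
  have A2: "A2 n \<in> events" for n
  proof -
    have [measurable]: "(\<lambda>\<omega>. SUP t\<in>{0..T}. \<bar>simple_integral_wrt W (ps n) t \<omega> - I t \<omega>\<bar>) \<in> borel_measurable M"
      by (rule borel_measurable_SUP_path[OF _ T0 c2])
        (intro borel_measurable_abs borel_measurable_diff simple_integral_wrt_path(1)[OF ps] Im)
    show ?thesis unfolding A2_def by measurable
  qed
  have c3: "continuous_on {0..T} (\<lambda>t. \<bar>parts_integral h h' (\<lambda>s. W s \<omega>) t - simple_integral_wrt W (step_process h T (Suc n)) t \<omega>\<bar>)"
    if "\<omega> \<in> space M" for n \<omega>
    by (intro continuous_intros parts_integral_continuous[OF h W_continuous[OF that]]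
        simple_integral_wrt_path(2)[OF is_simple_step_process that] T0) simp
  have Z: "Z n \<in> borel_measurable M" for n
    unfolding Z_def
  proof (rule borel_measurable_SUP_path[OF _ T0 c3])
    fix t assume t: "t \<in> {0..T}"
    show "(\<lambda>\<omega>. \<bar>parts_integral h h' (\<lambda>s. W s \<omega>) t - simple_integral_wrt W (step_process h T (Suc n)) t \<omega>\<bar>) \<in> borel_measurable M"
      by (intro borel_measurable_abs borel_measurable_diff simple_integral_wrt_path(1)[OF is_simple_step_process]
          borel_measurable_parts_integral[OF h] W_measurable W_continuous T0 t) simp_all
  qed
  have A3: "A3 n \<in> events" for n
    unfolding A3_def using Z[of n] by measurable
  have lim3: "(\<lambda>n. prob (A3 n)) \<longlonglongrightarrow> 0"
    unfolding A3_def
    by (rule prob_gt_tendsto_0[OF Z]) (use ab step_process_error_tendsto_0[OF T0 h] in \<open>auto simp: Z_def e_def\<close>)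
  \<comment> \<open>Steps within d of h have a squared error whose integral over the whole interval
    is at most b.\<close>
  define d where "d = sqrt (b / T)"
  have d: "d > 0" "d\<^sup>2 * T = b" using ab T by (auto simp: d_def)
  obtain \<delta> where \<delta>: "\<delta> > 0"
    "\<And>s t. s \<in> {0..T} \<Longrightarrow> t \<in> {0..T} \<Longrightarrow> \<bar>s - t\<bar> < \<delta> \<Longrightarrow> \<bar>h s - h t\<bar> \<le> d"
    using uniformly_continuous_IccD[OF C1_pair_continuous[OF h] d(1)] by metis
  have "\<forall>\<^sub>F n in sequentially. T / real (Suc n) < \<delta>"
    using order_tendstoD(2)[OF LIMSEQ_Suc[OF lim_const_over_n[of T]] \<delta>(1)] by simp
  moreover have "prob (lenglart_event H I h h' a b D) \<le> prob (A1 n) + prob (A2 n) + prob (A3 n) + 36 * b / a\<^sup>2"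
    if n: "T / real (Suc n) < \<delta>" for n
  proof -
    have "is_simple_process M F T (ps n @ qs n)"
      using ps qs by (simp add: is_simple_process_append)
    from simple_integral_lenglart[OF this D, of "a / 2" "9 * b"]
    obtain B where B: "B \<in> events" "prob B \<le> 9 * b / (a / 2)\<^sup>2"
      "\<And>\<omega> t. \<omega> \<in> space M \<Longrightarrow> t \<in> D \<Longrightarrow> a / 2 < \<bar>simple_integral_wrt W (ps n @ qs n) t \<omega>\<bar> \<Longrightarrow>
         (\<integral>\<^sup>+s\<in>{0..t}. ennreal ((simple_value (ps n @ qs n) s \<omega>)\<^sup>2) \<partial>lborel) \<le> ennreal (9 * b) \<Longrightarrow> \<omega> \<in> B"
      using ab T by auto
    have sub: "lenglart_event H I h h' a b D \<subseteq> A1 n \<union> A2 n \<union> A3 n \<union> B"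
    proof
      fix \<omega> assume "\<omega> \<in> lenglart_event H I h h' a b D"
      then obtain t where \<omega>: "\<omega> \<in> space M" and tD: "t \<in> D"
        and big: "a < \<bar>I t \<omega> - parts_integral h h' (\<lambda>s. W s \<omega>) t\<bar>"
        and small: "integral {0..t} (\<lambda>s. (H s \<omega> - h s)\<^sup>2) < b"
        by (auto simp: lenglart_event_def)
      have t: "t \<in> {0..T}" using tD D by auto
      have sub_t: "{0..t} \<subseteq> {0..T}" using t by auto
      show "\<omega> \<in> A1 n \<union> A2 n \<union> A3 n \<union> B"
      proof (rule ccontr)
        assume no: "\<omega> \<notin> A1 n \<union> A2 n \<union> A3 n \<union> B"
        have n1: "(\<integral>\<^sup>+t\<in>{0..T}. ennreal ((simple_value (ps n) t \<omega> - H t \<omega>)\<^sup>2) \<partial>lborel) \<le> ennreal b"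
          using no \<omega> by (simp add: A1_def not_less)
        have n2: "\<bar>simple_integral_wrt W (ps n) t \<omega> - I t \<omega>\<bar> \<le> e"
          using no \<omega> le_SUP_Icc[OF c2[OF \<omega>] t, of n] by (simp add: A2_def not_less)
        have n3: "\<bar>parts_integral h h' (\<lambda>s. W s \<omega>) t - simple_integral_wrt W (step_process h T (Suc n)) t \<omega>\<bar> \<le> e"
          using no \<omega> le_SUP_Icc[OF c3[OF \<omega>] t, of n] by (simp add: A3_def Z_def not_less)
        have neg: "simple_integral_wrt W (qs n) t \<omega> = - simple_integral_wrt W (step_process h T (Suc n)) t \<omega>"
          unfolding qs_def simple_integral_wrt_step_process by (simp add: sum_negf[symmetric])
        have "a / 2 < \<bar>simple_integral_wrt W (ps n @ qs n) t \<omega>\<bar>"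
          unfolding simple_integral_wrt_append neg
          using big n2[unfolded e_def] n3[unfolded e_def] by linarith
        moreover have "(\<integral>\<^sup>+s\<in>{0..t}. ennreal ((simple_value (ps n @ qs n) s \<omega>)\<^sup>2) \<partial>lborel) \<le> ennreal (9 * b)"
        proof -
          \<comment> \<open>Set to 0 outside the interval, the path of H and the function h become
            Borel functions on the whole line, as \<open>nn_integral_square_sum3\<close>
            requires.\<close>
          define Hi where "Hi s = indicator {0..T} s * H s \<omega>" for s
          define hi where "hi s = indicator {0..T} s * h s" for s
          have [measurable]: "Hi \<in> borel_measurable borel" "hi \<in> borel_measurable borel"
            unfolding Hi_def hi_def
            using borel_measurable_continuous_on_indicator[OF _ Hc'[OF \<omega>]]
              borel_measurable_continuous_on_indicator[OF _ C1_pair_continuous[OF h]] by auto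
          have [measurable]: "(\<lambda>s. simple_value (ps n) s \<omega>) \<in> borel_measurable borel"
            "(\<lambda>s. simple_value (qs n) s \<omega>) \<in> borel_measurable borel"
            by (rule simple_value_borel)+
          have "(\<integral>\<^sup>+s\<in>{0..t}. ennreal ((simple_value (ps n @ qs n) s \<omega>)\<^sup>2) \<partial>lborel)
            = (\<integral>\<^sup>+s\<in>{0..t}. ennreal (((simple_value (ps n) s \<omega> - Hi s) + (Hi s - hi s) + (hi s + simple_value (qs n) s \<omega>))\<^sup>2) \<partial>lborel)"
            by (simp add: simple_value_append)
          also have "\<dots> \<le> 3 * ((\<integral>\<^sup>+s\<in>{0..t}. ennreal ((simple_value (ps n) s \<omega> - Hi s)\<^sup>2) \<partial>lborel)
              + (\<integral>\<^sup>+s\<in>{0..t}. ennreal ((Hi s - hi s)\<^sup>2) \<partial>lborel)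
              + (\<integral>\<^sup>+s\<in>{0..t}. ennreal ((hi s + simple_value (qs n) s \<omega>)\<^sup>2) \<partial>lborel))"
            by (rule nn_integral_square_sum3) measurable
          also have "\<dots> \<le> 3 * (ennreal b + ennreal b + ennreal b)"
          proof (intro mult_left_mono add_mono)
            have "(\<integral>\<^sup>+s\<in>{0..t}. ennreal ((simple_value (ps n) s \<omega> - Hi s)\<^sup>2) \<partial>lborel)
              \<le> (\<integral>\<^sup>+t\<in>{0..T}. ennreal ((simple_value (ps n) t \<omega> - H t \<omega>)\<^sup>2) \<partial>lborel)"
              using sub_t by (intro nn_integral_mono) (auto simp: indicator_def Hi_def)
            then show "(\<integral>\<^sup>+s\<in>{0..t}. ennreal ((simple_value (ps n) s \<omega> - Hi s)\<^sup>2) \<partial>lborel) \<le> ennreal b"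
              using n1 by (rule order_trans)
            have ch: "continuous_on {0..t} (\<lambda>s. (H s \<omega> - h s)\<^sup>2)"
              by (intro continuous_on_subset[OF _ sub_t] continuous_intros Hc'[OF \<omega>] C1_pair_continuous[OF h])
            have "(\<integral>\<^sup>+s\<in>{0..t}. ennreal ((Hi s - hi s)\<^sup>2) \<partial>lborel) = (\<integral>\<^sup>+s. ennreal ((H s \<omega> - h s)\<^sup>2) * indicator {0..t} s \<partial>lborel)"
              using sub_t by (intro nn_integral_cong) (auto simp: indicator_def Hi_def hi_def)
            also have "\<dots> = ennreal (integral {0..t} (\<lambda>s. (H s \<omega> - h s)\<^sup>2))"
              by (rule nn_integral_has_integral_lebesgue') (auto intro!: integrable_integral integrable_continuous_real ch)
            finally show "(\<integral>\<^sup>+s\<in>{0..t}. ennreal ((Hi s - hi s)\<^sup>2) \<partial>lborel) \<le> ennreal b"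
              using small by (simp add: ennreal_leI)
            have "(\<integral>\<^sup>+s\<in>{0..t}. ennreal ((hi s + simple_value (qs n) s \<omega>)\<^sup>2) \<partial>lborel) \<le> (\<integral>\<^sup>+s\<in>{0..T}. ennreal (d\<^sup>2) \<partial>lborel)"
            proof (rule nn_integral_mono_AE)
              \<comment> \<open>The cells are open on the left, so the step process vanishes at time
                0 and misses h there; this one point is a null set.\<close>
              have "AE s in lborel. s \<noteq> (0::real)" by (rule AE_lborel_singleton)
              then show "AE s in lborel. ennreal ((hi s + simple_value (qs n) s \<omega>)\<^sup>2) * indicator {0..t} s \<le> ennreal (d\<^sup>2) * indicator {0..T} s"
              proof (rule AE_mp, intro AE_I2 impI)
                fix s :: real assume s0: "s \<noteq> 0"
                show "ennreal ((hi s + simple_value (qs n) s \<omega>)\<^sup>2) * indicator {0..t} s \<le> ennreal (d\<^sup>2) * indicator {0..T} s"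
                proof (cases "s \<in> {0..t}")
                  case True
                  then have s: "0 < s" "s \<le> T" using s0 t by auto
                  obtain j where j: "j < Suc n" "s \<in> {T * real j / real (Suc n)<..T * real (Suc j) / real (Suc n)}"
                    "simple_value (qs n) s \<omega> = - h (T * real j / real (Suc n))"
                    unfolding qs_def using simple_value_step_process_near[OF T _ s, of "Suc n" "\<lambda>t. - h t" \<omega>] by auto
                  have "T * real (Suc j) / real (Suc n) - T * real j / real (Suc n) = T / real (Suc n)"
                    by (simp add: diff_divide_distrib[symmetric] algebra_simps)
                  then have "\<bar>s - T * real j / real (Suc n)\<bar> < \<delta>"
                    using j(2) n by auto
                  moreover have "0 \<le> T * real j / real (Suc n)" "T * real j / real (Suc n) \<le> T"
                    using T j(2) s by auto
                  ultimately have "\<bar>hi s + simple_value (qs n) s \<omega>\<bar> \<le> d"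
                    using \<delta>(2)[of s "T * real j / real (Suc n)"] j(3) s by (simp add: hi_def)
                  then have "(hi s + simple_value (qs n) s \<omega>)\<^sup>2 \<le> d\<^sup>2"
                    using abs_le_square_iff[of "hi s + simple_value (qs n) s \<omega>" d] d(1) by simp
                  then show ?thesis using True t by (auto simp: indicator_def ennreal_leI)
                qed simp
              qed
            qed
            also have "\<dots> = ennreal b"
              using T d by (simp add: nn_integral_cmult_indicator ennreal_mult'[symmetric])
            finally show "(\<integral>\<^sup>+s\<in>{0..t}. ennreal ((hi s + simple_value (qs n) s \<omega>)\<^sup>2) \<partial>lborel) \<le> ennreal b" .
          qed simp
          also have "ennreal b + ennreal b + ennreal b = ennreal (b + b + b)"
            using ab by (simp only: ennreal_plus less_imp_le add_nonneg_nonneg)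
          also have "3 * ennreal (b + b + b) = ennreal 3 * ennreal (b + b + b)"
            by simp
          also have "\<dots> = ennreal (9 * b)"
            using ab by (subst ennreal_mult'[symmetric]) auto
          finally show ?thesis .
        qed
        ultimately show False using B(3)[OF \<omega> tD] no by blast
      qed
    qed
    have "prob (lenglart_event H I h h' a b D) \<le> prob (A1 n \<union> A2 n \<union> A3 n \<union> B)"
      using A1 A2 A3 B(1) by (intro finite_measure_mono[OF sub]) auto
    also have "\<dots> \<le> prob (A1 n \<union> A2 n \<union> A3 n) + prob B"
      using A1 A2 A3 B(1) by (intro measure_Un_le) auto
    also have "prob (A1 n \<union> A2 n \<union> A3 n) \<le> prob (A1 n \<union> A2 n) + prob (A3 n)"
      using A1 A2 A3 by (intro measure_Un_le) auto
    also have "prob (A1 n \<union> A2 n) \<le> prob (A1 n) + prob (A2 n)"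
      using A1 A2 by (intro measure_Un_le) auto
    finally show ?thesis using B(2) by (simp add: power_divide)
  qed
  ultimately have "\<forall>\<^sub>F n in sequentially. prob (lenglart_event H I h h' a b D)
      \<le> prob (A1 n) + prob (A2 n) + prob (A3 n) + 36 * b / a\<^sup>2"
    by (auto elim: eventually_mono)
  moreover have "(\<lambda>n. prob (A1 n) + prob (A2 n) + prob (A3 n) + 36 * b / a\<^sup>2) \<longlonglongrightarrow> 0 + 0 + 0 + 36 * b / a\<^sup>2"
    unfolding A1_def A2_def using ab by (intro tendsto_intros lim1 lim2 lim3) (auto simp: e_def)
  ultimately show ?thesis
    using tendsto_lowerbound[of _ _ sequentially "prob (lenglart_event H I h h' a b D)"] by auto
qed

text \<open>The finite sets of clamped rationals increase to a dense set of times. The bound for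
  finite sets does not depend on their size, so continuity of the measure from below carries it to
  the interval.\<close>

lemma ito_lenglart:
  assumes T: "0 < T" and ito: "is_ito_integral M F T W H I" and Hc: "continuous_paths M T H"
    and h: "C1_pair T h h'" and ab: "0 < a" "0 < b"
  shows "lenglart_event H I h h' a b {0..T} \<in> events"
    and "prob (lenglart_event H I h h' a b {0..T}) \<le> 36 * b / a\<^sup>2"
proof -
  have T0: "0 \<le> T" using T by simp
  have I: "continuous_on {0..T} (\<lambda>t. I t \<omega>)" if "\<omega> \<in> space M" for \<omega>
    using ito that unfolding is_ito_integral_def continuous_paths_def by blast
  have Im: "I t \<in> borel_measurable M" if "t \<in> {0..T}" for t
    using ito that measurable_F unfolding is_ito_integral_def adapted_def by blast
  have prog: "progressive F T H" using ito unfolding is_ito_integral_def by blast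
  note Hm = progressive_measurable(2)[OF prog T0]
  have Hc': "continuous_on {0..T} (\<lambda>t. H t \<omega>)" if "\<omega> \<in> space M" for \<omega>
    using Hc that unfolding continuous_paths_def by blast
  have cH: "continuous_on {0..T} (\<lambda>s. (H s \<omega> - h s)\<^sup>2)" if "\<omega> \<in> space M" for \<omega>
    by (intro continuous_intros Hc' C1_pair_continuous[OF h] that)
  \<comment> \<open>The smaller of the two slacks: it is positive exactly when both strict
    inequalities hold, and it is continuous in t.\<close>
  define \<phi> where "\<phi> t \<omega> = min (\<bar>I t \<omega> - parts_integral h h' (\<lambda>s. W s \<omega>) t\<bar> - a) (b - integral {0..t} (\<lambda>s. (H s \<omega> - h s)\<^sup>2))" for t \<omega>
  have c\<phi>: "continuous_on {0..T} (\<lambda>t. \<phi> t \<omega>)" if "\<omega> \<in> space M" for \<omega>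
    unfolding \<phi>_def
    by (intro continuous_intros I[OF that] parts_integral_continuous[OF h W_continuous[OF that]]
        C1_pair_continuous[OF C1_pair_primitive[OF cH[OF that]]])
  have m\<phi>: "\<phi> t \<in> borel_measurable M" if t: "t \<in> {0..T}" for t
  proof -
    have sub: "{0..t} \<subseteq> {0..T}" using t by auto
    have [measurable]: "(\<lambda>\<omega>. integral {0..t} (\<lambda>s. (H s \<omega> - h s)\<^sup>2)) \<in> borel_measurable M"
      by (rule borel_measurable_integral_path[OF _ _ continuous_on_subset[OF cH sub]])
        (use t sub Hm in \<open>auto intro!: borel_measurable_power borel_measurable_diff\<close>)
    have [measurable]: "(\<lambda>\<omega>. parts_integral h h' (\<lambda>s. W s \<omega>) t) \<in> borel_measurable M"
      by (rule borel_measurable_parts_integral[OF h W_measurable W_continuous t])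
    have [measurable]: "I t \<in> borel_measurable M" using Im[OF t] .
    show ?thesis unfolding \<phi>_def by measurable
  qed
  have ev: "lenglart_event H I h h' a b D = {\<omega>\<in>space M. \<exists>t\<in>D. 0 < \<phi> t \<omega>}" for D
    unfolding lenglart_event_def \<phi>_def by auto
  define D where "D m = clamp_rat T ` {..m}" for m :: nat
  have D: "finite (D m)" "D m \<subseteq> {0..T}" for m
    using clamp_rat_in[OF T0] by (auto simp: D_def)
  have evD: "lenglart_event H I h h' a b (D m) \<in> events" for m
  proof -
    have "lenglart_event H I h h' a b (D m) = (\<Union>t\<in>D m. {\<omega>\<in>space M. 0 < \<phi> t \<omega>})"
      unfolding ev by auto
    also have "\<dots> \<in> events"
      using D[of m] m\<phi> by (intro sets.finite_UN) (auto simp: borel_measurable_iff_greater)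
    finally show ?thesis .
  qed
  have U: "lenglart_event H I h h' a b {0..T} = (\<Union>m. lenglart_event H I h h' a b (D m))"
  proof -
    have "(\<exists>t\<in>{0..T}. 0 < \<phi> t \<omega>) \<longleftrightarrow> (\<exists>m. \<exists>t\<in>D m. 0 < \<phi> t \<omega>)" if "\<omega> \<in> space M" for \<omega>
      unfolding ex_gt_iff_ex_clamp_rat_gt[OF T0 c\<phi>[OF that], of 0] D_def by blast
    then show ?thesis unfolding ev by blast
  qed
  show "lenglart_event H I h h' a b {0..T} \<in> events"
    unfolding U using evD by auto
  have "incseq (\<lambda>m. lenglart_event H I h h' a b (D m))"
    unfolding ev incseq_def D_def by fastforce
  then have "(\<lambda>m. prob (lenglart_event H I h h' a b (D m))) \<longlonglongrightarrow> prob (lenglart_event H I h h' a b {0..T})"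
    unfolding U using evD by (intro finite_Lim_measure_incseq) auto
  then show "prob (lenglart_event H I h h' a b {0..T}) \<le> 36 * b / a\<^sup>2"
    by (rule LIMSEQ_le_const2) (use lenglart_event_finite[OF T ito Hc h ab D evD] in blast)
qed

end

section \<open>The law of functionals of a Wiener integral\<close>

context wiener
begin

text \<open>Any events that depend on the first m increments belong to \<open>F (p m)\<close>, which
  is independent of the next increment; so the product formula follows by induction on m.\<close>

lemma grid_increments_indep:
  assumes p: "0 \<le> p 0" "\<And>i. i < n \<Longrightarrow> p i < p (Suc i)" "p n \<le> T" and n: "0 < n"
  shows "indep_vars (\<lambda>_. borel) (\<lambda>i \<omega>. W (p (Suc i)) \<omega> - W (p i) \<omega>) {..<n}"
  unfolding indep_vars_def2
proof (intro conjI ballI)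
  note p_mono = grid_mono[of n p, OF less_imp_le[OF p(2)]]
  have p_in: "p i \<in> {0..T}" if "i \<le> n" for i
    using p_mono[of 0 i] p_mono[of i n] that p by auto
  define D where "D i \<omega> = W (p (Suc i)) \<omega> - W (p i) \<omega>" for i \<omega>
  have DF: "D i \<in> borel_measurable (F (p (Suc i)))" if "i < n" for i
  proof -
    have [measurable]: "W (p (Suc i)) \<in> borel_measurable (F (p (Suc i)))" "W (p i) \<in> borel_measurable (F (p (Suc i)))"
      using p_in[of i] p_in[of "Suc i"] that p(2)[OF that]
      by (auto intro!: W_measurable_F measurable_F_mono[OF W_measurable_F])
    show ?thesis unfolding D_def by measurable
  qed
  show rv: "random_variable borel (\<lambda>\<omega>. W (p (Suc i)) \<omega> - W (p i) \<omega>)" if "i \<in> {..<n}" for i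
    using measurable_F[OF DF[of i]] that by (simp add: D_def[abs_def])
  have "indep_sets (\<lambda>i. {D i -` A \<inter> space M |A. A \<in> sets borel}) {..<n} \<longleftrightarrow>
    (\<forall>A\<in>Pi {..<n} (\<lambda>i. {D i -` A \<inter> space M |A. A \<in> sets borel}). prob (\<Inter>j\<in>{..<n}. A j) = (\<Prod>j\<in>{..<n}. prob (A j)))"
  proof (rule indep_sets_finite)
    show "{D i -` A \<inter> space M |A. A \<in> sets borel} \<subseteq> events" if "i \<in> {..<n}" for i
      using measurable_sets[OF measurable_F[OF DF]] that by auto
    show "space M \<in> {D i -` A \<inter> space M |A. A \<in> sets borel}" for i
      by (auto intro!: exI[of _ UNIV])
  qed (use n in auto)
  also have "\<dots>"
  proof
    fix A assume A: "A \<in> Pi {..<n} (\<lambda>i. {D i -` A \<inter> space M |A. A \<in> sets borel})"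
    \<comment> \<open>Intersecting with \<open>space M\<close> settles m = 0, where the empty
      intersection is \<open>UNIV\<close>.\<close>
    have "space M \<inter> (\<Inter>j\<in>{..<m}. A j) \<in> sets (F (p m)) \<and> prob (space M \<inter> (\<Inter>j\<in>{..<m}. A j)) = (\<Prod>j\<in>{..<m}. prob (A j))"
      if "m \<le> n" for m
      using that
    proof (induction m)
      case 0
      show ?case using sets.top[of "F (p 0)"] by (simp add: space_F prob_space)
    next
      case (Suc m)
      then have m: "m < n" and IH: "space M \<inter> (\<Inter>j\<in>{..<m}. A j) \<in> sets (F (p m))"
        "prob (space M \<inter> (\<Inter>j\<in>{..<m}. A j)) = (\<Prod>j\<in>{..<m}. prob (A j))" by auto
      obtain B where B: "B \<in> sets borel" "A m = D m -` B \<inter> space M" using A m by blast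
      have Am: "A m \<in> sets (vimage_algebra (space M) (\<lambda>\<omega>. W (p (Suc m)) \<omega> - W (p m) \<omega>) borel)"
        unfolding B(2) D_def by (rule in_vimage_algebra[OF B(1)])
      have AmF: "A m \<in> sets (F (p (Suc m)))"
        using measurable_sets[OF DF[OF m] B(1)] by (simp add: B(2) space_F)
      have eq: "space M \<inter> (\<Inter>j\<in>{..<Suc m}. A j) = (space M \<inter> (\<Inter>j\<in>{..<m}. A j)) \<inter> A m"
        by (auto simp: lessThan_Suc)
      have "space M \<inter> (\<Inter>j\<in>{..<m}. A j) \<in> sets (F (p (Suc m)))"
        using IH(1) filtration.sets_F_mono[OF filtration_F, of "p m" "p (Suc m)"] p(2)[OF m] by auto
      moreover have "prob ((space M \<inter> (\<Inter>j\<in>{..<m}. A j)) \<inter> A m) = prob (space M \<inter> (\<Inter>j\<in>{..<m}. A j)) * prob (A m)"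
        using p_in[of m] p_in[of "Suc m"] p(2)[OF m] m
        by (intro indep_setD[OF increment_indep_set[of "p m" "p (Suc m)"] IH(1) Am]) auto
      ultimately show ?case
        unfolding eq using AmF IH(2) by (simp add: lessThan_Suc mult.commute)
    qed
    from this[of n] have "prob (space M \<inter> (\<Inter>j\<in>{..<n}. A j)) = (\<Prod>j\<in>{..<n}. prob (A j))" by simp
    moreover have "(\<Inter>j\<in>{..<n}. A j) \<subseteq> space M"
      using A n by blast
    ultimately show "prob (\<Inter>j\<in>{..<n}. A j) = (\<Prod>j\<in>{..<n}. prob (A j))"
      by (simp add: Int_absorb1)
  qed
  finally show "indep_sets (\<lambda>i. {(\<lambda>\<omega>. W (p (Suc i)) \<omega> - W (p i) \<omega>) -` A \<inter> space M |A. A \<in> sets borel}) {..<n}"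
    unfolding D_def .
qed

lemma weighted_increments_law:
  assumes p: "0 \<le> p 0" "\<And>i. i < n \<Longrightarrow> p i < p (Suc i)" "p n \<le> T" and n: "0 < n"
    and c: "\<And>i. i < n \<Longrightarrow> (c i)\<^sup>2 * (p (Suc i) - p i) = 1"
  shows "distr M (PiM {..<n} (\<lambda>_. borel)) (\<lambda>\<omega>. \<lambda>i\<in>{..<n}. c i * (W (p (Suc i)) \<omega> - W (p i) \<omega>))
     = PiM {..<n} (\<lambda>_. density lborel std_normal_density)"
proof -
  note p_mono = grid_mono[of n p, OF less_imp_le[OF p(2)]]
  have p_in: "0 \<le> p i" "p i \<le> T" if "i \<le> n" for i
    using p_mono[of 0 i] p_mono[of i n] that p by auto
  let ?Y = "\<lambda>i \<omega>. c i * (W (p (Suc i)) \<omega> - W (p i) \<omega>)"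
  have ind: "indep_vars (\<lambda>_. borel) ?Y {..<n}"
    by (rule indep_vars_compose2[OF grid_increments_indep[OF p n]]) auto
  have rv: "random_variable borel (?Y i)" if "i \<in> {..<n}" for i
    using p_in[of i] p_in[of "Suc i"] that
    by (intro borel_measurable_times borel_measurable_const borel_measurable_diff W_measurable) auto
  have law: "distr M borel (?Y i) = density lborel std_normal_density" if i: "i < n" for i
  proof -
    have pos: "0 < p (Suc i) - p i" using p(2)[OF i] by simp
    have c0: "c i \<noteq> 0" using c[OF i] by auto
    have "distributed M lborel (\<lambda>\<omega>. 0 + c i * (W (p (Suc i)) \<omega> - W (p i) \<omega>))
        (normal_density (0 + c i * 0) (\<bar>c i\<bar> * sqrt (p (Suc i) - p i)))"
      using p_in[of i] p_in[of "Suc i"] i pos c0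
      by (intro normal_density_affine increment_normal) auto
    moreover have "\<bar>c i\<bar> * sqrt (p (Suc i) - p i) = 1"
    proof -
      have "sqrt ((c i)\<^sup>2 * (p (Suc i) - p i)) = \<bar>c i\<bar> * sqrt (p (Suc i) - p i)"
        by (simp add: real_sqrt_mult)
      then show ?thesis using c[OF i] by simp
    qed
    ultimately have "distributed M lborel (?Y i) std_normal_density" by simp
    then have "distr M lborel (?Y i) = density lborel std_normal_density"
      by (simp add: distributed_distr_eq_density)
    then show ?thesis by (simp cong: distr_cong)
  qed
  have "distr M (PiM {..<n} (\<lambda>_. borel)) (\<lambda>\<omega>. \<lambda>i\<in>{..<n}. ?Y i \<omega>) = PiM {..<n} (\<lambda>i. distr M borel (?Y i))"
    using indep_vars_iff_distr_eq_PiM'[of "{..<n}" ?Y "\<lambda>_. borel"] rv ind n by auto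
  also have "\<dots> = PiM {..<n} (\<lambda>_. density lborel std_normal_density)"
    by (rule PiM_cong) (use law in auto)
  finally show ?thesis .
qed

end

text \<open>A reference law that mentions neither a probability space nor an integrand, so that
  functionals on different spaces can be compared with it.\<close>

definition gauss_law :: "nat \<Rightarrow> ((nat \<Rightarrow> real) \<Rightarrow> real) \<Rightarrow> real measure" where
  "gauss_law n \<Phi> = distr (PiM {..<n} (\<lambda>_. density lborel std_normal_density)) borel \<Phi>"

text \<open>The weights c normalise the independent increments to variance 1, so \<Phi> n of the
  weighted increments has the reference law exactly, for every n. Pointwise convergence then gives
  convergence of characteristic functions by dominated convergence.\<close>

lemma (in wiener) gauss_law_limit:
  assumes p: "\<And>n. 0 \<le> p n 0" "\<And>n i. i < Suc n \<Longrightarrow> p n i < p n (Suc i)" "\<And>n. p n (Suc n) \<le> T"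
    and c: "\<And>n i. i < Suc n \<Longrightarrow> (c n i)\<^sup>2 * (p n (Suc i) - p n i) = 1"
    and \<Phi>: "\<And>n. \<Phi> n \<in> borel_measurable (PiM {..<Suc n} (\<lambda>_. borel))"
    and A: "A \<in> borel_measurable M"
    and lim: "\<And>\<omega>. \<omega> \<in> space M \<Longrightarrow>
      (\<lambda>n. \<Phi> n (\<lambda>i\<in>{..<Suc n}. c n i * (W (p n (Suc i)) \<omega> - W (p n i) \<omega>))) \<longlonglongrightarrow> A \<omega>"
  shows "(\<lambda>n. char (gauss_law (Suc n) (\<Phi> n)) s) \<longlonglongrightarrow> char (distr M borel A) s"
proof -
  define Y where "Y n \<omega> = (\<lambda>i\<in>{..<Suc n}. c n i * (W (p n (Suc i)) \<omega> - W (p n i) \<omega>))" for n \<omega>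
  have Y: "Y n \<in> measurable M (PiM {..<Suc n} (\<lambda>_. borel))" for n
  proof -
    note p_mono = grid_mono[of "Suc n" "p n", OF less_imp_le[OF p(2)]]
    have p_in: "p n i \<in> {0..T}" if "i \<le> Suc n" for i
      using p_mono[of 0 i] p_mono[of i "Suc n"] that p(1,3)[of n] by auto
    show ?thesis unfolding Y_def
      by (intro measurable_restrict borel_measurable_times borel_measurable_const borel_measurable_diff W_measurable p_in) auto
  qed
  have \<Phi>Y: "(\<lambda>\<omega>. \<Phi> n (Y n \<omega>)) \<in> borel_measurable M" for n
    by (rule measurable_compose[OF Y \<Phi>])
  have law: "gauss_law (Suc n) (\<Phi> n) = distr M borel (\<lambda>\<omega>. \<Phi> n (Y n \<omega>))" for n
  proof -
    have "PiM {..<Suc n} (\<lambda>_. density lborel std_normal_density) = distr M (PiM {..<Suc n} (\<lambda>_. borel)) (Y n)"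
      unfolding Y_def by (rule weighted_increments_law[symmetric]) (use p c in auto)
    then show ?thesis
      unfolding gauss_law_def using distr_distr[OF \<Phi> Y, of n] by (simp add: comp_def)
  qed
  have char: "char (distr M borel f) s = (\<integral>\<omega>. iexp (s * f \<omega>) \<partial>M)" if "f \<in> borel_measurable M" for f
    unfolding char_def by (rule integral_distr[OF that]) measurable
  have "(\<lambda>n. \<integral>\<omega>. iexp (s * \<Phi> n (Y n \<omega>)) \<partial>M) \<longlonglongrightarrow> (\<integral>\<omega>. iexp (s * A \<omega>) \<partial>M)"
  proof (rule integral_dominated_convergence[where w = "\<lambda>_. 1"])
    show "AE \<omega> in M. (\<lambda>n. iexp (s * \<Phi> n (Y n \<omega>))) \<longlonglongrightarrow> iexp (s * A \<omega>)"
      using lim unfolding Y_def by (intro AE_I2 tendsto_intros)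
  qed (use \<Phi>Y A in auto)
  then show ?thesis
    unfolding law char[OF \<Phi>Y] char[OF A] .
qed

lemma distr_eq_of_gauss_law_limit:
  assumes "prob_space M" "prob_space N" "A \<in> borel_measurable M" "B \<in> borel_measurable N"
    and "\<And>s. (\<lambda>n. char (gauss_law (Suc n) (\<Phi> n)) s) \<longlonglongrightarrow> char (distr M borel A) s"
    and "\<And>s. (\<lambda>n. char (gauss_law (Suc n) (\<Phi> n)) s) \<longlonglongrightarrow> char (distr N borel B) s"
  shows "distr M borel A = distr N borel B"
proof (rule Levy_uniqueness)
  show "real_distribution (distr M borel A)" "real_distribution (distr N borel B)"
    using prob_space.real_distribution_distr assms by auto
  show "char (distr M borel A) = char (distr N borel B)"
    using LIMSEQ_unique assms(5,6) by blast
qed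

text \<open>With \<open>n + 1\<close> independent standard normal steps \<open>u\<close>, these are the discretised functionals of a
  Wiener process sampled at the multiples of \<open>1 / (n + 1)\<close>.\<close>

definition walk_square :: "nat \<Rightarrow> (nat \<Rightarrow> real) \<Rightarrow> real" where
  "walk_square n u = (\<Sum>k<Suc n. (\<Sum>i<Suc k. u i)\<^sup>2 / real (Suc n)) / real (Suc n)"

definition walk_max :: "nat \<Rightarrow> (nat \<Rightarrow> real) \<Rightarrow> real" where
  "walk_max n u = Max ((\<lambda>k. \<bar>\<Sum>i<k. u i\<bar> / sqrt (real (Suc n))) ` {..Suc n})"

lemma walk_square_measurable: "walk_square n \<in> borel_measurable (PiM {..<Suc n} (\<lambda>_. borel))"
  unfolding walk_square_def by measurable

lemma walk_max_measurable: "walk_max n \<in> borel_measurable (PiM {..<Suc n} (\<lambda>_. borel))"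
  unfolding walk_max_def by (rule borel_measurable_Max) (simp, measurable)

lemma grid_cell:
  fixes p :: "nat \<Rightarrow> real"
  assumes "p 0 \<le> t" "t \<le> p m" "0 < m"
  obtains i where "i < m" "t \<in> {p i..p (Suc i)}"
proof -
  define P where "P k \<longleftrightarrow> t \<le> p (Suc k)" for k
  obtain m' where m': "m = Suc m'" using assms(3) by (cases m) auto
  have "P m'" using assms(2) m' by (simp add: P_def)
  define i where "i = (LEAST k. P k)"
  have i: "P i" "i \<le> m'" unfolding i_def using \<open>P m'\<close> by (rule LeastI, rule Least_le)
  have "p i \<le> t"
  proof (cases i)
    case (Suc j)
    then have "\<not> P j" using not_less_Least[of j P] by (simp add: i_def)
    then show ?thesis by (simp add: P_def Suc)
  qed (use assms in simp)
  then show thesis using i m' by (intro that[of i]) (auto simp: P_def)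
qed

text \<open>The points \<open>u n i\<close> come from the mean value theorem and make \<open>g (u n i)\<close> times the increment
  of a Wiener process over the cell exactly normal with variance \<open>\<theta> / (n + 1)\<close>.\<close>

lemma time_change_grid:
  fixes g :: "real \<Rightarrow> real"
  assumes T: "0 < T" and g: "continuous_on {0..T} g" "\<And>t. t \<in> {0..T} \<Longrightarrow> g t \<noteq> 0"
    and \<theta>: "\<theta> = integral {0..T} (\<lambda>t. (g t)\<^sup>2)"
  obtains p u where "0 < \<theta>" "\<And>n. p n 0 = 0" "\<And>n. p n (Suc n) = T" "\<And>n i. i < Suc n \<Longrightarrow> p n i < p n (Suc i)"
    "\<And>n i. i \<le> Suc n \<Longrightarrow> p n i \<in> {0..T}" "\<And>n i. i < Suc n \<Longrightarrow> u n i \<in> {p n i..p n (Suc i)}"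
    "\<And>n i. i < Suc n \<Longrightarrow> (g (u n i))\<^sup>2 * (p n (Suc i) - p n i) = \<theta> / real (Suc n)"
    "\<And>n i. i < Suc n \<Longrightarrow> integral {p n i..p n (Suc i)} (\<lambda>t. (g t)\<^sup>2) = \<theta> / real (Suc n)"
    "\<And>d. d > 0 \<Longrightarrow> \<forall>\<^sub>F n in sequentially. \<forall>i<Suc n. p n (Suc i) - p n i < d"
proof -
  have c: "continuous_on {0..T} (\<lambda>t. (g t)\<^sup>2)" by (intro continuous_intros g)
  define \<tau> where "\<tau> t = integral {0..t} (\<lambda>t. (g t)\<^sup>2)" for t
  have \<tau>: "C1_pair T \<tau> (\<lambda>t. (g t)\<^sup>2)"
    unfolding \<tau>_def by (rule C1_pair_primitive[OF c])
  have diff: "integral {s..t} (\<lambda>t. (g t)\<^sup>2) = \<tau> t - \<tau> s" if "0 \<le> s" "s \<le> t" "t \<le> T" for s t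
    by (rule C1_pair_integral[OF \<tau> that])
  obtain t0 where t0: "t0 \<in> {0..T}" "\<And>t. t \<in> {0..T} \<Longrightarrow> (g t0)\<^sup>2 \<le> (g t)\<^sup>2"
    using continuous_attains_inf[of "{0..T}" "\<lambda>t. (g t)\<^sup>2"] c T by auto
  \<comment> \<open>A positive lower bound of the squared g. It makes \<tau> strictly increasing,
    and it bounds the length of a cell by its mass divided by m, so that equal masses force the mesh
    to 0.\<close>
  define m where "m = (g t0)\<^sup>2"
  have m: "m > 0" "\<And>t. t \<in> {0..T} \<Longrightarrow> m \<le> (g t)\<^sup>2"
    using g(2)[OF t0(1)] t0 by (auto simp: m_def)
  have lower: "m * (t - s) \<le> \<tau> t - \<tau> s" if st: "0 \<le> s" "s \<le> t" "t \<le> T" for s t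
  proof -
    have sub: "{s..t} \<subseteq> {0..T}" using st by auto
    have "integral {s..t} (\<lambda>_. m) \<le> integral {s..t} (\<lambda>t. (g t)\<^sup>2)"
      by (rule Henstock_Kurzweil_Integration.integral_le)
        (use m(2) sub continuous_on_subset[OF c sub] in \<open>auto intro!: integrable_continuous_real\<close>)
    then show ?thesis using diff[OF st] st by (simp add: mult.commute)
  qed
  have strict: "\<tau> s < \<tau> t" if "0 \<le> s" "s < t" "t \<le> T" for s t
  proof -
    have "0 < m * (t - s)" using m(1) that by simp
    then show ?thesis using lower[of s t] that by linarith
  qed
  have less: "s < t" if "s \<in> {0..T}" "t \<in> {0..T}" "\<tau> s < \<tau> t" for s t
    using that strict[of t s] by (cases s t rule: linorder_cases) auto
  have inj: "s = t" if "s \<in> {0..T}" "t \<in> {0..T}" "\<tau> s = \<tau> t" for s t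
    using that strict[of t s] strict[of s t] by (cases s t rule: linorder_cases) auto
  have ends: "\<tau> 0 = 0" "\<tau> T = \<theta>" by (auto simp: \<tau>_def \<theta>)
  have \<theta>_pos: "0 < \<theta>" using strict[of 0 T] T ends by simp
  \<comment> \<open>The minimum with 1 gives every index k a node, also beyond \<open>Suc n\<close>,
    so that the choice of p is total.\<close>
  have "\<exists>t. t \<in> {0..T} \<and> \<tau> t = \<theta> * min 1 (real k / real (Suc n))" for n k
  proof -
    have "0 \<le> \<theta> * min 1 (real k / real (Suc n))" using \<theta>_pos by simp
    moreover have "\<theta> * min 1 (real k / real (Suc n)) \<le> \<theta>"
      using \<theta>_pos mult_left_mono[of "min 1 (real k / real (Suc n))" 1 \<theta>] by simp
    ultimately show ?thesis
      using IVT'[of \<tau> 0 "\<theta> * min 1 (real k / real (Suc n))" T] ends T C1_pair_continuous[OF \<tau>] by auto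
  qed
  then have "\<forall>n k. \<exists>t. t \<in> {0..T} \<and> \<tau> t = \<theta> * min 1 (real k / real (Suc n))" by blast
  then obtain p where "\<forall>n k. p n k \<in> {0..T} \<and> \<tau> (p n k) = \<theta> * min 1 (real k / real (Suc n))"
    unfolding choice_iff by blast
  then have p: "\<And>n k. p n k \<in> {0..T}" "\<And>n k. \<tau> (p n k) = \<theta> * min 1 (real k / real (Suc n))"
    by blast+
  have \<tau>p: "\<tau> (p n k) = \<theta> * real k / real (Suc n)" if "k \<le> Suc n" for n k
  proof -
    have "real k / real (Suc n) \<le> 1" using that by simp
    then show ?thesis unfolding p(2) by (simp add: min_absorb2)
  qed
  have step: "\<tau> (p n (Suc i)) - \<tau> (p n i) = \<theta> / real (Suc n)" if "i < Suc n" for n i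
    using \<tau>p[of i n] \<tau>p[of "Suc i" n] that by (simp add: diff_divide_distrib[symmetric] algebra_simps)
  have inc: "p n i < p n (Suc i)" if "i < Suc n" for n i
  proof (rule less[OF p(1) p(1)])
    have "0 < \<theta> / real (Suc n)" using \<theta>_pos by simp
    then show "\<tau> (p n i) < \<tau> (p n (Suc i))" using step[OF that] by linarith
  qed
  have "\<exists>u. i < Suc n \<longrightarrow> u \<in> {p n i..p n (Suc i)} \<and> (g u)\<^sup>2 * (p n (Suc i) - p n i) = \<theta> / real (Suc n)" for n i
  proof (cases "i < Suc n")
    case True
    have "\<exists>u\<in>{p n i<..<p n (Suc i)}. \<tau> (p n (Suc i)) - \<tau> (p n i) = (g u)\<^sup>2 * (p n (Suc i) - p n i)"
    proof (rule mvt_simple[OF inc[OF True]])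
      fix t assume "p n i \<le> t" "t \<le> p n (Suc i)"
      then have "t \<in> {0..T}" and sub: "{p n i..p n (Suc i)} \<subseteq> {0..T}"
        using p(1)[of n i] p(1)[of n "Suc i"] by auto
      then have "(\<tau> has_real_derivative (g t)\<^sup>2) (at t within {0..T})"
        using \<tau> by (simp add: C1_pair_def)
      then show "(\<tau> has_derivative (*) ((g t)\<^sup>2)) (at t within {p n i..p n (Suc i)})"
        using DERIV_subset[OF _ sub] by (simp add: has_field_derivative_def)
    qed
    then obtain u where "u \<in> {p n i<..<p n (Suc i)}" "\<tau> (p n (Suc i)) - \<tau> (p n i) = (g u)\<^sup>2 * (p n (Suc i) - p n i)"
      by blast
    then show ?thesis using step[OF True] by (intro exI[of _ u]) auto
  qed simp
  then have "\<forall>n i. \<exists>u. i < Suc n \<longrightarrow> u \<in> {p n i..p n (Suc i)} \<and> (g u)\<^sup>2 * (p n (Suc i) - p n i) = \<theta> / real (Suc n)" by blast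
  then obtain u where "\<forall>n i. i < Suc n \<longrightarrow> u n i \<in> {p n i..p n (Suc i)} \<and> (g (u n i))\<^sup>2 * (p n (Suc i) - p n i) = \<theta> / real (Suc n)"
    unfolding choice_iff by blast
  then have u: "\<And>n i. i < Suc n \<Longrightarrow> u n i \<in> {p n i..p n (Suc i)}"
    "\<And>n i. i < Suc n \<Longrightarrow> (g (u n i))\<^sup>2 * (p n (Suc i) - p n i) = \<theta> / real (Suc n)"
    by blast+
  have mesh: "\<forall>\<^sub>F n in sequentially. \<forall>i<Suc n. p n (Suc i) - p n i < d" if d: "d > 0" for d
  proof -
    have "(\<lambda>n. \<theta> / real (Suc n)) \<longlonglongrightarrow> 0"
      using LIMSEQ_Suc[OF lim_const_over_n[of \<theta>]] by simp
    then have "\<forall>\<^sub>F n in sequentially. \<theta> / real (Suc n) < m * d"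
      using m(1) d by (intro order_tendstoD(2)) auto
    then show ?thesis
    proof (rule eventually_mono, intro allI impI)
      fix n i assume n: "\<theta> / real (Suc n) < m * d" and i: "i < Suc n"
      have "m * (p n (Suc i) - p n i) < m * d"
        using lower[of "p n i" "p n (Suc i)"] step[OF i] n p(1)[of n i] p(1)[of n "Suc i"] inc[OF i] by auto
      then show "p n (Suc i) - p n i < d" using m(1) by simp
    qed
  qed
  show thesis
  proof (rule that[of p u])
    show "p n 0 = 0" for n
      by (rule inj[OF p(1)]) (use \<tau>p[of 0 n] ends(1) T in simp_all)
    show "p n (Suc n) = T" for n
      by (rule inj[OF p(1)]) (use \<tau>p[of "Suc n" n] ends(2) T in simp_all)
    show "integral {p n i..p n (Suc i)} (\<lambda>t. (g t)\<^sup>2) = \<theta> / real (Suc n)" if "i < Suc n" for n i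
      using diff[of "p n i" "p n (Suc i)"] step[OF that] p(1)[of n i] p(1)[of n "Suc i"] inc[OF that] by auto
    show "0 < \<theta>" by (rule \<theta>_pos)
    show "p n i < p n (Suc i)" if "i < Suc n" for n i by (rule inc[OF that])
    show "p n i \<in> {0..T}" for n i by (rule p(1))
    show "u n i \<in> {p n i..p n (Suc i)}" if "i < Suc n" for n i by (rule u(1)[OF that])
    show "(g (u n i))\<^sup>2 * (p n (Suc i) - p n i) = \<theta> / real (Suc n)" if "i < Suc n" for n i by (rule u(2)[OF that])
    show "\<forall>\<^sub>F n in sequentially. \<forall>i<Suc n. p n (Suc i) - p n i < d" if "d > 0" for d by (rule mesh[OF that])
  qed
qed

text \<open>The partial sums of \<open>Y n\<close> are \<open>sqrt ((n + 1) / \<theta>)\<close>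
  times Riemann-Stieltjes sums for Z. The factors n + 1 cancel against those in the walk
  functionals. In \<open>walk_square\<close> one factor 1 / \<theta> comes from this scaling and the
  other from the weight 1 / (n + 1), which is the mass of a cell divided by \<theta>.\<close>

lemma walk_tendsto:
  fixes g g' w :: "real \<Rightarrow> real" and p u :: "nat \<Rightarrow> nat \<Rightarrow> real"
  assumes T: "0 < T" and g: "C1_pair T g g'" and w: "continuous_on {0..T} w"
    and \<theta>: "0 < \<theta>" and p: "\<And>n. p n 0 = 0" "\<And>n. p n (Suc n) = T" "\<And>n i. i < Suc n \<Longrightarrow> p n i < p n (Suc i)"
    "\<And>n i. i \<le> Suc n \<Longrightarrow> p n i \<in> {0..T}" and u: "\<And>n i. i < Suc n \<Longrightarrow> u n i \<in> {p n i..p n (Suc i)}"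
    and int: "\<And>n i. i < Suc n \<Longrightarrow> integral {p n i..p n (Suc i)} (\<lambda>t. (g t)\<^sup>2) = \<theta> / real (Suc n)"
    and mesh: "\<And>d. d > 0 \<Longrightarrow> \<forall>\<^sub>F n in sequentially. \<forall>i<Suc n. p n (Suc i) - p n i < d"
  defines "Y \<equiv> \<lambda>n. \<lambda>i\<in>{..<Suc n}. (sqrt (real (Suc n) / \<theta>) * g (u n i)) * (w (p n (Suc i)) - w (p n i))"
    and "Z \<equiv> parts_integral g g' w"
  shows "(\<lambda>n. walk_square n (Y n)) \<longlonglongrightarrow> integral {0..T} (\<lambda>t. (Z t)\<^sup>2 * (g t)\<^sup>2) / \<theta>\<^sup>2"
    and "(\<lambda>n. walk_max n (Y n)) \<longlonglongrightarrow> (SUP t\<in>{0..T}. \<bar>Z t\<bar>) / sqrt \<theta>"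
proof -
  have T0: "0 \<le> T" using T by simp
  define Zn where "Zn n k = (\<Sum>i<k. g (u n i) * (w (p n (Suc i)) - w (p n i)))" for n k
  have cZ: "continuous_on {0..T} Z"
    unfolding Z_def by (rule parts_integral_continuous[OF g w])
  obtain B where B: "B > 0" "\<And>t. t \<in> {0..T} \<Longrightarrow> \<bar>Z t\<bar> \<le> B"
    using continuous_on_Icc_bound[OF cZ] by metis
  obtain K where K: "K > 0" "\<And>t. t \<in> {0..T} \<Longrightarrow> \<bar>g' t\<bar> \<le> K"
    using continuous_on_Icc_bound[OF C1_pair_continuous'[OF g]] by metis
  have near: "\<forall>\<^sub>F n in sequentially. \<forall>k\<le>Suc n. \<bar>Zn n k - Z (p n k)\<bar> \<le> e" if e: "e > 0" for e
  proof -
    have "0 < e / (K * T)" using e K T by simp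
    from uniformly_continuous_IccD[OF w this] obtain d where d: "d > 0"
      "\<And>s t. s \<in> {0..T} \<Longrightarrow> t \<in> {0..T} \<Longrightarrow> \<bar>s - t\<bar> < d \<Longrightarrow> \<bar>w s - w t\<bar> \<le> e / (K * T)" by metis
    show ?thesis
      using mesh[OF d(1)]
    proof (rule eventually_mono, intro allI impI)
      fix n k assume n: "\<forall>i<Suc n. p n (Suc i) - p n i < d" and k: "k \<le> Suc n"
      have "\<bar>parts_integral g g' w (p n k) - parts_integral g g' w (p n 0)
            - (\<Sum>i<k. g (u n i) * (w (p n (Suc i)) - w (p n i)))\<bar> \<le> K * (e / (K * T)) * (p n k - p n 0) \<and> p n 0 \<le> p n k"
      proof (rule parts_integral_sum_error[OF g w])
        show "p n k \<le> T" using p(4)[OF k] by simp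
        fix i assume i: "i < k"
        then have i': "i < Suc n" using k by simp
        show "p n i \<le> p n (Suc i)" using p(3)[OF i'] by simp
        show "u n i \<in> {p n i..p n (Suc i)}" by (rule u[OF i'])
        show "\<bar>w s - w s'\<bar> \<le> e / (K * T)" if s: "s \<in> {p n i..p n (Suc i)}" "s' \<in> {p n i..p n (Suc i)}" for s s'
          using n[rule_format, OF i'] p(4)[of i n] p(4)[of "Suc i" n] i' s by (intro d(2)) auto
      qed (use p(1) K in auto)
      also have "parts_integral g g' w (p n 0) = 0" by (simp add: p(1) parts_integral_def)
      finally have "\<bar>Z (p n k) - Zn n k\<bar> \<le> K * (e / (K * T)) * p n k"
        by (simp add: Z_def Zn_def p(1))
      also have "\<dots> \<le> K * (e / (K * T)) * T"
        using p(4)[OF k] e K T by (intro mult_left_mono) auto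
      also have "\<dots> = e" using K T by simp
      finally show "\<bar>Zn n k - Z (p n k)\<bar> \<le> e" by (simp add: abs_minus_commute)
    qed
  qed
  have sumY: "(\<Sum>i<k. Y n i) = sqrt (real (Suc n) / \<theta>) * Zn n k" if "k \<le> Suc n" for n k
    unfolding Zn_def sum_distrib_left
    by (rule sum.cong) (use that in \<open>auto simp: Y_def mult.assoc\<close>)
  \<comment> \<open>All cells have mass \<open>\<theta> / (n + 1)\<close>, so this weighted Riemann
    sum has equal weights like \<open>walk_square\<close>.\<close>
  define RS where "RS n = (\<Sum>i<Suc n. (Z (p n (Suc i)))\<^sup>2 * integral {p n i..p n (Suc i)} (\<lambda>t. (g t)\<^sup>2))" for n
  have RS: "RS \<longlonglongrightarrow> integral {0..T} (\<lambda>t. (Z t)\<^sup>2 * (g t)\<^sup>2)"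
    unfolding RS_def
    by (rule weighted_riemann_sum_tendsto)
      (use p mesh in \<open>auto intro!: continuous_intros cZ C1_pair_continuous[OF g] less_imp_le\<close>)
  have "(\<lambda>n. walk_square n (Y n) - RS n / \<theta>\<^sup>2) \<longlonglongrightarrow> 0"
  proof (rule LIMSEQ_I)
    fix r :: real assume r: "r > 0"
    define e where "e = min 1 (r * \<theta> / 2 / (1 + 2 * B))"
    have e: "0 < e" "e \<le> 1" "e * (1 + 2 * B) / \<theta> < r"
    proof -
      show "0 < e" "e \<le> 1" using r \<theta> B by (auto simp: e_def)
      have "e * (1 + 2 * B) \<le> r * \<theta> / 2 / (1 + 2 * B) * (1 + 2 * B)"
        using B by (intro mult_right_mono) (auto simp: e_def)
      also have "\<dots> = r * \<theta> / 2"
        by (rule nonzero_eq_divide_eq[THEN iffD1, OF _ refl]) (use B in auto)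
      also have "\<dots> < r * \<theta>" using r \<theta> by simp
      finally show "e * (1 + 2 * B) / \<theta> < r" using \<theta> by (simp add: divide_less_eq)
    qed
    obtain n0 where n0: "\<And>n k. n \<ge> n0 \<Longrightarrow> k \<le> Suc n \<Longrightarrow> \<bar>Zn n k - Z (p n k)\<bar> \<le> e"
      using near[OF e(1)] unfolding eventually_sequentially by blast
    have "norm (walk_square n (Y n) - RS n / \<theta>\<^sup>2 - 0) < r" if n: "n \<ge> n0" for n
    proof -
      have "walk_square n (Y n) = (\<Sum>k<Suc n. ((Zn n (Suc k))\<^sup>2 / \<theta>) / real (Suc n))"
        unfolding walk_square_def sum_divide_distrib
        by (rule sum.cong) (use \<theta> in \<open>auto simp: sumY power_mult_distrib simp del: sum.lessThan_Suc\<close>)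
      moreover have "RS n / \<theta>\<^sup>2 = (\<Sum>k<Suc n. ((Z (p n (Suc k)))\<^sup>2 / \<theta>) / real (Suc n))"
        unfolding RS_def sum_divide_distrib
      proof (rule sum.cong[OF refl])
        fix k assume "k \<in> {..<Suc n}"
        then have k: "k < Suc n" by simp
        show "(Z (p n (Suc k)))\<^sup>2 * integral {p n k..p n (Suc k)} (\<lambda>t. (g t)\<^sup>2) / \<theta>\<^sup>2 = (Z (p n (Suc k)))\<^sup>2 / \<theta> / real (Suc n)"
          unfolding int[OF k] using \<theta> by (simp add: power2_eq_square)
      qed
      ultimately have "\<bar>walk_square n (Y n) - RS n / \<theta>\<^sup>2\<bar>
         = \<bar>\<Sum>k<Suc n. ((Zn n (Suc k))\<^sup>2 - (Z (p n (Suc k)))\<^sup>2) / \<theta> / real (Suc n)\<bar>"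
        by (simp add: sum_subtractf diff_divide_distrib del: sum.lessThan_Suc)
      also have "\<dots> \<le> (\<Sum>k<Suc n. \<bar>((Zn n (Suc k))\<^sup>2 - (Z (p n (Suc k)))\<^sup>2) / \<theta> / real (Suc n)\<bar>)"
        by (rule sum_abs)
      also have "\<dots> \<le> (\<Sum>k<Suc n. e * (1 + 2 * B) / \<theta> / real (Suc n))"
      proof (rule sum_mono)
        fix k assume "k \<in> {..<Suc n}"
        then have k: "Suc k \<le> Suc n" by auto
        have "\<bar>(Zn n (Suc k))\<^sup>2 - (Z (p n (Suc k)))\<^sup>2\<bar> = \<bar>Zn n (Suc k) - Z (p n (Suc k))\<bar> * \<bar>Zn n (Suc k) + Z (p n (Suc k))\<bar>"
          by (simp add: abs_mult[symmetric] power2_eq_square algebra_simps)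
        also have "\<dots> \<le> e * (1 + 2 * B)"
          using n0[OF n k] B(2)[OF p(4)[OF k]] e by (intro mult_mono) auto
        finally show "\<bar>((Zn n (Suc k))\<^sup>2 - (Z (p n (Suc k)))\<^sup>2) / \<theta> / real (Suc n)\<bar> \<le> e * (1 + 2 * B) / \<theta> / real (Suc n)"
          using \<theta> by (simp add: abs_divide divide_right_mono)
      qed
      also have "\<dots> = e * (1 + 2 * B) / \<theta>" by simp
      finally show ?thesis using e by simp
    qed
    then show "\<exists>n0. \<forall>n\<ge>n0. norm (walk_square n (Y n) - RS n / \<theta>\<^sup>2 - 0) < r" by blast
  qed
  from tendsto_add[OF this tendsto_divide[OF RS tendsto_const[of "\<theta>\<^sup>2"]]]
  show "(\<lambda>n. walk_square n (Y n)) \<longlonglongrightarrow> integral {0..T} (\<lambda>t. (Z t)\<^sup>2 * (g t)\<^sup>2) / \<theta>\<^sup>2"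
    using \<theta> by simp
  define s where "s = (SUP t\<in>{0..T}. \<bar>Z t\<bar>)"
  have caZ: "continuous_on {0..T} (\<lambda>t. \<bar>Z t\<bar>)" by (intro continuous_intros cZ)
  obtain t0 where t0: "t0 \<in> {0..T}" "\<bar>Z t0\<bar> = s"
    using SUP_Icc_attained[OF T0 caZ] unfolding s_def by metis
  have "(\<lambda>n. walk_max n (Y n)) \<longlonglongrightarrow> s / sqrt \<theta>"
  proof (rule LIMSEQ_I)
    fix r :: real assume r: "r > 0"
    \<comment> \<open>Two errors of size e occur in the lower estimate, one for the sums and one for
      moving the maximiser to a node; after division by the root of \<theta> they amount to 2 * r /
      3.\<close>
    define e where "e = r * sqrt \<theta> / 3"
    have e: "0 < e" using r \<theta> by (simp add: e_def)
    obtain d where d: "d > 0"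
      "\<And>s t. s \<in> {0..T} \<Longrightarrow> t \<in> {0..T} \<Longrightarrow> \<bar>s - t\<bar> < d \<Longrightarrow> \<bar>Z s - Z t\<bar> \<le> e"
      using uniformly_continuous_IccD[OF cZ e] by metis
    have "\<forall>\<^sub>F n in sequentially. (\<forall>k\<le>Suc n. \<bar>Zn n k - Z (p n k)\<bar> \<le> e) \<and> (\<forall>i<Suc n. p n (Suc i) - p n i < d)"
      using near[OF e] mesh[OF d(1)] by (rule eventually_conj)
    then obtain n0 where n0: "\<And>n k. n \<ge> n0 \<Longrightarrow> k \<le> Suc n \<Longrightarrow> \<bar>Zn n k - Z (p n k)\<bar> \<le> e"
      "\<And>n i. n \<ge> n0 \<Longrightarrow> i < Suc n \<Longrightarrow> p n (Suc i) - p n i < d"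
      unfolding eventually_sequentially by blast
    have "norm (walk_max n (Y n) - s / sqrt \<theta>) < r" if n: "n \<ge> n0" for n
    proof -
      have val: "\<bar>\<Sum>i<k. Y n i\<bar> / sqrt (real (Suc n)) = \<bar>Zn n k\<bar> / sqrt \<theta>" if "k \<le> Suc n" for k
        using \<theta> by (simp add: sumY[OF that] abs_mult real_sqrt_divide)
      have eq: "walk_max n (Y n) = Max ((\<lambda>k. \<bar>Zn n k\<bar> / sqrt \<theta>) ` {..Suc n})"
        unfolding walk_max_def by (rule arg_cong[where f = Max], rule image_cong) (use val in auto)
      have upper: "walk_max n (Y n) \<le> (s + e) / sqrt \<theta>"
        unfolding eq
      proof (rule Max.boundedI)
        fix a assume "a \<in> (\<lambda>k. \<bar>Zn n k\<bar> / sqrt \<theta>) ` {..Suc n}"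
        then obtain k where k: "k \<le> Suc n" "a = \<bar>Zn n k\<bar> / sqrt \<theta>" by auto
        have "\<bar>Zn n k\<bar> \<le> s + e"
          using n0(1)[OF n k(1)] le_SUP_Icc[OF caZ p(4)[OF k(1)]] unfolding s_def by linarith
        then show "a \<le> (s + e) / sqrt \<theta>" using \<theta> by (simp add: k divide_right_mono)
      qed auto
      obtain i where i: "i < Suc n" "t0 \<in> {p n i..p n (Suc i)}"
        using grid_cell[of "p n" t0 "Suc n"] t0 p(1,2)[of n] by auto
      have "\<bar>Z (p n i) - Z t0\<bar> \<le> e"
        using n0(2)[OF n i(1)] i p(4)[of i n] t0 by (intro d(2)) auto
      then have "s - 2 * e \<le> \<bar>Zn n i\<bar>"
        using n0(1)[OF n, of i] i t0(2) by simp
      then have "(s - 2 * e) / sqrt \<theta> \<le> \<bar>Zn n i\<bar> / sqrt \<theta>"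
        using \<theta> by (simp add: divide_right_mono)
      also have "\<dots> \<le> walk_max n (Y n)"
        unfolding eq using i(1) by (intro Max_ge) auto
      finally have lower: "(s - 2 * e) / sqrt \<theta> \<le> walk_max n (Y n)" .
      have "e / sqrt \<theta> = r / 3" using \<theta> by (simp add: e_def)
      moreover have "(s + e) / sqrt \<theta> = s / sqrt \<theta> + e / sqrt \<theta>" "(s - 2 * e) / sqrt \<theta> = s / sqrt \<theta> - 2 * (e / sqrt \<theta>)"
        by (simp_all add: add_divide_distrib diff_divide_distrib)
      ultimately show ?thesis
        using upper lower r unfolding real_norm_def abs_less_iff by linarith
    qed
    then show "\<exists>n0. \<forall>n\<ge>n0. norm (walk_max n (Y n) - s / sqrt \<theta>) < r" by blast
  qed
  then show "(\<lambda>n. walk_max n (Y n)) \<longlonglongrightarrow> (SUP t\<in>{0..T}. \<bar>Z t\<bar>) / sqrt \<theta>" by (simp add: s_def)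
qed

context wiener
begin

text \<open>If Z is regarded as a Wiener process run in the clock given by the integral of the
  squared g, of total length \<theta>, then rescaling this clock to length 1 turns
  \<open>square_limit\<close> into the integral of a squared Wiener process over the unit interval,
  and \<open>max_limit\<close> into its maximal modulus.\<close>

definition square_limit :: "(real \<Rightarrow> real) \<Rightarrow> (real \<Rightarrow> real) \<Rightarrow> real \<Rightarrow> 'a \<Rightarrow> real" where
  "square_limit g g' \<theta> \<omega> = integral {0..T} (\<lambda>t. (parts_integral g g' (\<lambda>s. W s \<omega>) t)\<^sup>2 * (g t)\<^sup>2) / \<theta>\<^sup>2"

definition max_limit :: "(real \<Rightarrow> real) \<Rightarrow> (real \<Rightarrow> real) \<Rightarrow> real \<Rightarrow> 'a \<Rightarrow> real" where
  "max_limit g g' \<theta> \<omega> = (SUP t\<in>{0..T}. \<bar>parts_integral g g' (\<lambda>s. W s \<omega>) t\<bar>) / sqrt \<theta>"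

lemma limit_measurable:
  assumes T: "0 \<le> T" and g: "C1_pair T g g'"
  shows "square_limit g g' \<theta> \<in> borel_measurable M" "max_limit g g' \<theta> \<in> borel_measurable M"
proof -
  note m = borel_measurable_parts_integral[OF g W_measurable W_continuous]
  note c = parts_integral_continuous[OF g W_continuous] C1_pair_continuous[OF g]
  have "(\<lambda>\<omega>. integral {0..T} (\<lambda>t. (parts_integral g g' (\<lambda>s. W s \<omega>) t)\<^sup>2 * (g t)\<^sup>2)) \<in> borel_measurable M"
    by (rule borel_measurable_integral_path[OF _ T])
      (intro borel_measurable_times borel_measurable_power m borel_measurable_const continuous_intros c, assumption+)+
  then show "square_limit g g' \<theta> \<in> borel_measurable M" unfolding square_limit_def[abs_def] by measurable
  have "(\<lambda>\<omega>. SUP t\<in>{0..T}. \<bar>parts_integral g g' (\<lambda>s. W s \<omega>) t\<bar>) \<in> borel_measurable M"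
    by (rule borel_measurable_SUP_path[OF _ T])
      (intro borel_measurable_abs m continuous_intros c, assumption+)+
  then show "max_limit g g' \<theta> \<in> borel_measurable M" unfolding max_limit_def[abs_def] by measurable
qed

text \<open>The left-hand sides do not depend on g, T or M; that is what allows the limits for two
  different Wiener processes to be identified.\<close>

lemma gauss_law_walk_limit:
  assumes T: "0 < T" and g: "C1_pair T g g'" "\<And>t. t \<in> {0..T} \<Longrightarrow> g t \<noteq> 0"
    and \<theta>: "\<theta> = integral {0..T} (\<lambda>t. (g t)\<^sup>2)"
  shows "(\<lambda>n. char (gauss_law (Suc n) (walk_square n)) s) \<longlonglongrightarrow> char (distr M borel (square_limit g g' \<theta>)) s"
    and "(\<lambda>n. char (gauss_law (Suc n) (walk_max n)) s) \<longlonglongrightarrow> char (distr M borel (max_limit g g' \<theta>)) s"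
proof -
  from time_change_grid[OF T C1_pair_continuous[OF g(1)] g(2) \<theta>]
  obtain p u where pu: "0 < \<theta>" "\<And>n. p n 0 = 0" "\<And>n. p n (Suc n) = T" "\<And>n i. i < Suc n \<Longrightarrow> p n i < p n (Suc i)"
    "\<And>n i. i \<le> Suc n \<Longrightarrow> p n i \<in> {0..T}" "\<And>n i. i < Suc n \<Longrightarrow> u n i \<in> {p n i..p n (Suc i)}"
    "\<And>n i. i < Suc n \<Longrightarrow> (g (u n i))\<^sup>2 * (p n (Suc i) - p n i) = \<theta> / real (Suc n)"
    "\<And>n i. i < Suc n \<Longrightarrow> integral {p n i..p n (Suc i)} (\<lambda>t. (g t)\<^sup>2) = \<theta> / real (Suc n)"
    "\<And>d. d > 0 \<Longrightarrow> \<forall>\<^sub>F n in sequentially. \<forall>i<Suc n. p n (Suc i) - p n i < d"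
    by blast
  define c where "c n i = sqrt (real (Suc n) / \<theta>) * g (u n i)" for n i
  have c: "(c n i)\<^sup>2 * (p n (Suc i) - p n i) = 1" if "i < Suc n" for n i
  proof -
    have "(c n i)\<^sup>2 * (p n (Suc i) - p n i) = real (Suc n) / \<theta> * ((g (u n i))\<^sup>2 * (p n (Suc i) - p n i))"
      using pu(1) by (simp add: c_def power_mult_distrib)
    also have "\<dots> = 1" unfolding pu(7)[OF that] using pu(1) by simp
    finally show ?thesis .
  qed
  note tendsto = walk_tendsto[OF T g(1) W_continuous pu(1-6,8,9), folded c_def]
  have p0: "0 \<le> p n 0" and pT: "p n (Suc n) \<le> T" for n unfolding pu(2,3) by auto
  note lim = gauss_law_limit[of p c, OF p0 pu(4) pT c]
  show "(\<lambda>n. char (gauss_law (Suc n) (walk_square n)) s) \<longlonglongrightarrow> char (distr M borel (square_limit g g' \<theta>)) s"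
  proof (rule lim)
    show "square_limit g g' \<theta> \<in> borel_measurable M" using T by (intro limit_measurable[OF _ g(1)]) simp
    show "(\<lambda>n. walk_square n (\<lambda>i\<in>{..<Suc n}. c n i * (W (p n (Suc i)) \<omega> - W (p n i) \<omega>))) \<longlonglongrightarrow> square_limit g g' \<theta> \<omega>"
      if "\<omega> \<in> space M" for \<omega>
      unfolding square_limit_def using tendsto(1)[OF that] .
  qed (assumption | rule walk_square_measurable)+
  show "(\<lambda>n. char (gauss_law (Suc n) (walk_max n)) s) \<longlonglongrightarrow> char (distr M borel (max_limit g g' \<theta>)) s"
  proof (rule lim)
    show "max_limit g g' \<theta> \<in> borel_measurable M" using T by (intro limit_measurable[OF _ g(1)]) simp
    show "(\<lambda>n. walk_max n (\<lambda>i\<in>{..<Suc n}. c n i * (W (p n (Suc i)) \<omega> - W (p n i) \<omega>))) \<longlonglongrightarrow> max_limit g g' \<theta> \<omega>"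
      if "\<omega> \<in> space M" for \<omega>
      unfolding max_limit_def using tendsto(2)[OF that] .
  qed (assumption | rule walk_max_measurable)+
qed

end

section \<open>Absence of atoms\<close>

lemma sqrt_diff_le:
  assumes "0 \<le> x" "x \<le> y"
  shows "sqrt y - sqrt x \<le> sqrt (y - x)"
  using sqrt_add_le_add_sqrt[of x "y - x"] assms by simp

text \<open>Completing the square confines \<open>a + P / q\<close> to two symmetric intervals
  between square roots, and a difference of square roots is at most the root of the difference. The
  bound is uniform in P and R, which will be random.\<close>

lemma emeasure_quadratic_slice:
  fixes q P R u v :: real
  assumes q: "0 < q" and uv: "u \<le> v"
  shows "emeasure lborel {a. q * a\<^sup>2 + 2 * a * P + R \<in> {u..v}} \<le> ennreal (2 * sqrt ((v - u) / q))"
proof -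
  define m where "m = P / q"
  define R' where "R' = R - P\<^sup>2 / q"
  \<comment> \<open>Levels below the minimum of the parabola are cut off at 0.\<close>
  define u' where "u' = max 0 ((u - R') / q)"
  define v' where "v' = max 0 ((v - R') / q)"
  have "(u - R') / q \<le> (v - R') / q" using q uv by (intro divide_right_mono) auto
  moreover have "(v - R') / q - (u - R') / q = (v - u) / q"
    by (simp add: diff_divide_distrib)
  moreover have "0 \<le> (v - u) / q" using q uv by simp
  ultimately have uv': "0 \<le> u'" "u' \<le> v'" and len: "v' - u' \<le> (v - u) / q" using q uv unfolding u'_def v'_def by linarith+
  have sub: "{a. q * a\<^sup>2 + 2 * a * P + R \<in> {u..v}} \<subseteq> {sqrt u' - m..sqrt v' - m} \<union> {- sqrt v' - m..- sqrt u' - m}"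
  proof
    fix a assume a: "a \<in> {a. q * a\<^sup>2 + 2 * a * P + R \<in> {u..v}}"
    have "q * a\<^sup>2 + 2 * a * P + R = q * (a + m)\<^sup>2 + R'"
      using q by (simp add: m_def R'_def power2_eq_square field_simps)
    then have "(u - R') / q \<le> (a + m)\<^sup>2" "(a + m)\<^sup>2 \<le> (v - R') / q"
      using a q by (auto simp: divide_le_eq le_divide_eq mult.commute)
    then have "u' \<le> (a + m)\<^sup>2" "(a + m)\<^sup>2 \<le> v'" by (auto simp: u'_def v'_def)
    then have "sqrt u' \<le> \<bar>a + m\<bar>" "\<bar>a + m\<bar> \<le> sqrt v'"
      using real_sqrt_le_mono by fastforce+
    then show "a \<in> {sqrt u' - m..sqrt v' - m} \<union> {- sqrt v' - m..- sqrt u' - m}" by auto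
  qed
  have le: "sqrt u' \<le> sqrt v'" using uv' by simp
  have "emeasure lborel {a. q * a\<^sup>2 + 2 * a * P + R \<in> {u..v}}
      \<le> emeasure lborel ({sqrt u' - m..sqrt v' - m} \<union> {- sqrt v' - m..- sqrt u' - m})"
    by (rule emeasure_mono[OF sub]) simp
  also have "\<dots> \<le> emeasure lborel {sqrt u' - m..sqrt v' - m} + emeasure lborel {- sqrt v' - m..- sqrt u' - m}"
    by (rule emeasure_subadditive) auto
  also have "\<dots> = ennreal ((sqrt v' - sqrt u') + (sqrt v' - sqrt u'))"
    using le by (subst ennreal_plus) auto
  also have "\<dots> \<le> ennreal (2 * sqrt ((v - u) / q))"
  proof (rule ennreal_leI)
    have "sqrt v' - sqrt u' \<le> sqrt (v' - u')" by (rule sqrt_diff_le[OF uv'])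
    also have "\<dots> \<le> sqrt ((v - u) / q)" using len by simp
    finally show "(sqrt v' - sqrt u') + (sqrt v' - sqrt u') \<le> 2 * sqrt ((v - u) / q)" by simp
  qed
  finally show ?thesis .
qed

lemma emeasure_max_slice:
  fixes U V :: real
  assumes "u \<le> v"
  shows "emeasure lborel {a. max (a + U) (- a - V) \<in> {u..v}} \<le> ennreal (2 * (v - u))"
proof -
  have "emeasure lborel {a. max (a + U) (- a - V) \<in> {u..v}} \<le> emeasure lborel ({u - U..v - U} \<union> {- v - V..- u - V})"
    by (rule emeasure_mono) (auto simp: max_def split: if_splits)
  also have "\<dots> \<le> emeasure lborel {u - U..v - U} + emeasure lborel {- v - V..- u - V}"
    by (rule emeasure_subadditive) auto
  also have "\<dots> = ennreal ((v - u) + (v - u))"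
    using assms by (subst ennreal_plus) auto
  finally show ?thesis by simp
qed

text \<open>By Fubini it suffices to bound the probability for fixed y. The slice has length at most
  l, and the centred normal density with variance s is bounded by its value
  \<open>1 / sqrt (2 * pi * s)\<close> at 0.\<close>

lemma (in prob_space) anticoncentration:
  assumes rv: "random_variable borel A" "random_variable S Y"
    and eq: "distr M borel A \<Otimes>\<^sub>M distr M S Y = distr M (borel \<Otimes>\<^sub>M S) (\<lambda>\<omega>. (A \<omega>, Y \<omega>))"
    and A: "distributed M lborel A (normal_density 0 (sqrt s))" and s: "0 < s"
    and B: "B \<in> sets (borel \<Otimes>\<^sub>M S)" and slice: "\<And>y. emeasure lborel {a. (a, y) \<in> B} \<le> ennreal l" and l: "0 \<le> l"
  shows "prob {\<omega>\<in>space M. (A \<omega>, Y \<omega>) \<in> B} \<le> l / sqrt (2 * pi * s)"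
proof -
  interpret A: prob_space "distr M borel A" by (rule prob_space_distr[OF rv(1)])
  interpret Y: prob_space "distr M S Y" by (rule prob_space_distr[OF rv(2)])
  interpret P: pair_sigma_finite "distr M borel A" "distr M S Y" ..
  have bound: "emeasure (distr M borel A) ((\<lambda>x. (x, y)) -` B) \<le> ennreal (l / sqrt (2 * pi * s))" for y
  proof -
    have m: "(\<lambda>x. (x, y)) -` B \<in> sets borel"
    proof (cases "y \<in> space S")
      case True
      then show ?thesis using sets_Pair2[OF B, of y] by simp
    next
      case False
      then have "(\<lambda>x. (x, y)) -` B = {}" using sets.sets_into_space[OF B] by (auto simp: space_pair_measure)
      then show ?thesis by simp
    qed
    have "emeasure (distr M borel A) ((\<lambda>x. (x, y)) -` B) = emeasure M (A -` ((\<lambda>x. (x, y)) -` B) \<inter> space M)"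
      by (rule emeasure_distr[OF rv(1) m])
    also have "\<dots> = (\<integral>\<^sup>+x. ennreal (normal_density 0 (sqrt s) x) * indicator ((\<lambda>x. (x, y)) -` B) x \<partial>lborel)"
      using m by (intro distributed_emeasure[OF A]) simp
    also have "\<dots> \<le> (\<integral>\<^sup>+x. ennreal (1 / sqrt (2 * pi * s)) * indicator ((\<lambda>x. (x, y)) -` B) x \<partial>lborel)"
    proof (rule nn_integral_mono)
      fix x
      have "normal_density 0 (sqrt s) x \<le> 1 / sqrt (2 * pi * s)"
      proof -
        have "1 / sqrt (2 * pi * s) * exp (- (x\<^sup>2) / (2 * s)) \<le> 1 / sqrt (2 * pi * s) * 1"
          using s by (intro mult_left_mono) auto
        then show ?thesis using s by (simp add: normal_density_def)
      qed
      then show "ennreal (normal_density 0 (sqrt s) x) * indicator ((\<lambda>x. (x, y)) -` B) x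
          \<le> ennreal (1 / sqrt (2 * pi * s)) * indicator ((\<lambda>x. (x, y)) -` B) x"
        by (intro mult_right_mono ennreal_leI) auto
    qed
    also have "\<dots> = ennreal (1 / sqrt (2 * pi * s)) * emeasure lborel {a. (a, y) \<in> B}"
      using m by (simp add: nn_integral_cmult_indicator vimage_def)
    also have "\<dots> \<le> ennreal (1 / sqrt (2 * pi * s)) * ennreal l"
      by (intro mult_left_mono slice) simp
    also have "\<dots> = ennreal (l / sqrt (2 * pi * s))"
      using s l by (simp add: ennreal_mult'[symmetric])
    finally show ?thesis .
  qed
  have mB: "{\<omega>\<in>space M. (A \<omega>, Y \<omega>) \<in> B} = (\<lambda>\<omega>. (A \<omega>, Y \<omega>)) -` B \<inter> space M" by auto
  have "ennreal (prob {\<omega>\<in>space M. (A \<omega>, Y \<omega>) \<in> B}) = emeasure (distr M (borel \<Otimes>\<^sub>M S) (\<lambda>\<omega>. (A \<omega>, Y \<omega>))) B"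
    unfolding emeasure_eq_measure[symmetric] mB using rv B by (subst emeasure_distr) auto
  also have "\<dots> = emeasure (distr M borel A \<Otimes>\<^sub>M distr M S Y) B" unfolding eq ..
  also have "\<dots> = (\<integral>\<^sup>+y. emeasure (distr M borel A) ((\<lambda>x. (x, y)) -` B) \<partial>distr M S Y)"
    using B by (intro P.emeasure_pair_measure_alt2) (simp cong: sets_pair_measure_cong)
  also have "\<dots> \<le> (\<integral>\<^sup>+y. ennreal (l / sqrt (2 * pi * s)) \<partial>distr M S Y)"
    by (intro nn_integral_mono bound)
  also have "\<dots> = ennreal (l / sqrt (2 * pi * s))"
    using Y.emeasure_space_1 by simp
  finally show ?thesis
    using l s by (simp add: ennreal_le_iff)
qed

text \<open>If Q equals c, then Qn is within \<kappa> of c except on an event whose probability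
  tends to 0. A bound for a fixed neighbourhood of c, uniform in n, therefore bounds the
  atom.\<close>

lemma (in prob_space) prob_eq_le_of_limit:
  fixes Q :: "'a \<Rightarrow> real"
  assumes Q: "Q \<in> borel_measurable M" and Qn: "\<And>n. Qn n \<in> borel_measurable M"
    and lim: "\<And>\<omega>. \<omega> \<in> space M \<Longrightarrow> (\<lambda>n. Qn n \<omega>) \<longlonglongrightarrow> Q \<omega>" and k: "\<kappa> > 0"
    and bound: "\<And>n. prob {\<omega>\<in>space M. \<bar>Qn n \<omega> - c\<bar> \<le> \<kappa>} \<le> B"
  shows "prob {\<omega>\<in>space M. Q \<omega> = c} \<le> B"
proof -
  note [measurable] = Q Qn
  have "(\<lambda>n. prob {\<omega>\<in>space M. \<kappa> < \<bar>Qn n \<omega> - Q \<omega>\<bar>}) \<longlonglongrightarrow> 0"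
  proof (rule prob_gt_tendsto_0[OF _ _ k])
    show "(\<lambda>n. \<bar>Qn n \<omega> - Q \<omega>\<bar>) \<longlonglongrightarrow> 0" if "\<omega> \<in> space M" for \<omega>
      using tendsto_rabs[OF tendsto_diff[OF lim[OF that] tendsto_const[of "Q \<omega>"]]] by simp
  qed measurable
  then have "(\<lambda>n. B + prob {\<omega>\<in>space M. \<kappa> < \<bar>Qn n \<omega> - Q \<omega>\<bar>}) \<longlonglongrightarrow> B + 0"
    by (intro tendsto_intros)
  moreover have "prob {\<omega>\<in>space M. Q \<omega> = c} \<le> B + prob {\<omega>\<in>space M. \<kappa> < \<bar>Qn n \<omega> - Q \<omega>\<bar>}" for n
  proof -
    have "prob {\<omega>\<in>space M. Q \<omega> = c} \<le> prob ({\<omega>\<in>space M. \<bar>Qn n \<omega> - c\<bar> \<le> \<kappa>} \<union> {\<omega>\<in>space M. \<kappa> < \<bar>Qn n \<omega> - Q \<omega>\<bar>})"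
      by (rule finite_measure_mono) auto
    also have "\<dots> \<le> prob {\<omega>\<in>space M. \<bar>Qn n \<omega> - c\<bar> \<le> \<kappa>} + prob {\<omega>\<in>space M. \<kappa> < \<bar>Qn n \<omega> - Q \<omega>\<bar>}"
      by (rule measure_Un_le) measurable
    finally show ?thesis using bound[of n] by linarith
  qed
  ultimately show ?thesis
    using LIMSEQ_le_const[of _ "B + 0" "prob {\<omega>\<in>space M. Q \<omega> = c}"] by auto
qed

lemma max_grid_tendsto:
  fixes f :: "real \<Rightarrow> real"
  assumes T: "0 \<le> T" and f: "continuous_on {0..T} f"
  shows "(\<lambda>n. Max ((\<lambda>i. f (T * real i / real (Suc n))) ` {..Suc n})) \<longlonglongrightarrow> (SUP t\<in>{0..T}. f t)"
proof (rule LIMSEQ_I)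
  fix r :: real assume r: "r > 0"
  obtain d where d: "d > 0"
    "\<And>s t. s \<in> {0..T} \<Longrightarrow> t \<in> {0..T} \<Longrightarrow> \<bar>s - t\<bar> < d \<Longrightarrow> \<bar>f s - f t\<bar> \<le> r / 2"
    using uniformly_continuous_IccD[OF f, of "r / 2"] r by auto
  obtain n0 where n0: "\<And>n i. n \<ge> n0 \<Longrightarrow> i < Suc n \<Longrightarrow> T * real (Suc i) / real (Suc n) - T * real i / real (Suc n) < d"
    using uniform_grid_mesh[OF T d(1)] unfolding eventually_sequentially by blast
  obtain t0 where t0: "t0 \<in> {0..T}" "f t0 = (SUP t\<in>{0..T}. f t)"
    using SUP_Icc_attained[OF T f] by blast
  have "norm (Max ((\<lambda>i. f (T * real i / real (Suc n))) ` {..Suc n}) - (SUP t\<in>{0..T}. f t)) < r" if n: "n \<ge> n0" for n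
  proof -
    have upper: "Max ((\<lambda>i. f (T * real i / real (Suc n))) ` {..Suc n}) \<le> (SUP t\<in>{0..T}. f t)"
    proof (rule Max.boundedI)
      fix a assume "a \<in> (\<lambda>i. f (T * real i / real (Suc n))) ` {..Suc n}"
      then obtain i where "i \<le> Suc n" "a = f (T * real i / real (Suc n))" by auto
      then show "a \<le> (SUP t\<in>{0..T}. f t)" using le_SUP_Icc[OF f uniform_grid_in[OF T]] by simp
    qed auto
    obtain i where i: "i < Suc n" "t0 \<in> {T * real i / real (Suc n)..T * real (Suc i) / real (Suc n)}"
      by (rule grid_cell[of "\<lambda>i. T * real i / real (Suc n)" t0 "Suc n"]) (use t0 in auto)
    have "\<bar>f (T * real i / real (Suc n)) - f t0\<bar> \<le> r / 2"
      using n0[OF n i(1)] i(2) uniform_grid_in[OF T, of i n] i(1) t0 by (intro d(2)) auto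
    moreover have "f (T * real i / real (Suc n)) \<le> Max ((\<lambda>i. f (T * real i / real (Suc n))) ` {..Suc n})"
      using i(1) by (intro Max_ge) auto
    ultimately have "(SUP t\<in>{0..T}. f t) - r / 2 \<le> Max ((\<lambda>i. f (T * real i / real (Suc n))) ` {..Suc n})"
      using t0(2) by linarith
    then show ?thesis using upper r unfolding real_norm_def abs_less_iff by linarith
  qed
  then show "\<exists>n0. \<forall>n\<ge>n0. norm (Max ((\<lambda>i. f (T * real i / real (Suc n))) ` {..Suc n}) - (SUP t\<in>{0..T}. f t)) < r"
    by blast
qed

context wiener
begin

text \<open>This is \<open>simple_integral_lenglart\<close> for the constant integrand 1 on the
  interval from 0 to s: its accumulated square never exceeds s, so only the size of the integral
  remains as a condition.\<close>

lemma maximal_inequality: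
  assumes s: "0 < s" "s \<le> T" and x: "0 < x"
  shows "prob {\<omega>\<in>space M. x < (SUP t\<in>{0..s}. \<bar>W t \<omega> - W 0 \<omega>\<bar>)} \<le> s / x\<^sup>2"
proof -
  have sub: "{0..s} \<subseteq> {0..T}" using s by auto
  have c: "continuous_on {0..s} (\<lambda>t. \<bar>W t \<omega> - W 0 \<omega>\<bar>)" if "\<omega> \<in> space M" for \<omega>
    by (intro continuous_intros continuous_on_subset[OF W_continuous[OF that] sub])
  define E where "E m = (\<Union>i\<in>{..m}. {\<omega>\<in>space M. x < \<bar>W (clamp_rat s i) \<omega> - W 0 \<omega>\<bar>})" for m
  have cr: "clamp_rat s i \<in> {0..s}" for i using clamp_rat_in[of s i] s by simp
  have E: "E m \<in> events" for m
    unfolding E_def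
  proof (intro sets.finite_UN)
    fix i
    have [measurable]: "W (clamp_rat s i) \<in> borel_measurable M" "W 0 \<in> borel_measurable M"
      using cr[of i] s by (auto intro!: W_measurable)
    show "{\<omega>\<in>space M. x < \<bar>W (clamp_rat s i) \<omega> - W 0 \<omega>\<bar>} \<in> events" by measurable
  qed auto
  have le: "prob (E m) \<le> s / x\<^sup>2" for m
  proof -
    define ps :: "'a simple_process" where "ps = [(0, s, \<lambda>_. 1)]"
    have ps: "is_simple_process M F T ps"
      using s by (auto simp: ps_def is_simple_process_def image_constant_conv)
    have "clamp_rat s ` {..m} \<subseteq> {0..T}" using cr sub by blast
    from simple_integral_lenglart[OF ps _ this x, of s]
    have "\<exists>B\<in>events. {\<omega> \<in> space M. \<exists>t\<in>clamp_rat s ` {..m}. x < \<bar>simple_integral_wrt W ps t \<omega>\<bar> \<and>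
      (\<integral>\<^sup>+u\<in>{0..t}. ennreal ((simple_value ps u \<omega>)\<^sup>2) \<partial>lborel) \<le> ennreal s} \<subseteq> B \<and> prob B \<le> s / x\<^sup>2"
      using s by simp
    then obtain B where B: "B \<in> events" "prob B \<le> s / x\<^sup>2"
      "\<And>\<omega> t. \<omega> \<in> space M \<Longrightarrow> t \<in> clamp_rat s ` {..m} \<Longrightarrow> x < \<bar>simple_integral_wrt W ps t \<omega>\<bar> \<Longrightarrow>
         (\<integral>\<^sup>+u\<in>{0..t}. ennreal ((simple_value ps u \<omega>)\<^sup>2) \<partial>lborel) \<le> ennreal s \<Longrightarrow> \<omega> \<in> B"
      by blast
    have "E m \<subseteq> B"
    proof
      fix \<omega> assume "\<omega> \<in> E m"
      then obtain i where i: "i \<le> m" "\<omega> \<in> space M" "x < \<bar>W (clamp_rat s i) \<omega> - W 0 \<omega>\<bar>" by (auto simp: E_def)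
      show "\<omega> \<in> B"
      proof (rule B(3)[OF i(2), of "clamp_rat s i"])
        show "x < \<bar>simple_integral_wrt W ps (clamp_rat s i) \<omega>\<bar>"
          using i(3) cr[of i] by (simp add: ps_def simple_integral_wrt_def min_absorb2)
        have "(\<integral>\<^sup>+u\<in>{0..clamp_rat s i}. ennreal ((simple_value ps u \<omega>)\<^sup>2) \<partial>lborel) \<le> (\<integral>\<^sup>+u\<in>{0..s}. 1 \<partial>lborel)"
          using cr[of i] by (intro nn_integral_mono) (auto simp: indicator_def ps_def simple_value_def)
        also have "\<dots> = ennreal s" using s by simp
        finally show "(\<integral>\<^sup>+u\<in>{0..clamp_rat s i}. ennreal ((simple_value ps u \<omega>)\<^sup>2) \<partial>lborel) \<le> ennreal s" .
      qed (use i in auto)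
    qed
    then have "prob (E m) \<le> prob B" using B(1) by (rule finite_measure_mono)
    then show ?thesis using B(2) by (rule order_trans)
  qed
  have s0: "0 \<le> s" using s by simp
  have "x < (SUP t\<in>{0..s}. \<bar>W t \<omega> - W 0 \<omega>\<bar>) \<longleftrightarrow> (\<exists>i. x < \<bar>W (clamp_rat s i) \<omega> - W 0 \<omega>\<bar>)" if "\<omega> \<in> space M" for \<omega>
    unfolding less_SUP_Icc_iff[OF s0 c[OF that]] ex_gt_iff_ex_clamp_rat_gt[OF s0 c[OF that]] ..
  then have eq: "{\<omega>\<in>space M. x < (SUP t\<in>{0..s}. \<bar>W t \<omega> - W 0 \<omega>\<bar>)} = (\<Union>m. E m)"
    unfolding E_def by blast
  have "incseq E" unfolding incseq_def E_def by fastforce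
  then have "(\<lambda>m. prob (E m)) \<longlonglongrightarrow> prob (\<Union>m. E m)"
    using E by (intro finite_Lim_measure_incseq) auto
  then show ?thesis
    unfolding eq by (rule LIMSEQ_le_const2) (use le in blast)
qed

end

text \<open>For a fixed shift the modulus is largest at the largest or the smallest
  \<open>r i\<close>. The right-hand side shows the dependence on a: one branch of slope 1 and one
  of slope -1, whence the short slices in \<open>emeasure_max_slice\<close>.\<close>

lemma Max_abs_shift:
  fixes r :: "nat \<Rightarrow> real"
  shows "Max ((\<lambda>i. \<bar>a + r i\<bar>) ` {..m}) = max (a + Max (r ` {..m})) (- a - Min (r ` {..m}))"
proof (rule Max_eqI)
  have bounds: "Min (r ` {..m}) \<le> r i" "r i \<le> Max (r ` {..m})" if "i \<le> m" for i
    using that by auto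
  fix z assume "z \<in> (\<lambda>i. \<bar>a + r i\<bar>) ` {..m}"
  then obtain i where i: "i \<le> m" "z = \<bar>a + r i\<bar>" by auto
  show "z \<le> max (a + Max (r ` {..m})) (- a - Min (r ` {..m}))"
    unfolding i(2) using bounds[OF i(1)] by linarith
next
  have "Max (r ` {..m}) \<in> r ` {..m}" "Min (r ` {..m}) \<in> r ` {..m}" by (rule Max_in Min_in; auto)+
  then obtain i j where i: "i \<le> m" "Max (r ` {..m}) = r i" and j: "j \<le> m" "Min (r ` {..m}) = r j"
    by (metis atMost_iff imageE)
  have "r j \<le> r i" using i(1) unfolding j(2)[symmetric] by auto
  then have "max (a + r i) (- a - r j) = \<bar>a + r i\<bar> \<or> max (a + r i) (- a - r j) = \<bar>a + r j\<bar>"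
    by linarith
  then show "max (a + Max (r ` {..m})) (- a - Min (r ` {..m})) \<in> (\<lambda>i. \<bar>a + r i\<bar>) ` {..m}"
    unfolding i(2) j(2) using i(1) j(1) by auto
qed simp

section \<open>Splitting a Wiener path at a small time s\<close>

definition node :: "real \<Rightarrow> nat \<Rightarrow> nat \<Rightarrow> real" where
  "node s n i = s + (1 - s) * real i / real (Suc n)"

text \<open>Indices start at 1 because index 0 belongs to the increment over the interval from 0 to
  s, which plays the part of A in the independence statement.\<close>

definition increments_from :: "(real \<Rightarrow> real) \<Rightarrow> real \<Rightarrow> nat \<Rightarrow> nat \<Rightarrow> real" where
  "increments_from w s n = (\<lambda>i\<in>{1..<Suc (Suc n)}. w (node s n i) - w (node s n (i - 1)))"

definition partial_sum :: "nat \<Rightarrow> (nat \<Rightarrow> real) \<Rightarrow> real" where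
  "partial_sum k y = (\<Sum>i\<in>{1..<Suc k}. y i)"

lemma node_0: "node s n 0 = s" and node_Suc: "node s n (Suc n) = 1"
  by (auto simp: node_def)

lemma node_in: "s \<in> {0..1} \<Longrightarrow> i \<le> Suc n \<Longrightarrow> node s n i \<in> {s..1}"
proof -
  assume "s \<in> {0..1}" "i \<le> Suc n"
  then have "(1 - s) * real i / real (Suc n) \<in> {0..1 - s}" by (intro uniform_grid_in) auto
  then show ?thesis by (simp add: node_def)
qed

lemma partial_sum_increments_from:
  assumes "k \<le> Suc n"
  shows "partial_sum k (increments_from w s n) = w (node s n k) - w s"
proof -
  have "partial_sum k (increments_from w s n) = (\<Sum>i\<in>{1..<Suc k}. w (node s n i) - w (node s n (i - 1)))"
    unfolding partial_sum_def increments_from_def by (rule sum.cong) (use assms in auto)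
  also have "\<dots> = (\<Sum>i\<in>{0..<k}. w (node s n (Suc i)) - w (node s n i))"
    using sum.shift_bounds_Suc_ivl[of "\<lambda>i. w (node s n i) - w (node s n (i - 1))" 0 k] by simp
  also have "\<dots> = w (node s n k) - w (node s n 0)"
    by (rule sum_Suc_diff') simp
  finally show ?thesis by (simp add: node_0)
qed

lemma partial_sum_measurable:
  assumes "k \<le> Suc n"
  shows "partial_sum k \<in> borel_measurable (PiM {1..<Suc (Suc n)} (\<lambda>_. borel))"
  unfolding partial_sum_def
  by (intro borel_measurable_sum measurable_component_singleton) (use assms in auto)

text \<open>Stated with product measures because \<^const>\<open>prob_space.indep_var\<close> requires both random
  variables to have the same type.\<close>

lemma (in wiener) increment_pair_law:
  fixes n :: nat
  assumes T: "T = 1" and s: "0 < s" "s < 1"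
  defines "S \<equiv> PiM {1..<Suc (Suc n)} (\<lambda>_. borel)"
    and "A \<equiv> \<lambda>\<omega>. W s \<omega> - W 0 \<omega>" and "Y \<equiv> \<lambda>\<omega>. increments_from (\<lambda>t. W t \<omega>) s n"
  shows "random_variable borel A" "random_variable S Y"
    and "distr M borel A \<Otimes>\<^sub>M distr M S Y = distr M (borel \<Otimes>\<^sub>M S) (\<lambda>\<omega>. (A \<omega>, Y \<omega>))"
proof -
  define p where "p i = (case i of 0 \<Rightarrow> 0 | Suc j \<Rightarrow> node s n j)" for i
  have p_Suc: "p (Suc i) = node s n i" for i by (simp add: p_def)
  have inc: "node s n i < node s n (Suc i)" for i
    using s by (simp add: node_def divide_strict_right_mono)
  have "indep_vars (\<lambda>_. borel) (\<lambda>i \<omega>. W (p (Suc i)) \<omega> - W (p i) \<omega>) {..<Suc (Suc n)}"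
  proof (rule grid_increments_indep)
    show "p i < p (Suc i)" for i
      using s inc by (cases i) (auto simp: p_def node_0)
    show "p (Suc (Suc n)) \<le> T" by (simp add: p_Suc node_Suc T)
  qed (auto simp: p_def)
  moreover have "{1..<Suc (Suc n)} \<subseteq> {..<Suc (Suc n)}" by auto
  ultimately
  have "indep_var (PiM {0} (\<lambda>_. borel)) (\<lambda>\<omega>. \<lambda>i\<in>{0}. W (p (Suc i)) \<omega> - W (p i) \<omega>)
     (PiM {1..<Suc (Suc n)} (\<lambda>_. borel)) (\<lambda>\<omega>. \<lambda>i\<in>{1..<Suc (Suc n)}. W (p (Suc i)) \<omega> - W (p i) \<omega>)"
    by (intro indep_var_restrict) auto
  moreover have "(\<lambda>i\<in>{1..<Suc (Suc n)}. W (p (Suc i)) \<omega> - W (p i) \<omega>) = Y \<omega>" for \<omega>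
    unfolding Y_def increments_from_def p_Suc by (rule restrict_ext) (auto simp: p_def split: nat.split)
  moreover have "(\<lambda>i\<in>{0}. W (p (Suc i)) \<omega> - W (p i) \<omega>) = (\<lambda>i\<in>{0}. A \<omega>)" for \<omega>
    unfolding A_def by (rule restrict_ext) (auto simp: p_def node_0)
  ultimately have ind: "indep_var (PiM {0} (\<lambda>_. borel)) (\<lambda>\<omega>. \<lambda>i\<in>{0::nat}. A \<omega>) S Y"
    by (simp add: S_def)
  define S0 where "S0 = PiM {0::nat} (\<lambda>_. borel :: real measure)"
  \<comment> \<open>The variable A disguised as a function on a one-point index set, of the same
    type as Y; evaluation at 0 recovers it.\<close>
  define A0 where "A0 \<omega> = (\<lambda>i\<in>{0::nat}. A \<omega>)" for \<omega>
  have rv: "random_variable S0 A0" "random_variable S Y"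
    and eq: "distr M S0 A0 \<Otimes>\<^sub>M distr M S Y = distr M (S0 \<Otimes>\<^sub>M S) (\<lambda>\<omega>. (A0 \<omega>, Y \<omega>))"
    using ind unfolding indep_var_distribution_eq S0_def A0_def by auto
  have proj: "(\<lambda>y. y 0) \<in> borel_measurable S0"
    unfolding S0_def by (rule measurable_component_singleton) simp
  have A_eq: "(\<lambda>\<omega>. A0 \<omega> 0) = A" by (simp add: A0_def fun_eq_iff)
  show "random_variable borel A" using measurable_compose[OF rv(1) proj] by (simp add: A_eq)
  show "random_variable S Y" by (rule rv(2))
  have 1: "distr M borel A = distr (distr M S0 A0) borel (\<lambda>y. y 0)"
    using distr_distr[OF proj rv(1)] A_eq by (simp add: comp_def)
  have 2: "distr M S Y = distr (distr M S Y) S (\<lambda>y. y)"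
    using distr_distr[of "\<lambda>y. y" S S Y M] rv(2) by (simp add: comp_def)
  interpret Y: prob_space "distr M S Y" by (rule prob_space_distr[OF rv(2)])
  have "distr M borel A \<Otimes>\<^sub>M distr M S Y = distr (distr M S0 A0) borel (\<lambda>y. y 0) \<Otimes>\<^sub>M distr (distr M S Y) S (\<lambda>y. y)"
    using 1 2 by simp
  also have "\<dots> = distr (distr M S0 A0 \<Otimes>\<^sub>M distr M S Y) (borel \<Otimes>\<^sub>M S) (\<lambda>(x, y). (x 0, y))"
  proof (rule pair_measure_distr)
    show "sigma_finite_measure (distr (distr M S Y) S (\<lambda>y. y))"
      using 2 Y.sigma_finite_measure_axioms by simp
  qed (use proj in simp_all)
  also have "\<dots> = distr M (borel \<Otimes>\<^sub>M S) ((\<lambda>(x, y). (x 0, y)) \<circ> (\<lambda>\<omega>. (A0 \<omega>, Y \<omega>)))"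
    unfolding eq
  proof (rule distr_distr)
    have [measurable]: "(\<lambda>y. y 0) \<in> borel_measurable S0" by (rule proj)
    show "(\<lambda>(x, y). (x 0, y)) \<in> measurable (S0 \<Otimes>\<^sub>M S) (borel \<Otimes>\<^sub>M S)"
      unfolding split_beta' by (intro measurable_Pair measurable_compose[OF measurable_fst proj] measurable_snd)
    show "(\<lambda>\<omega>. (A0 \<omega>, Y \<omega>)) \<in> measurable M (S0 \<Otimes>\<^sub>M S)" using rv by (intro measurable_Pair)
  qed
  also have "(\<lambda>(x, y). (x 0, y)) \<circ> (\<lambda>\<omega>. (A0 \<omega>, Y \<omega>)) = (\<lambda>\<omega>. (A \<omega>, Y \<omega>))"
    by (simp add: A0_def fun_eq_iff)
  finally show "distr M borel A \<Otimes>\<^sub>M distr M S Y = distr M (borel \<Otimes>\<^sub>M S) (\<lambda>\<omega>. (A \<omega>, Y \<omega>))" .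
qed

text \<open>Only the part after s is discretised. There the value at s enters as a shift common to
  all nodes, while the part before s will merely have to be small.\<close>

lemma square_split_tendsto:
  fixes f :: "real \<Rightarrow> real"
  assumes s: "0 < s" "s < 1" and f: "continuous_on {0..1} f"
  shows "(\<lambda>n. integral {0..s} f + (\<Sum>i<Suc n. f (node s n (Suc i)) * ((1 - s) / real (Suc n)))) \<longlonglongrightarrow> integral {0..1} f"
proof -
  have "continuous_on {0..1 - s} (\<lambda>t. f (s + t))"
    by (rule continuous_on_compose2[OF f]) (use s in \<open>auto intro!: continuous_intros\<close>)
  from riemann_sum_tendsto[OF _ this]
  have "(\<lambda>n. \<Sum>i<Suc n. f (node s n (Suc i)) * ((1 - s) / real (Suc n))) \<longlonglongrightarrow> integral {0..1 - s} (\<lambda>t. f (s + t))"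
    using s by (simp add: node_def)
  also have "integral {0..1 - s} (\<lambda>t. f (s + t)) = integral {s..1} f"
    using integral_shift_Icc_real[of 0 "1 - s" f s] by (simp add: comp_def)
  finally have "(\<lambda>n. integral {0..s} f + (\<Sum>i<Suc n. f (node s n (Suc i)) * ((1 - s) / real (Suc n)))) \<longlonglongrightarrow> integral {0..s} f + integral {s..1} f"
    by (intro tendsto_intros)
  also have "integral {0..s} f + integral {s..1} f = integral {0..1} f"
    using integral_Icc_diff[OF f, of s 1] s by simp
  finally show ?thesis .
qed

lemma max_split_tendsto:
  fixes f :: "real \<Rightarrow> real"
  assumes s: "0 < s" "s < 1" and f: "continuous_on {0..1} f"
  shows "(\<lambda>n. max (SUP t\<in>{0..s}. f t) (Max ((\<lambda>i. f (node s n i)) ` {..Suc n}))) \<longlonglongrightarrow> (SUP t\<in>{0..1}. f t)"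
proof -
  have cs: "continuous_on {0..1 - s} (\<lambda>t. f (s + t))"
    by (rule continuous_on_compose2[OF f]) (use s in \<open>auto intro!: continuous_intros\<close>)
  have c0: "continuous_on {0..s} f" using s by (intro continuous_on_subset[OF f]) auto
  have le: "0 \<le> 1 - s" "0 \<le> s" "(0::real) \<le> 1" using s by auto
  have "(\<lambda>n. Max ((\<lambda>i. f (node s n i)) ` {..Suc n})) \<longlonglongrightarrow> (SUP t\<in>{0..1 - s}. f (s + t))"
    using max_grid_tendsto[OF le(1) cs] by (simp add: node_def)
  then have "(\<lambda>n. max (SUP t\<in>{0..s}. f t) (Max ((\<lambda>i. f (node s n i)) ` {..Suc n})))
      \<longlonglongrightarrow> max (SUP t\<in>{0..s}. f t) (SUP t\<in>{0..1 - s}. f (s + t))"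
    by (intro tendsto_max tendsto_const)
  also have "max (SUP t\<in>{0..s}. f t) (SUP t\<in>{0..1 - s}. f (s + t)) = (SUP t\<in>{0..1}. f t)"
  proof (rule antisym)
    have "(SUP t\<in>{0..s}. f t) \<le> (SUP t\<in>{0..1}. f t)"
      unfolding SUP_Icc_le_iff[OF le(2) c0] using s by (auto intro!: le_SUP_Icc[OF f])
    moreover have "(SUP t\<in>{0..1 - s}. f (s + t)) \<le> (SUP t\<in>{0..1}. f t)"
      unfolding SUP_Icc_le_iff[OF le(1) cs] using s by (auto intro!: le_SUP_Icc[OF f])
    ultimately show "max (SUP t\<in>{0..s}. f t) (SUP t\<in>{0..1 - s}. f (s + t)) \<le> (SUP t\<in>{0..1}. f t)" by simp
    show "(SUP t\<in>{0..1}. f t) \<le> max (SUP t\<in>{0..s}. f t) (SUP t\<in>{0..1 - s}. f (s + t))"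
      unfolding SUP_Icc_le_iff[OF le(3) f]
    proof
      fix t :: real assume t: "t \<in> {0..1}"
      show "f t \<le> max (SUP t\<in>{0..s}. f t) (SUP t\<in>{0..1 - s}. f (s + t))"
      proof (cases "t \<le> s")
        case True
        then have "f t \<le> (SUP t\<in>{0..s}. f t)" using t by (intro le_SUP_Icc[OF c0]) auto
        then show ?thesis by simp
      next
        case False
        then have "f (s + (t - s)) \<le> (SUP t\<in>{0..1 - s}. f (s + t))" using t by (intro le_SUP_Icc[OF cs]) auto
        then show ?thesis by simp
      qed
    qed
  qed
  finally show ?thesis .
qed

context wiener
begin

text \<open>The split time is \<open>s = q\<^sup>4\<close>: the part of the integral before \<open>s\<close> exceeds \<open>q\<^sup>6\<close> with probability
  at most \<open>q\<^sup>2\<close>, and the quadratic function of \<open>W\<^sub>s\<close> hits an interval of length \<open>3 q\<^sup>6\<close> with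
  probability at most \<open>2 q\<close>.\<close>

lemma prob_square_eq_le:
  assumes T: "T = 1" and q: "0 < q" "q \<le> 1 / 2"
  shows "prob {\<omega>\<in>space M. integral {0..1} (\<lambda>t. (W t \<omega> - W 0 \<omega>)\<^sup>2) = c} \<le> q\<^sup>2 + 2 * q"
proof -
  define s where "s = q ^ 4"
  have "q ^ 4 \<le> (1 / 2) ^ 4" using q by (intro power_mono) auto
  also have "(1 / 2 :: real) ^ 4 = 1 / 16" by (simp add: power_divide)
  finally have s: "0 < s" "s < 1" "s \<le> 1 / 2" using q by (simp_all add: s_def)
  define f where "f \<omega> t = (W t \<omega> - W 0 \<omega>)\<^sup>2" for \<omega> t
  have f: "continuous_on {0..1} (f \<omega>)" if "\<omega> \<in> space M" for \<omega>
    unfolding f_def using W_continuous[OF that] by (intro continuous_intros) (simp add: T)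
  have fs: "continuous_on {0..s} (f \<omega>)" if "\<omega> \<in> space M" for \<omega>
    using s by (intro continuous_on_subset[OF f[OF that]]) auto
  have fm: "(\<lambda>\<omega>. f \<omega> t) \<in> borel_measurable M" if "t \<in> {0..1}" for t
    unfolding f_def using that by (intro borel_measurable_power borel_measurable_diff W_measurable) (auto simp: T)
  define Qn where "Qn n \<omega> = integral {0..s} (f \<omega>) + (\<Sum>i<Suc n. f \<omega> (node s n (Suc i)) * ((1 - s) / real (Suc n)))" for n \<omega>
  define A where "A \<omega> = W s \<omega> - W 0 \<omega>" for \<omega>
  define Y where "Y n \<omega> = increments_from (\<lambda>t. W t \<omega>) s n" for n \<omega>
  have A: "distributed M lborel A (normal_density 0 (sqrt s))"
    using increment_normal[of 0 s] s by (simp add: A_def[abs_def] T)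
  have node: "node s n i \<in> {0..1}" if "i \<le> Suc n" for n i
    using node_in[of s i n] that s by auto
  have "prob {\<omega>\<in>space M. integral {0..1} (f \<omega>) = c} \<le> q\<^sup>2 + 2 * q"
  proof (rule prob_eq_le_of_limit)
    show "(\<lambda>\<omega>. integral {0..1} (f \<omega>)) \<in> borel_measurable M"
      using f fm by (intro borel_measurable_integral_path) auto
    have [measurable]: "(\<lambda>\<omega>. integral {0..s} (f \<omega>)) \<in> borel_measurable M"
      using fs fm s by (intro borel_measurable_integral_path) auto
    show "Qn n \<in> borel_measurable M" for n
      unfolding Qn_def
      by (intro borel_measurable_add borel_measurable_sum borel_measurable_times borel_measurable_const fm node) auto
    show "(\<lambda>n. Qn n \<omega>) \<longlonglongrightarrow> integral {0..1} (f \<omega>)" if "\<omega> \<in> space M" for \<omega>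
      unfolding Qn_def by (rule square_split_tendsto[OF s(1,2) f[OF that]])
    show "0 < q ^ 6" using q by simp
    fix n
    define S where "S = PiM {1..<Suc (Suc n)} (\<lambda>_. borel :: real measure)"
    define P where "P y = (\<Sum>i<Suc n. partial_sum (Suc i) y * ((1 - s) / real (Suc n)))" for y
    define R where "R y = (\<Sum>i<Suc n. (partial_sum (Suc i) y)\<^sup>2 * ((1 - s) / real (Suc n)))" for y
    have [measurable]: "P \<in> borel_measurable S" "R \<in> borel_measurable S"
      unfolding P_def R_def S_def
      by (intro borel_measurable_sum borel_measurable_times borel_measurable_power borel_measurable_const partial_sum_measurable; simp)+
    \<comment> \<open>The approximation is within \<open>q ^ 6\<close> of c, and the integral before
      s lies between 0 and \<open>q ^ 6\<close>; subtracting it widens the interval downwards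
      only.\<close>
    define B where "B = {z\<in>space (borel \<Otimes>\<^sub>M S). (1 - s) * (fst z)\<^sup>2 + 2 * fst z * P (snd z) + R (snd z) \<in> {c - 2 * q ^ 6..c + q ^ 6}}"
    have B: "B \<in> sets (borel \<Otimes>\<^sub>M S)" unfolding B_def by measurable
    define l where "l = 2 * sqrt ((3 * q ^ 6) / (1 - s))"
    have law: "random_variable borel A" "random_variable S (Y n)"
      "distr M borel A \<Otimes>\<^sub>M distr M S (Y n) = distr M (borel \<Otimes>\<^sub>M S) (\<lambda>\<omega>. (A \<omega>, Y n \<omega>))"
      unfolding A_def[abs_def] Y_def[abs_def] S_def by (rule increment_pair_law[OF T s(1,2)])+
    have "prob {\<omega>\<in>space M. (A \<omega>, Y n \<omega>) \<in> B} \<le> l / sqrt (2 * pi * s)"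
    proof (rule anticoncentration[OF law A s(1) B])
      show "0 \<le> l" using s q by (simp add: l_def)
      show "emeasure lborel {a. (a, y) \<in> B} \<le> ennreal l" for y
      proof (cases "y \<in> space S")
        case True
        then have "{a. (a, y) \<in> B} = {a. (1 - s) * a\<^sup>2 + 2 * a * P y + R y \<in> {c - 2 * q ^ 6..c + q ^ 6}}"
          by (auto simp: B_def space_pair_measure)
        also have "emeasure lborel \<dots> \<le> ennreal (2 * sqrt ((c + q ^ 6 - (c - 2 * q ^ 6)) / (1 - s)))"
          using s q by (intro emeasure_quadratic_slice) auto
        finally show ?thesis by (simp add: l_def)
      next
        case False
        then have "{a. (a, y) \<in> B} = {}" by (auto simp: B_def space_pair_measure)
        then show ?thesis by simp
      qed
    qed
    also have "l / sqrt (2 * pi * s) \<le> 2 * q"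
    proof -
      have "(3 * q ^ 6) / (1 - s) \<le> 6 * q ^ 6"
      proof -
        have "3 * q ^ 6 \<le> (6 * q ^ 6) * (1 - s)"
          using mult_left_mono[of "1 / 2" "1 - s" "6 * q ^ 6"] s q by simp
        then show ?thesis using s by (simp add: divide_le_eq)
      qed
      also have "\<dots> \<le> q\<^sup>2 * (2 * pi * s)"
      proof -
        have "6 * q ^ 6 \<le> (2 * pi) * q ^ 6"
          using pi_gt3 q by (intro mult_right_mono) auto
        also have "\<dots> = q\<^sup>2 * (2 * pi * s)"
          by (simp add: s_def power_add[symmetric])
        finally show ?thesis .
      qed
      finally have "sqrt ((3 * q ^ 6) / (1 - s)) \<le> sqrt (q\<^sup>2 * (2 * pi * s))" by simp
      also have "\<dots> = q * sqrt (2 * pi * s)" using q by (simp add: real_sqrt_mult)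
      finally show ?thesis using s by (simp add: l_def divide_le_eq)
    qed
    finally have 1: "prob {\<omega>\<in>space M. (A \<omega>, Y n \<omega>) \<in> B} \<le> 2 * q" .
    define E where "E = {\<omega>\<in>space M. q < (SUP t\<in>{0..s}. \<bar>W t \<omega> - W 0 \<omega>\<bar>)}"
    have 2: "prob E \<le> q\<^sup>2"
    proof -
      have "prob E \<le> s / q\<^sup>2" unfolding E_def using s q by (intro maximal_inequality) (auto simp: T)
      also have "\<dots> = q\<^sup>2" using q by (simp add: s_def divide_eq_eq power_add[symmetric])
      finally show ?thesis .
    qed
    have cW: "continuous_on {0..s} (\<lambda>t. \<bar>W t \<omega> - W 0 \<omega>\<bar>)" if "\<omega> \<in> space M" for \<omega>
      using W_continuous[OF that] s by (intro continuous_intros continuous_on_subset[OF W_continuous[OF that]]) (auto simp: T)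
    have mE: "E \<in> events"
    proof -
      have [measurable]: "(\<lambda>\<omega>. SUP t\<in>{0..s}. \<bar>W t \<omega> - W 0 \<omega>\<bar>) \<in> borel_measurable M"
        by (rule borel_measurable_SUP_path[OF _ _ cW])
          (use s in \<open>auto simp: T intro!: borel_measurable_abs borel_measurable_diff W_measurable\<close>)
      show ?thesis unfolding E_def by measurable
    qed
    have mY: "Y n \<in> measurable M S"
      by (rule law(2))
    have mAB: "{\<omega>\<in>space M. (A \<omega>, Y n \<omega>) \<in> B} \<in> events"
    proof -
      have "(\<lambda>\<omega>. (A \<omega>, Y n \<omega>)) \<in> measurable M (borel \<Otimes>\<^sub>M S)"
        using law(1,2) by (intro measurable_Pair)
      from measurable_sets[OF this B] show ?thesis by (simp add: vimage_def Int_def conj_commute)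
    qed
    have sub: "{\<omega>\<in>space M. \<bar>Qn n \<omega> - c\<bar> \<le> q ^ 6} \<subseteq> E \<union> {\<omega>\<in>space M. (A \<omega>, Y n \<omega>) \<in> B}"
    proof
      fix \<omega> assume "\<omega> \<in> {\<omega>\<in>space M. \<bar>Qn n \<omega> - c\<bar> \<le> q ^ 6}"
      then have \<omega>: "\<omega> \<in> space M" "\<bar>Qn n \<omega> - c\<bar> \<le> q ^ 6" by auto
      show "\<omega> \<in> E \<union> {\<omega>\<in>space M. (A \<omega>, Y n \<omega>) \<in> B}"
      proof (cases "\<omega> \<in> E")
        case False
        have W_le: "\<bar>W t \<omega> - W 0 \<omega>\<bar> \<le> q" if "t \<in> {0..s}" for t
          using False \<omega>(1) le_SUP_Icc[OF cW[OF \<omega>(1)] that] by (simp add: E_def)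
        have "0 \<le> integral {0..s} (f \<omega>)"
          using fs[OF \<omega>(1)] by (intro integral_nonneg integrable_continuous_real) (auto simp: f_def)
        moreover have "integral {0..s} (f \<omega>) \<le> q ^ 6"
        proof -
          have "\<bar>integral {0..s} (f \<omega>)\<bar> \<le> q\<^sup>2 * (s - 0)"
          proof (rule integral_continuous_bound[OF fs[OF \<omega>(1)]])
            fix t assume "t \<in> {0..s}"
            then have "\<bar>W t \<omega> - W 0 \<omega>\<bar>\<^sup>2 \<le> q\<^sup>2" by (intro power_mono W_le) auto
            then show "\<bar>f \<omega> t\<bar> \<le> q\<^sup>2" by (simp add: f_def)
          qed (use s in simp)
          then show ?thesis by (simp add: s_def power_add[symmetric])
        qed
        moreover have "Qn n \<omega> = integral {0..s} (f \<omega>) + ((1 - s) * (A \<omega>)\<^sup>2 + 2 * A \<omega> * P (Y n \<omega>) + R (Y n \<omega>))"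
        proof -
          have "f \<omega> (node s n (Suc i)) * ((1 - s) / real (Suc n))
             = (A \<omega>)\<^sup>2 * ((1 - s) / real (Suc n)) + 2 * A \<omega> * (partial_sum (Suc i) (Y n \<omega>) * ((1 - s) / real (Suc n)))
               + (partial_sum (Suc i) (Y n \<omega>))\<^sup>2 * ((1 - s) / real (Suc n))" if "i < Suc n" for i
          proof -
            have "W (node s n (Suc i)) \<omega> - W 0 \<omega> = A \<omega> + partial_sum (Suc i) (Y n \<omega>)"
              unfolding Y_def A_def using partial_sum_increments_from[of "Suc i" n "\<lambda>t. W t \<omega>" s] that by simp
            then have "f \<omega> (node s n (Suc i)) = (A \<omega>)\<^sup>2 + 2 * A \<omega> * partial_sum (Suc i) (Y n \<omega>) + (partial_sum (Suc i) (Y n \<omega>))\<^sup>2"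
              unfolding f_def by (simp add: power2_sum algebra_simps)
            then show ?thesis by (simp only: distrib_right mult.assoc)
          qed
          then have "(\<Sum>i<Suc n. f \<omega> (node s n (Suc i)) * ((1 - s) / real (Suc n)))
            = (\<Sum>i<Suc n. (A \<omega>)\<^sup>2 * ((1 - s) / real (Suc n)) + 2 * A \<omega> * (partial_sum (Suc i) (Y n \<omega>) * ((1 - s) / real (Suc n)))
               + (partial_sum (Suc i) (Y n \<omega>))\<^sup>2 * ((1 - s) / real (Suc n)))"
            by (intro sum.cong) auto
          also have "\<dots> = (\<Sum>i<Suc n. (A \<omega>)\<^sup>2 * ((1 - s) / real (Suc n))) + 2 * A \<omega> * P (Y n \<omega>) + R (Y n \<omega>)"
            unfolding P_def R_def by (simp only: sum.distrib sum_distrib_left)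
          also have "(\<Sum>i<Suc n. (A \<omega>)\<^sup>2 * ((1 - s) / real (Suc n))) = (1 - s) * (A \<omega>)\<^sup>2"
            by (simp del: sum.lessThan_Suc)
          finally show ?thesis by (simp only: Qn_def)
        qed
        moreover have "(A \<omega>, Y n \<omega>) \<in> space (borel \<Otimes>\<^sub>M S)"
          using measurable_space[OF mY \<omega>(1)] by (simp add: space_pair_measure)
        ultimately show ?thesis using \<omega> by (auto simp: B_def abs_le_iff)
      qed simp
    qed
    have "prob {\<omega>\<in>space M. \<bar>Qn n \<omega> - c\<bar> \<le> q ^ 6} \<le> prob (E \<union> {\<omega>\<in>space M. (A \<omega>, Y n \<omega>) \<in> B})"
      using mE mAB by (intro finite_measure_mono[OF sub]) auto
    also have "\<dots> \<le> prob E + prob {\<omega>\<in>space M. (A \<omega>, Y n \<omega>) \<in> B}"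
      using mE mAB by (rule measure_Un_le)
    finally show "prob {\<omega>\<in>space M. \<bar>Qn n \<omega> - c\<bar> \<le> q ^ 6} \<le> q\<^sup>2 + 2 * q" using 1 2 by linarith
  qed
  then show ?thesis by (simp add: f_def[abs_def])
qed

text \<open>The split time is s = q^2, which is at most b / 2. If the maximum before s is at most b
  / 4, it is below b - s, so a maximum within s of b must be attained at the nodes after s, where it
  is a V-shaped function of the value at s. The slice has length at most 4 * s, and
  \<open>4 * s / sqrt (2 * pi * s)\<close> is at most 2 * q because 2 * pi exceeds 4. The maximal
  inequality at level b / 4 contributes the other term.\<close>

lemma prob_max_eq_le:
  assumes T: "T = 1" and q: "0 < q" "q \<le> 1 / 2" and b: "0 < b" "2 * q\<^sup>2 \<le> b"
  shows "prob {\<omega>\<in>space M. (SUP t\<in>{0..1}. \<bar>W t \<omega> - W 0 \<omega>\<bar>) = b} \<le> 16 * q\<^sup>2 / b\<^sup>2 + 2 * q"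
proof -
  define s where "s = q\<^sup>2"
  have "q\<^sup>2 \<le> (1 / 2)\<^sup>2" using q by (intro power_mono) auto
  also have "(1 / 2 :: real)\<^sup>2 = 1 / 4" by (simp add: power_divide)
  finally have s: "0 < s" "s < 1" using q by (simp_all add: s_def)
  define f where "f \<omega> t = \<bar>W t \<omega> - W 0 \<omega>\<bar>" for \<omega> t
  have f: "continuous_on {0..1} (f \<omega>)" if "\<omega> \<in> space M" for \<omega>
    unfolding f_def using W_continuous[OF that] by (intro continuous_intros) (simp add: T)
  have fs: "continuous_on {0..s} (f \<omega>)" if "\<omega> \<in> space M" for \<omega>
    using s by (intro continuous_on_subset[OF f[OF that]]) auto
  have fm: "(\<lambda>\<omega>. f \<omega> t) \<in> borel_measurable M" if "t \<in> {0..1}" for t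
    unfolding f_def using that by (intro borel_measurable_abs borel_measurable_diff W_measurable) (auto simp: T)
  define Qn where "Qn n \<omega> = max (SUP t\<in>{0..s}. f \<omega> t) (Max ((\<lambda>i. f \<omega> (node s n i)) ` {..Suc n}))" for n \<omega>
  define A where "A \<omega> = W s \<omega> - W 0 \<omega>" for \<omega>
  define Y where "Y n \<omega> = increments_from (\<lambda>t. W t \<omega>) s n" for n \<omega>
  have A: "distributed M lborel A (normal_density 0 (sqrt s))"
    using increment_normal[of 0 s] s by (simp add: A_def[abs_def] T)
  have node: "node s n i \<in> {0..1}" if "i \<le> Suc n" for n i
    using node_in[of s i n] that s by auto
  have [measurable]: "(\<lambda>\<omega>. SUP t\<in>{0..s}. f \<omega> t) \<in> borel_measurable M"
    using fs fm s by (intro borel_measurable_SUP_path) auto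
  have "prob {\<omega>\<in>space M. (SUP t\<in>{0..1}. f \<omega> t) = b} \<le> 16 * q\<^sup>2 / b\<^sup>2 + 2 * q"
  proof (rule prob_eq_le_of_limit)
    show "(\<lambda>\<omega>. SUP t\<in>{0..1}. f \<omega> t) \<in> borel_measurable M"
      using f fm by (intro borel_measurable_SUP_path) auto
    show "Qn n \<in> borel_measurable M" for n
    proof -
      have "(\<lambda>\<omega>. Max ((\<lambda>i. f \<omega> (node s n i)) ` {..Suc n})) \<in> borel_measurable M"
        by (intro borel_measurable_Max fm node) auto
      then show ?thesis unfolding Qn_def[abs_def] by measurable
    qed
    show "(\<lambda>n. Qn n \<omega>) \<longlonglongrightarrow> (SUP t\<in>{0..1}. f \<omega> t)" if "\<omega> \<in> space M" for \<omega>
      unfolding Qn_def by (rule max_split_tendsto[OF s f[OF that]])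
    show "0 < s" by (rule s(1))
    fix n
    define S where "S = PiM {1..<Suc (Suc n)} (\<lambda>_. borel :: real measure)"
    define U where "U y = Max ((\<lambda>i. partial_sum i y) ` {..Suc n})" for y
    define V where "V y = Min ((\<lambda>i. partial_sum i y) ` {..Suc n})" for y
    have [measurable]: "U \<in> borel_measurable S" "V \<in> borel_measurable S"
      unfolding U_def[abs_def] V_def[abs_def] S_def
      by (intro borel_measurable_Max borel_measurable_Min partial_sum_measurable; simp)+
    define B where "B = {z\<in>space (borel \<Otimes>\<^sub>M S). max (fst z + U (snd z)) (- fst z - V (snd z)) \<in> {b - s..b + s}}"
    have B: "B \<in> sets (borel \<Otimes>\<^sub>M S)" unfolding B_def by measurable
    have law: "random_variable borel A" "random_variable S (Y n)"
      "distr M borel A \<Otimes>\<^sub>M distr M S (Y n) = distr M (borel \<Otimes>\<^sub>M S) (\<lambda>\<omega>. (A \<omega>, Y n \<omega>))"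
      unfolding A_def[abs_def] Y_def[abs_def] S_def by (rule increment_pair_law[OF T s])+
    have "prob {\<omega>\<in>space M. (A \<omega>, Y n \<omega>) \<in> B} \<le> 4 * s / sqrt (2 * pi * s)"
    proof (rule anticoncentration[OF law A s(1) B])
      show "0 \<le> 4 * s" using s by simp
      show "emeasure lborel {a. (a, y) \<in> B} \<le> ennreal (4 * s)" for y
      proof (cases "y \<in> space S")
        case True
        then have "{a. (a, y) \<in> B} = {a. max (a + U y) (- a - V y) \<in> {b - s..b + s}}"
          by (auto simp: B_def space_pair_measure)
        also have "emeasure lborel \<dots> \<le> ennreal (2 * (b + s - (b - s)))"
          using s by (intro emeasure_max_slice) auto
        finally show ?thesis by simp
      next
        case False
        then have "{a. (a, y) \<in> B} = {}" by (auto simp: B_def space_pair_measure)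
        then show ?thesis by simp
      qed
    qed
    also have "4 * s / sqrt (2 * pi * s) \<le> 2 * q"
    proof -
      have "sqrt (4 * s) \<le> sqrt (2 * pi * s)"
        using pi_gt3 s by (intro real_sqrt_le_mono mult_right_mono) auto
      moreover have "sqrt (4 * s) = 2 * q" using q by (simp add: s_def real_sqrt_mult)
      ultimately have "2 * q * (2 * q) \<le> 2 * q * sqrt (2 * pi * s)" using q by (intro mult_left_mono) auto
      then show ?thesis using s by (simp add: divide_le_eq s_def power2_eq_square)
    qed
    finally have 1: "prob {\<omega>\<in>space M. (A \<omega>, Y n \<omega>) \<in> B} \<le> 2 * q" .
    define E where "E = {\<omega>\<in>space M. b / 4 < (SUP t\<in>{0..s}. f \<omega> t)}"
    have 2: "prob E \<le> 16 * q\<^sup>2 / b\<^sup>2"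
    proof -
      have "prob E \<le> s / (b / 4)\<^sup>2" unfolding E_def f_def using s b by (intro maximal_inequality) (auto simp: T)
      then show ?thesis by (simp add: s_def power_divide mult.commute)
    qed
    have mE: "E \<in> events" unfolding E_def by measurable
    have mAB: "{\<omega>\<in>space M. (A \<omega>, Y n \<omega>) \<in> B} \<in> events"
    proof -
      have "(\<lambda>\<omega>. (A \<omega>, Y n \<omega>)) \<in> measurable M (borel \<Otimes>\<^sub>M S)"
        using law(1,2) by (intro measurable_Pair)
      from measurable_sets[OF this B] show ?thesis by (simp add: vimage_def Int_def conj_commute)
    qed
    have sub: "{\<omega>\<in>space M. \<bar>Qn n \<omega> - b\<bar> \<le> s} \<subseteq> E \<union> {\<omega>\<in>space M. (A \<omega>, Y n \<omega>) \<in> B}"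
    proof
      fix \<omega> assume "\<omega> \<in> {\<omega>\<in>space M. \<bar>Qn n \<omega> - b\<bar> \<le> s}"
      then have \<omega>: "\<omega> \<in> space M" "\<bar>Qn n \<omega> - b\<bar> \<le> s" by auto
      show "\<omega> \<in> E \<union> {\<omega>\<in>space M. (A \<omega>, Y n \<omega>) \<in> B}"
      proof (cases "\<omega> \<in> E")
        case False
        then have "(SUP t\<in>{0..s}. f \<omega> t) \<le> b / 4" using \<omega>(1) by (simp add: E_def)
        moreover have "s \<le> b / 2" using b by (simp add: s_def)
        ultimately have "(SUP t\<in>{0..s}. f \<omega> t) < b - s" using b by linarith
        moreover have "Max ((\<lambda>i. f \<omega> (node s n i)) ` {..Suc n}) = max (A \<omega> + U (Y n \<omega>)) (- A \<omega> - V (Y n \<omega>))"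
        proof -
          have "f \<omega> (node s n i) = \<bar>A \<omega> + partial_sum i (Y n \<omega>)\<bar>" if "i \<le> Suc n" for i
            unfolding f_def Y_def A_def using partial_sum_increments_from[of i n "\<lambda>t. W t \<omega>" s] that by simp
          then have "(\<lambda>i. f \<omega> (node s n i)) ` {..Suc n} = (\<lambda>i. \<bar>A \<omega> + partial_sum i (Y n \<omega>)\<bar>) ` {..Suc n}"
            by (intro image_cong) auto
          then show ?thesis unfolding U_def V_def by (simp only: Max_abs_shift)
        qed
        ultimately have "max (A \<omega> + U (Y n \<omega>)) (- A \<omega> - V (Y n \<omega>)) \<in> {b - s..b + s}"
          using \<omega>(2) unfolding Qn_def abs_le_iff atLeastAtMost_iff by linarith
        moreover have "(A \<omega>, Y n \<omega>) \<in> space (borel \<Otimes>\<^sub>M S)"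
          using measurable_space[OF law(2) \<omega>(1)] by (simp add: space_pair_measure)
        ultimately show ?thesis using \<omega>(1) by (simp add: B_def)
      qed simp
    qed
    have "prob {\<omega>\<in>space M. \<bar>Qn n \<omega> - b\<bar> \<le> s} \<le> prob (E \<union> {\<omega>\<in>space M. (A \<omega>, Y n \<omega>) \<in> B})"
      using mE mAB by (intro finite_measure_mono[OF sub]) auto
    also have "\<dots> \<le> prob E + prob {\<omega>\<in>space M. (A \<omega>, Y n \<omega>) \<in> B}"
      using mE mAB by (rule measure_Un_le)
    finally show "prob {\<omega>\<in>space M. \<bar>Qn n \<omega> - b\<bar> \<le> s} \<le> 16 * q\<^sup>2 / b\<^sup>2 + 2 * q" using 1 2 by linarith
  qed
  then show ?thesis by (simp add: f_def[abs_def])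
qed

lemma prob_square_eq_0:
  assumes "T = 1"
  shows "prob {\<omega>\<in>space M. integral {0..1} (\<lambda>t. (W t \<omega> - W 0 \<omega>)\<^sup>2) = c} = 0"
proof -
  let ?p = "prob {\<omega>\<in>space M. integral {0..1} (\<lambda>t. (W t \<omega> - W 0 \<omega>)\<^sup>2) = c}"
  have "(\<lambda>n. (1 / real (Suc n))\<^sup>2 + 2 * (1 / real (Suc n))) \<longlonglongrightarrow> 0\<^sup>2 + 2 * 0"
    by (intro tendsto_intros LIMSEQ_Suc[OF lim_const_over_n])
  then have "?p \<le> 0\<^sup>2 + 2 * 0"
  proof (rule LIMSEQ_le_const)
    have "?p \<le> (1 / real (Suc n))\<^sup>2 + 2 * (1 / real (Suc n))" if "n \<ge> 1" for n
      using that by (intro prob_square_eq_le[OF assms]) (auto simp: field_simps)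
    then show "\<exists>N. \<forall>n\<ge>N. ?p \<le> (1 / real (Suc n))\<^sup>2 + 2 * (1 / real (Suc n))" by blast
  qed
  then show ?thesis using measure_nonneg[of M "{\<omega>\<in>space M. integral {0..1} (\<lambda>t. (W t \<omega> - W 0 \<omega>)\<^sup>2) = c}"] by simp
qed

lemma prob_max_eq_0:
  assumes T: "T = 1"
  shows "prob {\<omega>\<in>space M. (SUP t\<in>{0..1}. \<bar>W t \<omega> - W 0 \<omega>\<bar>) = b} = 0"
proof (cases "0 < b")
  case True
  let ?p = "prob {\<omega>\<in>space M. (SUP t\<in>{0..1}. \<bar>W t \<omega> - W 0 \<omega>\<bar>) = b}"
  have lim: "(\<lambda>n. 1 / real (Suc n)) \<longlonglongrightarrow> 0"
    by (rule LIMSEQ_Suc[OF lim_const_over_n])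
  have "(\<lambda>n. 16 * (1 / real (Suc n))\<^sup>2 / b\<^sup>2 + 2 * (1 / real (Suc n))) \<longlonglongrightarrow> 16 * 0\<^sup>2 / b\<^sup>2 + 2 * 0"
    using True by (intro tendsto_intros lim) auto
  moreover have "(\<lambda>n. 2 * (1 / real (Suc n))\<^sup>2) \<longlonglongrightarrow> 2 * 0\<^sup>2"
    by (intro tendsto_intros lim)
  then have "\<forall>\<^sub>F n in sequentially. 2 * (1 / real (Suc n))\<^sup>2 < b"
    using True by (intro order_tendstoD(2)) auto
  then have "\<forall>\<^sub>F n in sequentially. ?p \<le> 16 * (1 / real (Suc n))\<^sup>2 / b\<^sup>2 + 2 * (1 / real (Suc n))"
    using eventually_ge_at_top[of 1]
  proof eventually_elim
    case (elim n)
    then show ?case using True by (intro prob_max_eq_le[OF T]) (auto simp: field_simps)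
  qed
  ultimately have "?p \<le> 16 * 0\<^sup>2 / b\<^sup>2 + 2 * 0"
    using tendsto_lowerbound[of _ _ sequentially ?p] by auto
  then show ?thesis using measure_nonneg[of M "{\<omega>\<in>space M. (SUP t\<in>{0..1}. \<bar>W t \<omega> - W 0 \<omega>\<bar>) = b}"] by simp
next
  case False
  have cont: "continuous_on {0..1} (\<lambda>t. \<bar>W t \<omega> - W 0 \<omega>\<bar>)" if "\<omega> \<in> space M" for \<omega>
    using W_continuous[OF that] by (intro continuous_intros) (simp add: T)
  have D: "distributed M lborel (\<lambda>\<omega>. W 1 \<omega> - W 0 \<omega>) (normal_density 0 (sqrt (1 - 0)))"
    by (rule increment_normal) (auto simp: T)
  \<comment> \<open>The supremum is at least the modulus of the increment over the unit interval, so
    a value b that is not positive forces this increment to be 0, a null event.\<close>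
  have sub: "{\<omega>\<in>space M. (SUP t\<in>{0..1}. \<bar>W t \<omega> - W 0 \<omega>\<bar>) = b} \<subseteq> (\<lambda>\<omega>. W 1 \<omega> - W 0 \<omega>) -` {0} \<inter> space M"
    using False le_SUP_Icc[OF cont, of _ 1] by fastforce
  have "emeasure M ((\<lambda>\<omega>. W 1 \<omega> - W 0 \<omega>) -` {0} \<inter> space M) = (\<integral>\<^sup>+x. ennreal (normal_density 0 (sqrt (1 - 0)) x) * indicator {0} x \<partial>lborel)"
    by (rule distributed_emeasure[OF D]) simp
  also have "\<dots> = (\<integral>\<^sup>+x. 0 \<partial>(lborel :: real measure))"
  proof (rule nn_integral_cong_AE)
    have "AE x in lborel. x \<noteq> (0::real)" by (rule AE_lborel_singleton)
    then show "AE x in lborel. ennreal (normal_density 0 (sqrt (1 - 0)) x) * indicator {0} x = 0"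
      by (rule AE_mp) (auto simp: indicator_def)
  qed
  finally have "prob ((\<lambda>\<omega>. W 1 \<omega> - W 0 \<omega>) -` {0} \<inter> space M) = 0" by (simp add: measure_def)
  moreover have "prob {\<omega>\<in>space M. (SUP t\<in>{0..1}. \<bar>W t \<omega> - W 0 \<omega>\<bar>) = b} \<le> prob ((\<lambda>\<omega>. W 1 \<omega> - W 0 \<omega>) -` {0} \<inter> space M)"
    by (rule finite_measure_mono[OF sub]) (intro measurable_sets[of _ M borel] borel_measurable_diff W_measurable; simp add: T)
  ultimately show ?thesis using measure_nonneg[of M "{\<omega>\<in>space M. (SUP t\<in>{0..1}. \<bar>W t \<omega> - W 0 \<omega>\<bar>) = b}"] by simp
qed

end

section \<open>Convergence in probability\<close>

lemma set_lebesgue_integral_Icc: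
  fixes f :: "real \<Rightarrow> real"
  assumes "continuous_on {a..b} f"
  shows "(LINT t:{a..b}|lborel. f t) = integral {a..b} f"
  by (rule set_borel_integral_eq_integral(2)[OF borel_integrable_atLeastAtMost'[OF assms]])

text \<open>The mean value theorem is used twice, once for S and once for S'; this gives the
  constant C.\<close>

lemma taylor_bound:
  fixes S S' S'' :: "real \<Rightarrow> real"
  assumes d1: "\<And>x. (S has_real_derivative S' x) (at x)" and d2: "\<And>x. (S' has_real_derivative S'' x) (at x)"
    and b: "\<And>x. \<bar>S'' x\<bar> \<le> C"
  shows "\<bar>S y - S z - S' z * (y - z)\<bar> \<le> C * (y - z)\<^sup>2"
proof -
  have lip: "\<bar>S' u - S' z\<bar> \<le> C * \<bar>u - z\<bar>" for u
  proof (cases u z rule: linorder_cases)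
    case less
    then obtain v where "S' z - S' u = (z - u) * S'' v" using MVT2[OF less, of S' S''] d2 by auto
    then have "\<bar>S' u - S' z\<bar> = \<bar>S'' v\<bar> * \<bar>u - z\<bar>" by (metis abs_minus_commute abs_mult mult.commute)
    then show ?thesis using mult_right_mono[OF b[of v], of "\<bar>u - z\<bar>"] by simp
  next
    case greater
    then obtain v where "S' u - S' z = (u - z) * S'' v" using MVT2[OF greater, of S' S''] d2 by auto
    then have "\<bar>S' u - S' z\<bar> = \<bar>S'' v\<bar> * \<bar>u - z\<bar>" by (metis abs_mult mult.commute)
    then show ?thesis using mult_right_mono[OF b[of v], of "\<bar>u - z\<bar>"] by simp
  qed simp
  have C: "0 \<le> C" using b[of 0] by linarith
  have "\<exists>u. \<bar>u - z\<bar> \<le> \<bar>y - z\<bar> \<and> S y - S z = S' u * (y - z)"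
  proof (cases y z rule: linorder_cases)
    case less
    then obtain u where "y < u" "u < z" "S z - S y = (z - y) * S' u" using MVT2[OF less, of S S'] d1 by auto
    then show ?thesis by (intro exI[of _ u]) (auto simp: algebra_simps)
  next
    case greater
    then obtain u where "z < u" "u < y" "S y - S z = (y - z) * S' u" using MVT2[OF greater, of S S'] d1 by auto
    then show ?thesis by (intro exI[of _ u]) (auto simp: algebra_simps)
  qed auto
  then obtain u where u: "\<bar>u - z\<bar> \<le> \<bar>y - z\<bar>" "S y - S z = S' u * (y - z)" by blast
  have "S y - S z - S' z * (y - z) = (S' u - S' z) * (y - z)" using u(2) by (simp add: algebra_simps)
  then have "\<bar>S y - S z - S' z * (y - z)\<bar> = \<bar>S' u - S' z\<bar> * \<bar>y - z\<bar>" by (simp add: abs_mult)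
  also have "\<dots> \<le> (C * \<bar>y - z\<bar>) * \<bar>y - z\<bar>"
    using lip[of u] mult_left_mono[OF u(1) C] by (intro mult_right_mono) auto
  also have "\<dots> = C * (y - z)\<^sup>2" by (simp add: power2_eq_square abs_mult[symmetric])
  finally show ?thesis .
qed

lemma parts_integral_scale: "parts_integral (\<lambda>t. c * h t) (\<lambda>t. c * h' t) v t = c * parts_integral h h' v t"
  by (simp add: parts_integral_def mult.assoc right_diff_distrib)

lemma C1_pair_scale: "C1_pair T h h' \<Longrightarrow> C1_pair T (\<lambda>t. c * h t) (\<lambda>t. c * h' t)"
  by (auto simp: C1_pair_def intro!: derivative_eq_intros continuous_intros)

lemma (in prob_space) prob_large_tendsto_0:
  fixes Z :: "'a \<Rightarrow> real"
  assumes [measurable]: "Z \<in> borel_measurable M" and e: "0 < e"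
  obtains K where "0 < K" "prob {\<omega>\<in>space M. K < Z \<omega>} \<le> e"
proof -
  have "(\<lambda>n. prob {\<omega>\<in>space M. 1 < Z \<omega> / real (Suc n)}) \<longlonglongrightarrow> 0"
  proof (rule prob_gt_tendsto_0)
    show "(\<lambda>n. Z \<omega> / real (Suc n)) \<longlonglongrightarrow> 0" for \<omega> by (rule LIMSEQ_Suc[OF lim_const_over_n])
  qed auto
  then have "\<forall>\<^sub>F n in sequentially. prob {\<omega>\<in>space M. 1 < Z \<omega> / real (Suc n)} < e"
    using e by (rule order_tendstoD(2))
  then obtain n where "prob {\<omega>\<in>space M. 1 < Z \<omega> / real (Suc n)} < e"
    unfolding eventually_sequentially by blast
  then show thesis
    by (intro that[of "real (Suc n)"]) (auto simp: less_divide_eq)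
qed

text \<open>Where G differs from c by more than the approximation error, D and G lie on the same
  side of c. The exceptional events \<open>E n\<close> decrease to the event that G equals c, which
  has probability 0.\<close>

lemma (in prob_space) prob_gt_tendsto_of_close:
  fixes G :: "'a \<Rightarrow> real" and D :: "real \<Rightarrow> 'a \<Rightarrow> real"
  assumes G: "G \<in> borel_measurable M" and D: "\<And>\<epsilon>. 0 < \<epsilon> \<Longrightarrow> D \<epsilon> \<in> borel_measurable M"
    and atom: "prob {\<omega>\<in>space M. G \<omega> = c} = 0"
    and close: "\<And>e \<eta>. 0 < e \<Longrightarrow> 0 < \<eta> \<Longrightarrow> \<exists>\<epsilon>0>0. \<forall>\<epsilon>. 0 < \<epsilon> \<and> \<epsilon> < \<epsilon>0 \<longrightarrow>
      (\<exists>B\<in>events. prob B \<le> \<eta> \<and> (\<forall>\<omega>\<in>space M - B. \<bar>D \<epsilon> \<omega> - G \<omega>\<bar> \<le> e))"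
  shows "((\<lambda>\<epsilon>. prob {\<omega>\<in>space M. c < D \<epsilon> \<omega>}) \<longlongrightarrow> prob {\<omega>\<in>space M. c < G \<omega>}) (at_right 0)"
proof (rule tendstoI)
  fix r :: real assume r: "0 < r"
  note [measurable] = G
  define E where "E n = {\<omega>\<in>space M. \<bar>G \<omega> - c\<bar> \<le> 1 / real (Suc n)}" for n
  have E: "E n \<in> events" for n unfolding E_def by measurable
  have "(\<lambda>n. prob (E n)) \<longlonglongrightarrow> prob (\<Inter>n. E n)"
  proof (rule finite_Lim_measure_decseq)
    show "range E \<subseteq> events" using E by auto
    show "decseq E"
      unfolding decseq_def
    proof (intro allI impI)
      fix m n :: nat assume "m \<le> n"
      then have "1 / real (Suc n) \<le> 1 / real (Suc m)" by (simp add: frac_le)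
      then show "E n \<subseteq> E m" by (auto simp: E_def)
    qed
  qed
  also have "(\<Inter>n. E n) = {\<omega>\<in>space M. G \<omega> = c}"
  proof
    show "(\<Inter>n. E n) \<subseteq> {\<omega>\<in>space M. G \<omega> = c}"
    proof
      fix \<omega> assume \<omega>: "\<omega> \<in> (\<Inter>n. E n)"
      have "(\<lambda>n. 1 / real (Suc n)) \<longlonglongrightarrow> 0" by (rule LIMSEQ_Suc[OF lim_const_over_n])
      then have "\<bar>G \<omega> - c\<bar> \<le> 0"
        by (rule LIMSEQ_le_const) (use \<omega> in \<open>auto simp: E_def\<close>)
      then show "\<omega> \<in> {\<omega>\<in>space M. G \<omega> = c}" using \<omega> by (auto simp: E_def)
    qed
  qed (auto simp: E_def)
  finally have "\<forall>\<^sub>F n in sequentially. prob (E n) < r / 2"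
    using r atom by (intro order_tendstoD(2)) auto
  then obtain n where n: "prob (E n) < r / 2" unfolding eventually_sequentially by blast
  obtain \<epsilon>0 where \<epsilon>0: "\<epsilon>0 > 0" "\<And>\<epsilon>. 0 < \<epsilon> \<Longrightarrow> \<epsilon> < \<epsilon>0 \<Longrightarrow>
      \<exists>B\<in>events. prob B \<le> r / 4 \<and> (\<forall>\<omega>\<in>space M - B. \<bar>D \<epsilon> \<omega> - G \<omega>\<bar> \<le> 1 / real (Suc n))"
    using close[of "1 / real (Suc n)" "r / 4"] r by auto
  have "dist (prob {\<omega>\<in>space M. c < D \<epsilon> \<omega>}) (prob {\<omega>\<in>space M. c < G \<omega>}) < r" if \<epsilon>: "0 < \<epsilon>" "\<epsilon> < \<epsilon>0" for \<epsilon>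
  proof -
    obtain B where B: "B \<in> events" "prob B \<le> r / 4" "\<And>\<omega>. \<omega> \<in> space M \<Longrightarrow> \<omega> \<notin> B \<Longrightarrow> \<bar>D \<epsilon> \<omega> - G \<omega>\<bar> \<le> 1 / real (Suc n)"
      using \<epsilon>0(2)[OF \<epsilon>] by blast
    have [measurable]: "D \<epsilon> \<in> borel_measurable M" using D[OF \<epsilon>(1)] .
    note [measurable] = E[of n] B(1)
    have "{\<omega>\<in>space M. c < D \<epsilon> \<omega>} \<subseteq> {\<omega>\<in>space M. c < G \<omega>} \<union> (E n \<union> B)"
      using B(3) by (force simp: E_def abs_le_iff)
    then have "prob {\<omega>\<in>space M. c < D \<epsilon> \<omega>} \<le> prob ({\<omega>\<in>space M. c < G \<omega>} \<union> (E n \<union> B))"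
      by (rule finite_measure_mono) measurable
    also have "\<dots> \<le> prob {\<omega>\<in>space M. c < G \<omega>} + prob (E n \<union> B)"
      by (rule measure_Un_le) measurable
    finally have 1: "prob {\<omega>\<in>space M. c < D \<epsilon> \<omega>} \<le> prob {\<omega>\<in>space M. c < G \<omega>} + prob (E n \<union> B)" .
    have "{\<omega>\<in>space M. c < G \<omega>} \<subseteq> {\<omega>\<in>space M. c < D \<epsilon> \<omega>} \<union> (E n \<union> B)"
      using B(3) by (force simp: E_def abs_le_iff)
    then have "prob {\<omega>\<in>space M. c < G \<omega>} \<le> prob ({\<omega>\<in>space M. c < D \<epsilon> \<omega>} \<union> (E n \<union> B))"
      by (rule finite_measure_mono) measurable
    also have "\<dots> \<le> prob {\<omega>\<in>space M. c < D \<epsilon> \<omega>} + prob (E n \<union> B)"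
      by (rule measure_Un_le) measurable
    finally have 2: "prob {\<omega>\<in>space M. c < G \<omega>} \<le> prob {\<omega>\<in>space M. c < D \<epsilon> \<omega>} + prob (E n \<union> B)" .
    have "prob (E n \<union> B) \<le> prob (E n) + prob B" by (rule measure_Un_le) measurable
    then show ?thesis using 1 2 n B(2) r unfolding dist_real_def by linarith
  qed
  then show "\<forall>\<^sub>F \<epsilon> in at_right 0. dist (prob {\<omega>\<in>space M. c < D \<epsilon> \<omega>}) (prob {\<omega>\<in>space M. c < G \<omega>}) < r"
    using \<epsilon>0(1) by (auto simp: eventually_at_right_field)
qed

text \<open>The exceptional event has three parts: the Lenglart event, the event that the Wiener
  integral \<open>\<psi>\<close> is large, and the null set where the integral equation fails.
  Outside it the two pathwise lemmas apply.\<close>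

lemma (in wiener) rescaled_deviation_in_probability:
  assumes T: "0 < T" and L: "0 < L" "\<And>y z. \<bar>S y - S z\<bar> \<le> L * \<bar>y - z\<bar>" "\<And>y z. \<bar>\<sigma> y - \<sigma> z\<bar> \<le> L * \<bar>y - z\<bar>"
    and sde: "\<And>\<epsilon>. \<epsilon> > 0 \<Longrightarrow> sde_solution M F T W S (\<lambda>y. \<epsilon> * \<sigma> y) x0 (X \<epsilon>)"
    and x: "ode_solution T S x0 x" and cont: "continuous_on UNIV S" "continuous_on UNIV \<sigma>"
    and taylor: "\<And>y z. \<bar>S y - S z - S' z * (y - z)\<bar> \<le> C * (y - z)\<^sup>2" and C: "0 \<le> C"
    and f: "C1_pair T f f'" "\<And>t. t \<in> {0..T} \<Longrightarrow> f' t = - S' (x t) * f t"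
    and h: "C1_pair T (\<lambda>t. \<sigma> (x t)) h'"
    and e: "0 < e" and \<eta>: "0 < \<eta>"
  shows "\<exists>\<epsilon>0>0. \<forall>\<epsilon>. 0 < \<epsilon> \<and> \<epsilon> < \<epsilon>0 \<longrightarrow> (\<exists>B\<in>events. prob B \<le> \<eta> \<and> (\<forall>\<omega>\<in>space M - B. \<forall>t\<in>{0..T}.
     \<bar>(X \<epsilon> t \<omega> - x t) / \<epsilon> * f t - parts_integral (\<lambda>t. f t * \<sigma> (x t)) (\<lambda>t. f' t * \<sigma> (x t) + f t * h' t) (\<lambda>s. W s \<omega>) t\<bar> \<le> e))"
proof -
  have T0: "0 \<le> T" using T by simp
  define \<psi> where "\<psi> \<omega> = parts_integral (\<lambda>t. \<sigma> (x t)) h' (\<lambda>s. W s \<omega>)" for \<omega>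
  have c\<psi>: "continuous_on {0..T} (\<psi> \<omega>)" if "\<omega> \<in> space M" for \<omega>
    unfolding \<psi>_def by (rule parts_integral_continuous[OF h W_continuous[OF that]])
  have ca\<psi>: "continuous_on {0..T} (\<lambda>t. \<bar>\<psi> \<omega> t\<bar>)" if "\<omega> \<in> space M" for \<omega>
    by (intro continuous_intros c\<psi> that)
  have [measurable]: "(\<lambda>\<omega>. SUP t\<in>{0..T}. \<bar>\<psi> \<omega> t\<bar>) \<in> borel_measurable M"
    by (rule borel_measurable_SUP_path[OF _ T0 ca\<psi>])
      (auto simp: \<psi>_def intro!: borel_measurable_abs borel_measurable_parts_integral[OF h] W_measurable W_continuous)
  obtain K where K: "0 < K" "prob {\<omega>\<in>space M. K < (SUP t\<in>{0..T}. \<bar>\<psi> \<omega> t\<bar>)} \<le> \<eta> / 2"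
    using prob_large_tendsto_0[of "\<lambda>\<omega>. SUP t\<in>{0..T}. \<bar>\<psi> \<omega> t\<bar>" "\<eta> / 2"] \<eta> by auto
  obtain K1 where K1: "K1 > 0" "\<And>t. t \<in> {0..T} \<Longrightarrow> \<bar>f t\<bar> \<le> K1"
    using continuous_on_Icc_bound[OF C1_pair_continuous[OF f(1)]] by metis
  obtain K2 where K2: "K2 > 0" "\<And>t. t \<in> {0..T} \<Longrightarrow> \<bar>f' t\<bar> \<le> K2"
    using continuous_on_Icc_bound[OF C1_pair_continuous'[OF f(1)]] by metis
  define Kf where "Kf = max K1 K2"
  have Kf: "Kf > 0" "\<And>t. t \<in> {0..T} \<Longrightarrow> \<bar>f t\<bar> \<le> Kf" "\<And>t. t \<in> {0..T} \<Longrightarrow> \<bar>f' t\<bar> \<le> Kf"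
    using K1 K2 by (auto simp: Kf_def less_max_iff_disj le_max_iff_disj)
  \<comment> \<open>Half of e pays for replacing \<open>I / \<epsilon>\<close> by
    \<open>\<psi>\<close>, which costs \<open>a * Kf * (1 + T)\<close>; the other half pays for the
    Taylor remainder.\<close>
  define a where "a = e / 2 / (Kf * (1 + T))"
  have a: "0 < a" using e Kf(1) T by (simp add: a_def)
  have aKf: "a * Kf * (1 + T) = e / 2"
  proof -
    have "a * Kf * (1 + T) = e / 2 / (Kf * (1 + T)) * (Kf * (1 + T))" by (simp only: a_def mult.assoc)
    also have "\<dots> = e / 2" by (rule nonzero_eq_divide_eq[THEN iffD1, OF _ refl]) (use Kf(1) T in auto)
    finally show ?thesis .
  qed
  \<comment> \<open>Chosen so that 36 * b divided by the square of a is \<eta> / 2.\<close>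
  define b where "b = a\<^sup>2 * \<eta> / 72"
  have b: "0 < b" using a \<eta> by (simp add: b_def)
  \<comment> \<open>While X is within r of x, the accumulated square of the difference of the
    diffusion coefficients is at most b / 2.\<close>
  define r where "r = sqrt (b / (2 * T)) / L"
  have r: "0 < r" using b T L by (simp add: r_def)
  have rb: "(L * r)\<^sup>2 * T < b"
  proof -
    have "(L * r)\<^sup>2 * T = b / 2" using b T L by (simp add: r_def)
    then show ?thesis using b by simp
  qed
  define R where "R = (a + K) * exp (L * T)"
  have R: "0 < R" using a K by (simp add: R_def)
  \<comment> \<open>The summand 1 keeps D positive if C is 0.\<close>
  define D where "D = Kf * C * T * R\<^sup>2 + 1"
  have D: "0 < D" using Kf C T by (simp add: D_def add_nonneg_pos)
  define \<epsilon>0 where "\<epsilon>0 = min (r / R) (e / 2 / D)"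
  have \<epsilon>0: "0 < \<epsilon>0" using r R e D by (simp add: \<epsilon>0_def)
  have "\<exists>B\<in>events. prob B \<le> \<eta> \<and> (\<forall>\<omega>\<in>space M - B. \<forall>t\<in>{0..T}.
     \<bar>(X \<epsilon> t \<omega> - x t) / \<epsilon> * f t - parts_integral (\<lambda>t. f t * \<sigma> (x t)) (\<lambda>t. f' t * \<sigma> (x t) + f t * h' t) (\<lambda>s. W s \<omega>) t\<bar> \<le> e)"
    if \<epsilon>: "0 < \<epsilon>" "\<epsilon> < \<epsilon>0" for \<epsilon>
  proof -
    have \<epsilon>R: "\<epsilon> * R < r" using \<epsilon> R by (simp add: \<epsilon>0_def less_divide_eq)
    have \<epsilon>D: "Kf * C * T * \<epsilon> * R\<^sup>2 \<le> e / 2"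
    proof -
      have "\<epsilon> * D < e / 2" using \<epsilon> D by (simp add: \<epsilon>0_def less_divide_eq)
      moreover have "\<epsilon> * D = Kf * C * T * \<epsilon> * R\<^sup>2 + \<epsilon>" by (simp add: D_def algebra_simps)
      ultimately show ?thesis using \<epsilon>(1) by linarith
    qed
    from sde[OF \<epsilon>(1)] obtain I where I: "is_ito_integral M F T W (\<lambda>t \<omega>. \<epsilon> * \<sigma> (X \<epsilon> t \<omega>)) I"
      and eq: "AE \<omega> in M. \<forall>t\<in>{0..T}. X \<epsilon> t \<omega> = x0 + (LINT u:{0..t}|lborel. S (X \<epsilon> u \<omega>)) + I t \<omega>"
      and cX: "\<And>\<omega>. \<omega> \<in> space M \<Longrightarrow> continuous_on {0..T} (\<lambda>t. X \<epsilon> t \<omega>)"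
      unfolding sde_solution_def continuous_paths_def by blast
    have cI: "continuous_on {0..T} (\<lambda>t. I t \<omega>)" if "\<omega> \<in> space M" for \<omega>
      using I that unfolding is_ito_integral_def continuous_paths_def by blast
    obtain N0 where N0: "N0 \<in> null_sets M" "{\<omega>\<in>space M. \<not> (\<forall>t\<in>{0..T}. X \<epsilon> t \<omega> = x0 + (LINT u:{0..t}|lborel. S (X \<epsilon> u \<omega>)) + I t \<omega>)} \<subseteq> N0"
      using eq unfolding eventually_ae_filter by blast
    \<comment> \<open>The integrand carries the factor \<epsilon>, so the threshold is scaled by
      \<epsilon> and the accumulated square by its square; the resulting bound is the same for all
      \<epsilon>.\<close>
    define B1 where "B1 = lenglart_event (\<lambda>t \<omega>. \<epsilon> * \<sigma> (X \<epsilon> t \<omega>)) I (\<lambda>t. \<epsilon> * \<sigma> (x t)) (\<lambda>t. \<epsilon> * h' t) (\<epsilon> * a) (\<epsilon>\<^sup>2 * b) {0..T}"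
    have cH: "continuous_paths M T (\<lambda>t \<omega>. \<epsilon> * \<sigma> (X \<epsilon> t \<omega>))"
      unfolding continuous_paths_def
      by (intro ballI continuous_intros continuous_on_compose2[OF cont(2)] cX) auto
    have pos: "0 < \<epsilon> * a" "0 < \<epsilon>\<^sup>2 * b" using \<epsilon> a b by auto
    have B1: "B1 \<in> events" "prob B1 \<le> \<eta> / 2"
    proof -
      show "B1 \<in> events"
        unfolding B1_def by (rule ito_lenglart(1)[OF T I cH C1_pair_scale[OF h] pos])
      have "prob B1 \<le> 36 * (\<epsilon>\<^sup>2 * b) / (\<epsilon> * a)\<^sup>2"
        unfolding B1_def by (rule ito_lenglart(2)[OF T I cH C1_pair_scale[OF h] pos])
      also have "\<dots> = \<eta> / 2"
        using \<epsilon> a by (simp add: b_def power_mult_distrib)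
      finally show "prob B1 \<le> \<eta> / 2" .
    qed
    define B2 where "B2 = {\<omega>\<in>space M. K < (SUP t\<in>{0..T}. \<bar>\<psi> \<omega> t\<bar>)}"
    have B2: "B2 \<in> events" "prob B2 \<le> \<eta> / 2" unfolding B2_def by (measurable, rule K(2))
    have ev: "(B1 \<union> B2) \<union> N0 \<in> events" using B1 B2 N0 by auto
    moreover have "prob ((B1 \<union> B2) \<union> N0) \<le> \<eta>"
    proof -
      have "prob ((B1 \<union> B2) \<union> N0) = prob (B1 \<union> B2)"
        using B1 B2 N0 by (intro measure_Un_null_set) auto
      also have "\<dots> \<le> prob B1 + prob B2" using B1 B2 by (intro measure_Un_le)
      finally show ?thesis using B1 B2 by linarith
    qed
    moreover have "\<bar>(X \<epsilon> t \<omega> - x t) / \<epsilon> * f t - parts_integral (\<lambda>t. f t * \<sigma> (x t)) (\<lambda>t. f' t * \<sigma> (x t) + f t * h' t) (\<lambda>s. W s \<omega>) t\<bar> \<le> e"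
      if \<omega>: "\<omega> \<in> space M - ((B1 \<union> B2) \<union> N0)" and t: "t \<in> {0..T}" for \<omega> t
    proof -
      have \<omega>M: "\<omega> \<in> space M" using \<omega> by blast
      have Xeq: "X \<epsilon> t \<omega> = x0 + integral {0..t} (\<lambda>u. S (X \<epsilon> u \<omega>)) + I t \<omega>" if t: "t \<in> {0..T}" for t
      proof -
        have "continuous_on {0..t} (\<lambda>u. S (X \<epsilon> u \<omega>))"
          by (rule continuous_on_compose2[OF cont(1) continuous_on_subset[OF cX[OF \<omega>M]]]) (use t in auto)
        moreover have "X \<epsilon> t \<omega> = x0 + (LINT u:{0..t}|lborel. S (X \<epsilon> u \<omega>)) + I t \<omega>"
          using N0(2) \<omega> t by blast
        ultimately show ?thesis by (simp add: set_lebesgue_integral_Icc)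
      qed
      have \<psi>K: "\<bar>\<psi> \<omega> t\<bar> \<le> K" if "t \<in> {0..T}" for t
      proof -
        have "(SUP t\<in>{0..T}. \<bar>\<psi> \<omega> t\<bar>) \<le> K" using \<omega> by (auto simp: B2_def)
        then show ?thesis using le_SUP_Icc[OF ca\<psi>[OF \<omega>M] that] by linarith
      qed
      have good: "\<bar>I t \<omega> / \<epsilon> - \<psi> \<omega> t\<bar> \<le> a"
        if t: "t \<in> {0..T}" and small: "integral {0..t} (\<lambda>s. (\<sigma> (X \<epsilon> s \<omega>) - \<sigma> (x s))\<^sup>2) < b" for t
      proof -
        have "integral {0..t} (\<lambda>s. (\<epsilon> * \<sigma> (X \<epsilon> s \<omega>) - \<epsilon> * \<sigma> (x s))\<^sup>2) = \<epsilon>\<^sup>2 * integral {0..t} (\<lambda>s. (\<sigma> (X \<epsilon> s \<omega>) - \<sigma> (x s))\<^sup>2)"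
          by (simp add: right_diff_distrib[symmetric] power_mult_distrib)
        also have "\<dots> < \<epsilon>\<^sup>2 * b" using small \<epsilon> by simp
        finally have "\<not> \<epsilon> * a < \<bar>I t \<omega> - \<epsilon> * \<psi> \<omega> t\<bar>"
          using \<omega> t by (auto simp: B1_def lenglart_event_def parts_integral_scale \<psi>_def)
        moreover have "\<bar>I t \<omega> - \<epsilon> * \<psi> \<omega> t\<bar> = \<epsilon> * \<bar>I t \<omega> / \<epsilon> - \<psi> \<omega> t\<bar>"
        proof -
          have "I t \<omega> - \<epsilon> * \<psi> \<omega> t = \<epsilon> * (I t \<omega> / \<epsilon> - \<psi> \<omega> t)" using \<epsilon> by (simp add: right_diff_distrib)
          then show ?thesis using \<epsilon> by (simp add: abs_mult)
        qed
        ultimately show ?thesis using \<epsilon> by simp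
      qed
      note xc = ode_solution_continuous[OF x] and xi = ode_solution_integral[OF x cont(1)]
      have loc: "\<bar>X \<epsilon> t \<omega> - x t\<bar> \<le> \<epsilon> * R \<and> \<bar>I t \<omega> / \<epsilon> - \<psi> \<omega> t\<bar> \<le> a" if "t \<in> {0..T}" for t
        unfolding R_def
        by (rule pathwise_localisation[where S = S and \<sigma> = \<sigma> and x = x and X = "\<lambda>t. X \<epsilon> t \<omega>" and I = "\<lambda>t. I t \<omega>" and \<psi> = "\<psi> \<omega>"
              and L = L and r = r and b = b and T = T])
          (use L \<epsilon> xc cX[OF \<omega>M] cI[OF \<omega>M] cont xi Xeq \<psi>K good \<epsilon>R[unfolded R_def] rb a K that in simp_all)
      have "\<bar>(X \<epsilon> t \<omega> - x t) / \<epsilon> * f t - parts_integral f f' (\<psi> \<omega>) t\<bar> \<le> a * Kf * (1 + T) + Kf * C * T * \<epsilon> * R\<^sup>2"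
      proof (rule rescaled_deviation_approx[where S = S and S' = S' and x = x and X = "\<lambda>t. X \<epsilon> t \<omega>" and I = "\<lambda>t. I t \<omega>"])
        show "\<psi> \<omega> 0 = 0" by (simp add: \<psi>_def parts_integral_def)
        show "\<bar>X \<epsilon> t \<omega> - x t\<bar> \<le> \<epsilon> * R" "\<bar>I t \<omega> / \<epsilon> - \<psi> \<omega> t\<bar> \<le> a" if "t \<in> {0..T}" for t
          using loc[OF that] by auto
      qed (fact \<epsilon> xc cX[OF \<omega>M] cI[OF \<omega>M] c\<psi>[OF \<omega>M] cont f xi Xeq taylor Kf C t)+
      also have "\<dots> \<le> e" using aKf \<epsilon>D by linarith
      also have "parts_integral f f' (\<psi> \<omega>) t = parts_integral (\<lambda>t. f t * \<sigma> (x t)) (\<lambda>t. f' t * \<sigma> (x t) + f t * h' t) (\<lambda>s. W s \<omega>) t"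
        unfolding \<psi>_def by (rule parts_integral_compose[OF f(1) h W_continuous[OF \<omega>M] t])
      finally show ?thesis .
    qed
    ultimately show ?thesis by blast
  qed
  then show ?thesis using \<epsilon>0 by blast
qed

section \<open>Size of the tests\<close>

lemma C1_pair_compose:
  assumes S: "\<And>y. (S has_real_derivative S' y) (at y)" "continuous_on UNIV S'" and x: "C1_pair T x x'"
  shows "C1_pair T (\<lambda>t. S (x t)) (\<lambda>t. S' (x t) * x' t)"
  unfolding C1_pair_def
proof (intro conjI ballI)
  show "continuous_on {0..T} (\<lambda>t. S' (x t) * x' t)"
    by (intro continuous_intros continuous_on_compose2[OF S(2)] C1_pair_continuous[OF x] C1_pair_continuous'[OF x]) auto
  fix t assume "t \<in> {0..T}"
  then have "(x has_real_derivative x' t) (at t within {0..T})" using x by (simp add: C1_pair_def)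
  then show "((\<lambda>t. S (x t)) has_real_derivative S' (x t) * x' t) (at t within {0..T})"
    by (rule DERIV_chain2[OF S(1)])
qed

lemma C1_pair_reciprocal:
  assumes s: "C1_pair T s s'" and nz: "\<And>t. t \<in> {0..T} \<Longrightarrow> s t \<noteq> 0"
  shows "C1_pair T (\<lambda>t. 1 / s t) (\<lambda>t. - s' t / (s t)\<^sup>2)"
  unfolding C1_pair_def
proof (intro conjI ballI)
  show "continuous_on {0..T} (\<lambda>t. - s' t / (s t)\<^sup>2)"
    using nz by (intro continuous_intros C1_pair_continuous[OF s] C1_pair_continuous'[OF s]) auto
  fix t assume t: "t \<in> {0..T}"
  then have "(s has_real_derivative s' t) (at t within {0..T})" using s by (simp add: C1_pair_def)
  then show "((\<lambda>t. 1 / s t) has_real_derivative - s' t / (s t)\<^sup>2) (at t within {0..T})"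
    using nz[OF t] by (auto intro!: derivative_eq_intros simp: power2_eq_square)
qed

lemma (in prob_space) indicator_test_of_size:
  fixes stat :: "real \<Rightarrow> (real \<Rightarrow> real) \<Rightarrow> real" and D :: "real \<Rightarrow> 'a \<Rightarrow> real"
  assumes stat: "\<And>\<epsilon> \<omega>. 0 < \<epsilon> \<Longrightarrow> \<omega> \<in> space M \<Longrightarrow> stat \<epsilon> (observation T (X \<epsilon>) \<omega>) = D \<epsilon> \<omega>"
    and D: "\<And>\<epsilon>. 0 < \<epsilon> \<Longrightarrow> D \<epsilon> \<in> borel_measurable M"
    and lim: "((\<lambda>\<epsilon>. prob {\<omega>\<in>space M. c < D \<epsilon> \<omega>}) \<longlongrightarrow> \<alpha>) (at_right 0)"
  shows "(\<lambda>\<epsilon>. indicator {p. stat \<epsilon> p > c}) \<in> tests_of_size M T X \<alpha>"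
proof -
  have int: "integrable M (\<lambda>\<omega>. indicator {p. stat \<epsilon> p > c} (observation T (X \<epsilon>) \<omega>) :: real) \<and>
    (LINT \<omega>|M. indicator {p. stat \<epsilon> p > c} (observation T (X \<epsilon>) \<omega>)) = prob {\<omega>\<in>space M. c < D \<epsilon> \<omega>}"
    if \<epsilon>: "0 < \<epsilon>" for \<epsilon>
  proof -
    have [measurable]: "D \<epsilon> \<in> borel_measurable M" using D[OF \<epsilon>] .
    have eq: "indicator {p. stat \<epsilon> p > c} (observation T (X \<epsilon>) \<omega>) = (indicator {\<omega>\<in>space M. c < D \<epsilon> \<omega>} \<omega> :: real)"
      if "\<omega> \<in> space M" for \<omega>
      using stat[OF \<epsilon> that] that by (simp add: indicator_def)
    have ev: "{\<omega>\<in>space M. c < D \<epsilon> \<omega>} \<in> events" by measurable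
    have i: "integrable M (indicator {\<omega>\<in>space M. c < D \<epsilon> \<omega>} :: 'a \<Rightarrow> real)"
      using ev by (intro integrable_real_indicator) (auto simp: emeasure_eq_measure)
    have "integrable M (\<lambda>\<omega>. indicator {p. stat \<epsilon> p > c} (observation T (X \<epsilon>) \<omega>) :: real)"
      using i by (subst Bochner_Integration.integrable_cong[OF refl eq]) auto
    moreover have "(LINT \<omega>|M. indicator {p. stat \<epsilon> p > c} (observation T (X \<epsilon>) \<omega>)) = (LINT \<omega>|M. (indicator {\<omega>\<in>space M. c < D \<epsilon> \<omega>} \<omega> :: real))"
      by (rule Bochner_Integration.integral_cong[OF refl eq])
    ultimately show ?thesis using ev by simp
  qed
  have "((\<lambda>\<epsilon>. prob {\<omega>\<in>space M. c < D \<epsilon> \<omega>} - \<alpha>) \<longlongrightarrow> \<alpha> - \<alpha>) (at_right 0)"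
    by (intro tendsto_intros lim)
  moreover have "\<forall>\<^sub>F \<epsilon> in at_right 0. prob {\<omega>\<in>space M. c < D \<epsilon> \<omega>} - \<alpha>
      = ((LINT \<omega>|M. indicator {p. stat \<epsilon> p > c} (observation T (X \<epsilon>) \<omega>)) - \<alpha>) / 1"
    using eventually_at_right_less[of "0::real"] by eventually_elim (use int in simp)
  ultimately have "((\<lambda>\<epsilon>. ((LINT \<omega>|M. indicator {p. stat \<epsilon> p > c} (observation T (X \<epsilon>) \<omega>)) - \<alpha>) / 1) \<longlongrightarrow> 0) (at_right 0)"
    using Lim_transform_eventually by fastforce
  then have "(\<lambda>\<epsilon>. (LINT \<omega>|M. indicator {p. stat \<epsilon> p > c} (observation T (X \<epsilon>) \<omega>)) - \<alpha>) \<in> o[at_right 0](\<lambda>_. 1)"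
    by (intro smalloI_tendsto) auto
  then show ?thesis using int by (simp add: tests_of_size_def)
qed

lemma (in wiener) unit_limits:
  shows "square_limit (\<lambda>_. 1) (\<lambda>_. 0) 1 \<omega> = integral {0..T} (\<lambda>t. (W t \<omega> - W 0 \<omega>)\<^sup>2)"
    and "max_limit (\<lambda>_. 1) (\<lambda>_. 0) 1 \<omega> = (SUP t\<in>{0..T}. \<bar>W t \<omega> - W 0 \<omega>\<bar>)"
  by (simp_all add: square_limit_def max_limit_def parts_integral_def)

lemma distr_prob_transfer:
  assumes "prob_space M" "prob_space N" "A \<in> borel_measurable M" "B \<in> borel_measurable N"
    and eq: "distr M borel A = distr N borel B" and U: "U \<in> sets borel"
  shows "measure M {\<omega>\<in>space M. A \<omega> \<in> U} = measure N {\<omega>\<in>space N. B \<omega> \<in> U}"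
proof -
  have "measure M {\<omega>\<in>space M. A \<omega> \<in> U} = measure (distr M borel A) U"
    using assms(3) U by (subst measure_distr) (auto simp: vimage_def Int_def conj_commute)
  also have "\<dots> = measure N {\<omega>\<in>space N. B \<omega> \<in> U}"
    unfolding eq using assms(4) U by (subst measure_distr) (auto simp: vimage_def Int_def conj_commute)
  finally show ?thesis .
qed

theorem proposition1:
  fixes T x0 \<alpha> c b :: real
    and S0 \<sigma> x :: "real \<Rightarrow> real"
    and M :: "'a measure" and F :: "real \<Rightarrow> 'a measure"
    and W :: "real \<Rightarrow> 'a \<Rightarrow> real" and X :: "real \<Rightarrow> real \<Rightarrow> 'a \<Rightarrow> real"
    and N :: "'b measure" and w :: "real \<Rightarrow> 'b \<Rightarrow> real"
  assumes "T > 0"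
    and "lipschitz_coefficients S0 \<sigma>"
    and "wiener_process M F T W"
    and "\<And>\<epsilon>. \<epsilon> > 0 \<Longrightarrow> sde_solution M F T W S0 (\<lambda>y. \<epsilon> * \<sigma> y) x0 (X \<epsilon>)"
    and "ode_solution T S0 x0 x"
    and "condition_R S0 \<sigma> x0"
    and "0 < \<alpha>" and "\<alpha> < 1"
    and "standard_wiener_process N 1 w"
    and "measure N {\<omega>\<in>space N. (LINT v:{0..1}|lborel. (w v \<omega>)\<^sup>2) > c} = \<alpha>"
    and "measure N {\<omega>\<in>space N. (SUP v\<in>{0..1}. \<bar>w v \<omega>\<bar>) > b} = \<alpha>"
  shows "(\<lambda>\<epsilon>. indicator {p. delta_stat T S0 \<sigma> x \<epsilon> p > c}) \<in> tests_of_size M T X \<alpha> \<and>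
         (\<lambda>\<epsilon>. indicator {p. gamma_stat T S0 \<sigma> x \<epsilon> p > b}) \<in> tests_of_size M T X \<alpha>"
proof -
  have T: "0 < T" "0 \<le> T" using assms(1) by auto
  note sde = assms(4) and ode = assms(5)
  have "prob_space M" "prob_space N"
    using assms(3,9) by (auto simp: wiener_process_def standard_wiener_process_def filtered_prob_space_def)
  then interpret M: wiener M F T W + N: wiener N "natural_filtration N 1 w" 1 w
    using assms(3,9) by (simp_all add: wiener_def wiener_axioms_def standard_wiener_process_def)
  obtain L where L: "L > 0" "\<And>y z. \<bar>S0 y - S0 z\<bar> + \<bar>\<sigma> y - \<sigma> z\<bar> \<le> L * \<bar>y - z\<bar>"
    using assms(2) unfolding lipschitz_coefficients_def by blast
  have lip: "\<bar>S0 y - S0 z\<bar> \<le> L * \<bar>y - z\<bar>" "\<bar>\<sigma> y - \<sigma> z\<bar> \<le> L * \<bar>y - z\<bar>" for y z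
    using L(2)[of y z] by linarith+
  obtain S0' S0'' where S0: "\<And>y. (S0 has_real_derivative S0' y) (at y)" "\<And>y. (S0' has_real_derivative S0'' y) (at y)"
    "continuous_on UNIV S0'" "bounded (range S0'')"
    using assms(6) unfolding condition_R_def by blast
  obtain \<sigma>' where \<sigma>: "\<And>y. (\<sigma> has_real_derivative \<sigma>' y) (at y)" "continuous_on UNIV \<sigma>'"
    using assms(6) unfolding condition_R_def by blast
  have pos: "0 < S0 y" "0 < (\<sigma> y)\<^sup>2" if "x0 \<le> y" for y
    using assms(6) that unfolding condition_R_def by blast+
  obtain C where C: "\<And>y. \<bar>S0'' y\<bar> \<le> C" using S0(4) by (auto simp: bounded_iff)
  have C0: "0 \<le> C" using C[of 0] by linarith
  note taylor = taylor_bound[OF S0(1,2) C]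
  have cS: "continuous_on UNIV S0" "continuous_on UNIV \<sigma>"
    using DERIV_continuous_on S0(1) \<sigma>(1) by blast+
  note x1 = ode_solution_C1[OF ode cS(1)]
  \<comment> \<open>The solution never falls below x0, so Condition R excludes zeros of both
    coefficients along it.\<close>
  have xpos: "0 < S0 (x t)" "\<sigma> (x t) \<noteq> 0" if "t \<in> {0..T}" for t
    using pos[OF ode_solution_ge[OF ode pos(1)[OF order_refl] that]] by auto
  define f where "f t = 1 / S0 (x t)" for t
  define f' where "f' t = - (S0' (x t) * S0 (x t)) / (S0 (x t))\<^sup>2" for t
  have f: "C1_pair T f f'"
    unfolding f_def[abs_def] f'_def[abs_def]
    by (rule C1_pair_reciprocal[OF C1_pair_compose[OF S0(1,3) x1]]) (use xpos in force)
  have f': "f' t = - S0' (x t) * f t" if "t \<in> {0..T}" for t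
    using xpos(1)[OF that] by (simp add: f_def f'_def power2_eq_square)
  define h' where "h' t = \<sigma>' (x t) * S0 (x t)" for t
  have h: "C1_pair T (\<lambda>t. \<sigma> (x t)) h'"
    unfolding h'_def[abs_def] by (rule C1_pair_compose[OF \<sigma> x1])
  define g where "g t = f t * \<sigma> (x t)" for t
  define g' where "g' t = f' t * \<sigma> (x t) + f t * h' t" for t
  have g: "C1_pair T g g'"
    unfolding g_def[abs_def] g'_def[abs_def] by (rule C1_pair_mult[OF f h])
  have g0: "g t \<noteq> 0" if "t \<in> {0..T}" for t
    using xpos[OF that] by (simp add: g_def f_def)
  note cf = C1_pair_continuous[OF f] and cg = C1_pair_continuous[OF g]
  have cx: "continuous_on {0..T} x" by (rule ode_solution_continuous[OF ode])
  define \<theta> where "\<theta> = integral {0..T} (\<lambda>t. (g t)\<^sup>2)"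
  have \<theta>: "0 < \<theta>" using time_change_grid[OF T(1) cg g0 \<theta>_def] by blast
  have \<theta>_eq: "(LINT t:{0..T}|lborel. (\<sigma> (x t) / S0 (x t))\<^sup>2) = \<theta>"
    using set_lebesgue_integral_Icc[of 0 T "\<lambda>t. (g t)\<^sup>2"] cg
    by (simp add: \<theta>_def g_def f_def continuous_intros)
  define Z where "Z \<omega> = parts_integral g g' (\<lambda>s. W s \<omega>)" for \<omega>
  have cZ: "continuous_on {0..T} (Z \<omega>)" if "\<omega> \<in> space M" for \<omega>
    unfolding Z_def by (rule parts_integral_continuous[OF g M.W_continuous[OF that]])
  have caZ: "continuous_on {0..T} (\<lambda>t. \<bar>Z \<omega> t\<bar>)" if "\<omega> \<in> space M" for \<omega>
    by (intro continuous_intros cZ that)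
  have mZ: "(\<lambda>\<omega>. SUP t\<in>{0..T}. \<bar>Z \<omega> t\<bar>) \<in> borel_measurable M"
    by (rule borel_measurable_SUP_path[OF _ T(2) caZ])
      (auto simp: Z_def intro!: borel_measurable_abs borel_measurable_parts_integral[OF g] M.W_measurable M.W_continuous)
  define Y where "Y \<epsilon> \<omega> t = (X \<epsilon> t \<omega> - x t) / \<epsilon> * f t" for \<epsilon> \<omega> t
  have cY: "continuous_on {0..T} (Y \<epsilon> \<omega>)" if "0 < \<epsilon>" "\<omega> \<in> space M" for \<epsilon> \<omega>
  proof -
    have "continuous_on {0..T} (\<lambda>t. X \<epsilon> t \<omega>)"
      using sde[OF that(1)] that(2) unfolding sde_solution_def continuous_paths_def by blast
    then show ?thesis unfolding Y_def using that(1) by (intro continuous_intros cf cx) auto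
  qed
  have mY: "(\<lambda>\<omega>. Y \<epsilon> \<omega> t) \<in> borel_measurable M" if "0 < \<epsilon>" "t \<in> {0..T}" for \<epsilon> t
  proof -
    have [measurable]: "X \<epsilon> t \<in> borel_measurable M"
      using sde[OF that(1)] that(2) M.measurable_F unfolding sde_solution_def adapted_def by blast
    show ?thesis unfolding Y_def by measurable
  qed
  have close: "\<exists>\<epsilon>0>0. \<forall>\<epsilon>. 0 < \<epsilon> \<and> \<epsilon> < \<epsilon>0 \<longrightarrow> (\<exists>B\<in>sets M. measure M B \<le> \<eta> \<and>
      (\<forall>\<omega>\<in>space M - B. \<forall>t\<in>{0..T}. \<bar>Y \<epsilon> \<omega> t - Z \<omega> t\<bar> \<le> e))" if "0 < e" "0 < \<eta>" for e \<eta>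
    using M.rescaled_deviation_in_probability[OF T(1) L(1) lip sde ode cS taylor C0 f f' h that]
    by (simp add: Y_def Z_def g_def[abs_def] g'_def[abs_def])

  \<comment> \<open>The process w on the unit interval is the case g = 1 with \<theta> = 1, so its
    functionals are limits of the same reference laws.\<close>
  have N1: "C1_pair 1 (\<lambda>_. 1) (\<lambda>_. 0)" "1 = integral {0..1::real} (\<lambda>t. 1\<^sup>2 :: real)"
    by (auto simp: C1_pair_def)
  have square_law: "distr M borel (M.square_limit g g' \<theta>) = distr N borel (N.square_limit (\<lambda>_. 1) (\<lambda>_. 0) 1)"
    by (rule distr_eq_of_gauss_law_limit[OF M.prob_space_axioms N.prob_space_axioms M.limit_measurable(1)[OF T(2) g] N.limit_measurable(1)[OF _ N1(1)]
          M.gauss_law_walk_limit(1)[OF T(1) g g0 \<theta>_def] N.gauss_law_walk_limit(1)[OF _ N1(1) _ N1(2)]]) auto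
  have max_law: "distr M borel (M.max_limit g g' \<theta>) = distr N borel (N.max_limit (\<lambda>_. 1) (\<lambda>_. 0) 1)"
    by (rule distr_eq_of_gauss_law_limit[OF M.prob_space_axioms N.prob_space_axioms M.limit_measurable(2)[OF T(2) g] N.limit_measurable(2)[OF _ N1(1)]
          M.gauss_law_walk_limit(2)[OF T(1) g g0 \<theta>_def] N.gauss_law_walk_limit(2)[OF _ N1(1) _ N1(2)]]) auto
  have transfer_square: "measure M {\<omega>\<in>space M. M.square_limit g g' \<theta> \<omega> \<in> U} = measure N {\<omega>\<in>space N. N.square_limit (\<lambda>_. 1) (\<lambda>_. 0) 1 \<omega> \<in> U}"
    if "U \<in> sets borel" for U
    by (rule distr_prob_transfer[OF M.prob_space_axioms N.prob_space_axioms M.limit_measurable(1)[OF T(2) g] N.limit_measurable(1)[OF _ N1(1)] square_law that]) simp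
  have transfer_max: "measure M {\<omega>\<in>space M. M.max_limit g g' \<theta> \<omega> \<in> U} = measure N {\<omega>\<in>space N. N.max_limit (\<lambda>_. 1) (\<lambda>_. 0) 1 \<omega> \<in> U}"
    if "U \<in> sets borel" for U
    by (rule distr_prob_transfer[OF M.prob_space_axioms N.prob_space_axioms M.limit_measurable(2)[OF T(2) g] N.limit_measurable(2)[OF _ N1(1)] max_law that]) simp

  have square_c: "measure M {\<omega>\<in>space M. c < M.square_limit g g' \<theta> \<omega>} = \<alpha>"
  proof -
    have cw: "continuous_on {0..1} (\<lambda>v. (w v \<omega>)\<^sup>2)" if "\<omega> \<in> space N" for \<omega>
      by (intro continuous_intros N.W_continuous that)
    have "measure N {\<omega>\<in>space N. c < N.square_limit (\<lambda>_. 1) (\<lambda>_. 0) 1 \<omega>} = measure N {\<omega>\<in>space N. c < integral {0..1} (\<lambda>v. (w v \<omega>)\<^sup>2)}"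
    \<comment> \<open>The limit functionals subtract \<open>w 0\<close>, which vanishes only almost
      surely; the two events agree up to a null set.\<close>
    proof (rule measure_eq_AE)
      show "AE \<omega> in N. (\<omega> \<in> {\<omega>\<in>space N. c < N.square_limit (\<lambda>_. 1) (\<lambda>_. 0) 1 \<omega>}) = (\<omega> \<in> {\<omega>\<in>space N. c < integral {0..1} (\<lambda>v. (w v \<omega>)\<^sup>2)})"
        using N.W_0 by (rule AE_mp) (auto simp: N.unit_limits)
      have [measurable]: "N.square_limit (\<lambda>_. 1) (\<lambda>_. 0) 1 \<in> borel_measurable N"
        by (rule N.limit_measurable(1)[OF _ N1(1)]) simp
      show "{\<omega>\<in>space N. c < N.square_limit (\<lambda>_. 1) (\<lambda>_. 0) 1 \<omega>} \<in> sets N" by measurable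
      have [measurable]: "(\<lambda>\<omega>. integral {0..1} (\<lambda>v. (w v \<omega>)\<^sup>2)) \<in> borel_measurable N"
        using cw N.W_measurable by (intro borel_measurable_integral_path) auto
      show "{\<omega>\<in>space N. c < integral {0..1} (\<lambda>v. (w v \<omega>)\<^sup>2)} \<in> sets N" by measurable
    qed
    also have "{\<omega>\<in>space N. c < integral {0..1} (\<lambda>v. (w v \<omega>)\<^sup>2)} = {\<omega>\<in>space N. (LINT v:{0..1}|lborel. (w v \<omega>)\<^sup>2) > c}"
      using set_lebesgue_integral_Icc[OF cw] by auto
    finally show ?thesis using transfer_square[of "{c<..}"] assms(10) by simp
  qed
  have max_b: "measure M {\<omega>\<in>space M. b < M.max_limit g g' \<theta> \<omega>} = \<alpha>"
  proof -
    have cw: "continuous_on {0..1} (\<lambda>v. \<bar>w v \<omega>\<bar>)" if "\<omega> \<in> space N" for \<omega>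
      by (intro continuous_intros N.W_continuous that)
    have "measure N {\<omega>\<in>space N. b < N.max_limit (\<lambda>_. 1) (\<lambda>_. 0) 1 \<omega>} = measure N {\<omega>\<in>space N. b < (SUP v\<in>{0..1}. \<bar>w v \<omega>\<bar>)}"
    proof (rule measure_eq_AE)
      show "AE \<omega> in N. (\<omega> \<in> {\<omega>\<in>space N. b < N.max_limit (\<lambda>_. 1) (\<lambda>_. 0) 1 \<omega>}) = (\<omega> \<in> {\<omega>\<in>space N. b < (SUP v\<in>{0..1}. \<bar>w v \<omega>\<bar>)})"
        using N.W_0 by (rule AE_mp) (auto simp: N.unit_limits)
      have [measurable]: "N.max_limit (\<lambda>_. 1) (\<lambda>_. 0) 1 \<in> borel_measurable N"
        by (rule N.limit_measurable(2)[OF _ N1(1)]) simp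
      show "{\<omega>\<in>space N. b < N.max_limit (\<lambda>_. 1) (\<lambda>_. 0) 1 \<omega>} \<in> sets N" by measurable
      have [measurable]: "(\<lambda>\<omega>. SUP v\<in>{0..1}. \<bar>w v \<omega>\<bar>) \<in> borel_measurable N"
        using cw N.W_measurable by (intro borel_measurable_SUP_path) auto
      show "{\<omega>\<in>space N. b < (SUP v\<in>{0..1}. \<bar>w v \<omega>\<bar>)} \<in> sets N" by measurable
    qed
    then show ?thesis using transfer_max[of "{b<..}"] assms(11) by simp
  qed
  have square_atom: "measure M {\<omega>\<in>space M. M.square_limit g g' \<theta> \<omega> = c} = 0"
    using transfer_square[of "{c}"] N.prob_square_eq_0[OF refl, of c] by (simp add: N.unit_limits)
  have max_atom: "measure M {\<omega>\<in>space M. M.max_limit g g' \<theta> \<omega> = b} = 0"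
    using transfer_max[of "{b}"] N.prob_max_eq_0[OF refl, of b] by (simp add: N.unit_limits)

  define D1 where "D1 \<epsilon> \<omega> = integral {0..T} (\<lambda>t. (Y \<epsilon> \<omega> t)\<^sup>2 * (g t)\<^sup>2) / \<theta>\<^sup>2" for \<epsilon> \<omega>
  define D2 where "D2 \<epsilon> \<omega> = (SUP t\<in>{0..T}. \<bar>Y \<epsilon> \<omega> t\<bar>) / sqrt \<theta>" for \<epsilon> \<omega>
  have mD1: "D1 \<epsilon> \<in> borel_measurable M" if "0 < \<epsilon>" for \<epsilon>
  proof -
    have [measurable]: "(\<lambda>\<omega>. integral {0..T} (\<lambda>t. (Y \<epsilon> \<omega> t)\<^sup>2 * (g t)\<^sup>2)) \<in> borel_measurable M"
      using mY[OF that] cY[OF that] cg T by (intro borel_measurable_integral_path) (auto intro!: continuous_intros)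
    show ?thesis unfolding D1_def[abs_def] by measurable
  qed
  have mD2: "D2 \<epsilon> \<in> borel_measurable M" if "0 < \<epsilon>" for \<epsilon>
  proof -
    have [measurable]: "(\<lambda>\<omega>. SUP t\<in>{0..T}. \<bar>Y \<epsilon> \<omega> t\<bar>) \<in> borel_measurable M"
      using mY[OF that] cY[OF that] T by (intro borel_measurable_SUP_path) (auto intro!: continuous_intros)
    show ?thesis unfolding D2_def[abs_def] by measurable
  qed

  have "((\<lambda>\<epsilon>. measure M {\<omega>\<in>space M. c < D1 \<epsilon> \<omega>}) \<longlongrightarrow> measure M {\<omega>\<in>space M. c < M.square_limit g g' \<theta> \<omega>}) (at_right 0)"
  proof (rule M.prob_gt_tendsto_of_close[OF M.limit_measurable(1)[OF T(2) g] mD1 square_atom])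
    fix e \<eta> :: real assume e: "0 < e" and \<eta>: "0 < \<eta>"
    obtain K where K: "0 < K" "measure M {\<omega>\<in>space M. K < (SUP t\<in>{0..T}. \<bar>Z \<omega> t\<bar>)} \<le> \<eta> / 2"
      using M.prob_large_tendsto_0[OF mZ, of "\<eta> / 2"] \<eta> by auto
    define B2 where "B2 = {\<omega>\<in>space M. K < (SUP t\<in>{0..T}. \<bar>Z \<omega> t\<bar>)}"
    have B2: "B2 \<in> sets M" unfolding B2_def using mZ by measurable
    \<comment> \<open>Capping at 1 turns \<open>e' * (e' + 2 * K)\<close> into a bound linear in e';
      the two factors \<theta> by which \<open>D1\<close> is divided then leave e.\<close>
    define e' where "e' = min 1 (e * \<theta> / (1 + 2 * K))"
    have e': "0 < e'" "e' \<le> 1" "e' * (1 + 2 * K) \<le> e * \<theta>"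
    proof -
      show "0 < e'" "e' \<le> 1" using e \<theta> K(1) by (auto simp: e'_def)
      have "e' \<le> e * \<theta> / (1 + 2 * K)" by (simp add: e'_def)
      then show "e' * (1 + 2 * K) \<le> e * \<theta>" using K(1) by (simp add: le_divide_eq)
    qed
    obtain \<epsilon>0 where \<epsilon>0: "\<epsilon>0 > 0" "\<And>\<epsilon>. 0 < \<epsilon> \<Longrightarrow> \<epsilon> < \<epsilon>0 \<Longrightarrow> \<exists>B\<in>sets M. measure M B \<le> \<eta> / 2 \<and>
      (\<forall>\<omega>\<in>space M - B. \<forall>t\<in>{0..T}. \<bar>Y \<epsilon> \<omega> t - Z \<omega> t\<bar> \<le> e')"
      using close[of e' "\<eta> / 2"] e' \<eta> by auto
    have "\<exists>B\<in>sets M. measure M B \<le> \<eta> \<and> (\<forall>\<omega>\<in>space M - B. \<bar>D1 \<epsilon> \<omega> - M.square_limit g g' \<theta> \<omega>\<bar> \<le> e)"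
      if \<epsilon>: "0 < \<epsilon>" "\<epsilon> < \<epsilon>0" for \<epsilon>
    proof -
      obtain B where B: "B \<in> sets M" "measure M B \<le> \<eta> / 2"
        "\<And>\<omega> t. \<omega> \<in> space M \<Longrightarrow> \<omega> \<notin> B \<Longrightarrow> t \<in> {0..T} \<Longrightarrow> \<bar>Y \<epsilon> \<omega> t - Z \<omega> t\<bar> \<le> e'"
        using \<epsilon>0(2)[OF \<epsilon>] by blast
      have "measure M (B \<union> B2) \<le> measure M B + measure M B2" by (rule measure_Un_le[OF B(1) B2])
      then have "measure M (B \<union> B2) \<le> \<eta>" using B(2) K(2) by (simp add: B2_def)
      moreover have "\<bar>D1 \<epsilon> \<omega> - M.square_limit g g' \<theta> \<omega>\<bar> \<le> e" if \<omega>: "\<omega> \<in> space M - (B \<union> B2)" for \<omega>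
      proof -
        have \<omega>M: "\<omega> \<in> space M" using \<omega> by blast
        have ZK: "\<bar>Z \<omega> t\<bar> \<le> K" if "t \<in> {0..T}" for t
          using \<omega> le_SUP_Icc[OF caZ[OF \<omega>M] that] by (auto simp: B2_def)
        have "\<bar>integral {0..T} (\<lambda>t. (Y \<epsilon> \<omega> t)\<^sup>2 * (g t)\<^sup>2) - integral {0..T} (\<lambda>t. (Z \<omega> t)\<^sup>2 * (g t)\<^sup>2)\<bar>
            \<le> e' * (e' + 2 * K) * integral {0..T} (\<lambda>t. (g t)\<^sup>2)"
          by (rule integral_square_diff_le[OF T(2) cY[OF \<epsilon>(1) \<omega>M] cZ[OF \<omega>M]])
            (use B(3)[OF \<omega>M] \<omega> ZK cg in \<open>auto intro!: continuous_intros\<close>)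
        also have "\<dots> \<le> e * \<theta> * \<theta>"
        proof -
          have "e' * (e' + 2 * K) \<le> e' * (1 + 2 * K)" using e' by (intro mult_left_mono) auto
          then show ?thesis unfolding \<theta>_def[symmetric] using e'(3) \<theta> by (intro mult_right_mono) auto
        qed
        finally have "\<bar>integral {0..T} (\<lambda>t. (Y \<epsilon> \<omega> t)\<^sup>2 * (g t)\<^sup>2) - integral {0..T} (\<lambda>t. (Z \<omega> t)\<^sup>2 * (g t)\<^sup>2)\<bar> / \<theta>\<^sup>2 \<le> e"
          using \<theta> by (simp add: divide_le_eq power2_eq_square mult.assoc)
        then show ?thesis
          using \<theta> by (simp add: D1_def M.square_limit_def Z_def diff_divide_distrib[symmetric] abs_divide)
      qed
      ultimately show ?thesis using B(1) B2 by blast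
    qed
    then show "\<exists>\<epsilon>0>0. \<forall>\<epsilon>. 0 < \<epsilon> \<and> \<epsilon> < \<epsilon>0 \<longrightarrow> (\<exists>B\<in>sets M. measure M B \<le> \<eta> \<and> (\<forall>\<omega>\<in>space M - B. \<bar>D1 \<epsilon> \<omega> - M.square_limit g g' \<theta> \<omega>\<bar> \<le> e))"
      using \<epsilon>0(1) by blast
  qed
  then have lim1: "((\<lambda>\<epsilon>. measure M {\<omega>\<in>space M. c < D1 \<epsilon> \<omega>}) \<longlongrightarrow> \<alpha>) (at_right 0)"
    by (simp add: square_c)

  have "((\<lambda>\<epsilon>. measure M {\<omega>\<in>space M. b < D2 \<epsilon> \<omega>}) \<longlongrightarrow> measure M {\<omega>\<in>space M. b < M.max_limit g g' \<theta> \<omega>}) (at_right 0)"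
  proof (rule M.prob_gt_tendsto_of_close[OF M.limit_measurable(2)[OF T(2) g] mD2 max_atom])
    fix e \<eta> :: real assume e: "0 < e" and \<eta>: "0 < \<eta>"
    have bound: "\<bar>D2 \<epsilon> \<omega> - M.max_limit g g' \<theta> \<omega>\<bar> \<le> e"
      if \<epsilon>: "0 < \<epsilon>" and \<omega>: "\<omega> \<in> space M" and near: "\<forall>t\<in>{0..T}. \<bar>Y \<epsilon> \<omega> t - Z \<omega> t\<bar> \<le> e * sqrt \<theta>" for \<epsilon> \<omega>
    proof -
      have "\<bar>(SUP t\<in>{0..T}. \<bar>Y \<epsilon> \<omega> t\<bar>) - (SUP t\<in>{0..T}. \<bar>Z \<omega> t\<bar>)\<bar> \<le> e * sqrt \<theta>"
      proof (rule abs_SUP_diff_le[OF T(2) _ caZ[OF \<omega>]])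
        show "continuous_on {0..T} (\<lambda>t. \<bar>Y \<epsilon> \<omega> t\<bar>)" by (intro continuous_intros cY \<epsilon> \<omega>)
        fix t assume "t \<in> {0..T}"
        then show "\<bar>\<bar>Y \<epsilon> \<omega> t\<bar> - \<bar>Z \<omega> t\<bar>\<bar> \<le> e * sqrt \<theta>"
          using near abs_triangle_ineq3[of "Y \<epsilon> \<omega> t" "Z \<omega> t"] by fastforce
      qed
      then have "\<bar>(SUP t\<in>{0..T}. \<bar>Y \<epsilon> \<omega> t\<bar>) - (SUP t\<in>{0..T}. \<bar>Z \<omega> t\<bar>)\<bar> / sqrt \<theta> \<le> e"
        using \<theta> by (simp add: divide_le_eq)
      then show ?thesis
        using \<theta> by (simp add: D2_def M.max_limit_def Z_def diff_divide_distrib[symmetric] abs_divide)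
    qed
    obtain \<epsilon>0 where \<epsilon>0: "\<epsilon>0 > 0" "\<And>\<epsilon>. 0 < \<epsilon> \<Longrightarrow> \<epsilon> < \<epsilon>0 \<Longrightarrow> \<exists>B\<in>sets M. measure M B \<le> \<eta> \<and>
      (\<forall>\<omega>\<in>space M - B. \<forall>t\<in>{0..T}. \<bar>Y \<epsilon> \<omega> t - Z \<omega> t\<bar> \<le> e * sqrt \<theta>)"
      using close[of "e * sqrt \<theta>" \<eta>] e \<theta> \<eta> by auto
    have "\<exists>B\<in>sets M. measure M B \<le> \<eta> \<and> (\<forall>\<omega>\<in>space M - B. \<bar>D2 \<epsilon> \<omega> - M.max_limit g g' \<theta> \<omega>\<bar> \<le> e)"
      if "0 < \<epsilon>" "\<epsilon> < \<epsilon>0" for \<epsilon>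
      using \<epsilon>0(2)[OF that] bound[OF that(1)] by (meson DiffD1)
    then show "\<exists>\<epsilon>0>0. \<forall>\<epsilon>. 0 < \<epsilon> \<and> \<epsilon> < \<epsilon>0 \<longrightarrow> (\<exists>B\<in>sets M. measure M B \<le> \<eta> \<and> (\<forall>\<omega>\<in>space M - B. \<bar>D2 \<epsilon> \<omega> - M.max_limit g g' \<theta> \<omega>\<bar> \<le> e))"
      using \<epsilon>0(1) by blast
  qed
  then have lim2: "((\<lambda>\<epsilon>. measure M {\<omega>\<in>space M. b < D2 \<epsilon> \<omega>}) \<longlongrightarrow> \<alpha>) (at_right 0)"
    by (simp add: max_b)

  have stat1: "delta_stat T S0 \<sigma> x \<epsilon> (observation T (X \<epsilon>) \<omega>) = D1 \<epsilon> \<omega>" if \<epsilon>: "0 < \<epsilon>" and \<omega>: "\<omega> \<in> space M" for \<epsilon> \<omega>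
  proof -
    \<comment> \<open>Of the fourth power of S0 in the denominator, one square belongs to the
      rescaled deviation Y and the other joins the squared \<sigma> to form the squared g.\<close>
    have "(LINT t:{0..T}|lborel. ((observation T (X \<epsilon>) \<omega> t - x t) / (\<epsilon> * (S0 (x t))\<^sup>2))\<^sup>2 * (\<sigma> (x t))\<^sup>2)
        = (LINT t:{0..T}|lborel. (Y \<epsilon> \<omega> t)\<^sup>2 * (g t)\<^sup>2)"
    proof (rule set_lebesgue_integral_cong)
      show "\<forall>t. t \<in> {0..T} \<longrightarrow> ((observation T (X \<epsilon>) \<omega> t - x t) / (\<epsilon> * (S0 (x t))\<^sup>2))\<^sup>2 * (\<sigma> (x t))\<^sup>2 = (Y \<epsilon> \<omega> t)\<^sup>2 * (g t)\<^sup>2"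
        by (auto simp: observation_def Y_def g_def f_def power_mult_distrib power_divide power2_eq_square)
    qed simp
    also have "\<dots> = integral {0..T} (\<lambda>t. (Y \<epsilon> \<omega> t)\<^sup>2 * (g t)\<^sup>2)"
      by (intro set_lebesgue_integral_Icc continuous_intros cY cg \<epsilon> \<omega>)
    finally show ?thesis
      unfolding delta_stat_def \<theta>_eq D1_def using \<theta> by (simp add: powr_minus_divide)
  qed
  have stat2: "gamma_stat T S0 \<sigma> x \<epsilon> (observation T (X \<epsilon>) \<omega>) = D2 \<epsilon> \<omega>" for \<epsilon> \<omega>
  proof -
    have "(SUP t\<in>{0..T}. \<bar>(observation T (X \<epsilon>) \<omega> t - x t) / (\<epsilon> * S0 (x t))\<bar>) = (SUP t\<in>{0..T}. \<bar>Y \<epsilon> \<omega> t\<bar>)"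
      by (rule SUP_cong) (auto simp: observation_def Y_def f_def)
    then show ?thesis
      unfolding gamma_stat_def \<theta>_eq D2_def using \<theta> by (simp add: powr_minus_divide powr_half_sqrt)
  qed
  show ?thesis
    using M.indicator_test_of_size[of "delta_stat T S0 \<sigma> x" T X D1, OF stat1 mD1 lim1]
      M.indicator_test_of_size[of "gamma_stat T S0 \<sigma> x" T X D2, OF stat2 mD2 lim2] by blast
qed

end
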